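(* Let $T>0$, $I=(0,1)$, and let $G\subset[0,T]\times I$ be a (Lebesgue) measurable set. (Dirichlet) The following two properties are equivalent: (1) every weak solution $u$ of the Dirichlet problem $\partial_t^2u-\partial_x^2u=0$ on $[0,T]\times I$, $u(t,0)=u(t,1)=0$, $(u,\partial_tu)|_{t=0}=(u_0,u_1)\in H_0^1(I)\times L^2(I)$, with $\partial_tu=0$ a.e. on $G$ satisfies $u=0$; (2) $G$ satisfies both (OSC-D) and (Weak GCC). (Neumann) The following two properties are equivalent: (1) every weak solution $u$ of the Neumann problem $\partial_t^2u-\partial_x^2u=0$ on $[0,T]\times I$, $\partial_xu(t,0)=\partial_xu(t,1)=0$, $(u,\partial_tu)|_{t=0}=(u_0,u_1)\in H^1(I)\times L^2(I)$, with $\partial_tu=0$ a.e. on $G$ is constant; (2) $G$ satisfies both (OSC-N) and (Weak GCC).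
   Context: Weak solutions are taken in $C([0,T];H_0^1(I))\cap C^1([0,T];L^2(I))$ in the Dirichlet case and in $C([0,T];H^1(I))\cap C^1([0,T];L^2(I))$ in the Neumann case. Labelled double cover. $\widetilde I=I\times\{\xi,\eta\}$ with the natural Lebesgue measure $|\cdot|$, so $|\widetilde I|=2$. Its points are written $[x;\sigma]$, $x\in I$, $\sigma\in\{\xi,\eta\}$. Characteristics. $L_{[x;\xi]}$ (resp. $L_{[x;\eta]}$) is the characteristic line in $\{t\ge0\}$ starting from $(t,x)=(0,x)$ and moving initially to the right (resp. left) with unit speed, reflecting at the boundary points $x=0$ and $x=1$. Explicitly, with the $2$-periodic folding map $\pi:\mathbb R\to[0,1]$, $\pi(s)=s$ for $0\le s\le1$ and $\pi(s)=2-s$ for $1<s<2$, the point of $L_{[x;\xi]}$ at time $s$ is $L_{[x;\xi]}(s)=(s,\pi(x+s))$ and that of $L_{[x;\eta]}$ is $L_{[x;\eta]}(s)=(s,\pi(x-s))$, $s\ge0$. (Weak GCC). $G$ satisfies (Weak GCC) if for almost every $x\in[0,1]$ both sets $G\cap\{L_{[x;\eta]}(s):s\in[0,T]\}$ and $G\cap\{L_{[x;\xi]}(s):s\in[0,T]\}$ have positive one-dimensional measure. Intersection sets. For $\widetilde A\subset\widetilde I$, $$\mathcal M_{\widetilde A}=\{(t,x)\in[0,\infty)\times I:\ \exists\text{ distinct }\widetilde y,\widetilde z\in\widetilde A\text{ with }(t,x)\in L_{\widetilde y}\cap L_{\widetilde z}\},\qquad \mathcal M_{\widetilde A}(\tau)=\mathcal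 M_{\widetilde A}\cap\{t\le\tau\}.$$ For disjoint $\widetilde E,\widetilde F\subset\widetilde I$, $$\mathcal W_{\widetilde E,\widetilde F}=\{(t,x)\in[0,\infty)\times I:\ \exists\,\widetilde y\in\widetilde E,\ \widetilde z\in\widetilde F,\ \widetilde y\ne\widetilde z,\text{ with }(t,x)\in L_{\widetilde y}\cap L_{\widetilde z}\},\qquad \mathcal W_{\widetilde E,\widetilde F}(\tau)=\mathcal W_{\widetilde E,\widetilde F}\cap\{t\le\tau\}.$$ (OSC-D). For measurable $\widetilde A\subset\widetilde I$, $G$ is $(\widetilde A;T)$-observable symmetric if $G\setminus(\mathcal M_{\widetilde A}(T)\cup\mathcal M_{\widetilde I\setminus\widetilde A}(T))$ has two-dimensional Lebesgue measure $0$. $\widetilde A$ is trivial if $|\widetilde A|=0$ or $|\widetilde A|=2$, and nontrivial otherwise. $G$ satisfies (OSC-D) if for every nontrivial measurable $\widetilde A\subset\widetilde I$, $G$ is not $(\widetilde A;T)$-observable symmetric. (OSC-N). For disjoint measurable $\widetilde E,\widetilde F\subset\widetilde I$, $G$ is $(\widetilde E,\widetilde F;T)$-observable symmetric if $G\setminus(\mathcal W_{\widetilde E,\widetilde F}(T)\cup\mathcal M_{\widetilde I\setminus(\widetilde E\cup\widetilde F)}(T))$ has two-dimensional Lebesgue measure $0$. The pair $(\widetilde E,\widetilde F)$ is trivial if $|\widetilde E|=0$ or $|\widetilde F|=0$, and nontrivial otherwise. $G$ satisfies (OSC-N) if for every nontrivial pair of disjoint measurable sets $(\widetilde E,\widetilde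 F)$, $G$ is not $(\widetilde E,\widetilde F;T)$-observable symmetric. *)

theory Defs
  imports "HOL-Analysis.Analysis" "HOL-Library.Real_Mod"
begin

abbreviation I01 :: "real set" where
  "I01 \<equiv> {0<..<1}"

section \<open>Sobolev spaces on the unit interval\<close>

text \<open>
  Elements of the function spaces are represented by functions \<open>real \<Rightarrow> real\<close>, of which only the
  values on \<open>I01\<close> matter, up to null sets.
\<close>

definition L2 :: "(real \<Rightarrow> real) set" where
  "L2 = {f \<in> borel_measurable (lebesgue_on I01). integrable (lebesgue_on I01) (\<lambda>x. (f x)\<^sup>2)}"

definition L2_inner :: "(real \<Rightarrow> real) \<Rightarrow> (real \<Rightarrow> real) \<Rightarrow> real" where
  "L2_inner f g = (LINT x|lebesgue_on I01. f x * g x)"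

definition L2_norm :: "(real \<Rightarrow> real) \<Rightarrow> real" where
  "L2_norm f = sqrt (L2_inner f f)"

definition test_functions :: "(real \<Rightarrow> real) set" where
  "test_functions =
     {\<phi>. (\<forall>n x. (deriv ^^ n) \<phi> differentiable at x) \<and>
         (\<exists>K. compact K \<and> K \<subseteq> I01 \<and> (\<forall>x. x \<notin> K \<longrightarrow> \<phi> x = 0))}"

definition has_weak_deriv :: "(real \<Rightarrow> real) \<Rightarrow> (real \<Rightarrow> real) \<Rightarrow> bool" where
  "has_weak_deriv f g \<longleftrightarrow>
     f \<in> L2 \<and> g \<in> L2 \<and> (\<forall>\<phi>\<in>test_functions. L2_inner f (deriv \<phi>) = - L2_inner g \<phi>)"

definition H1 :: "(real \<Rightarrow> real) set" where
  "H1 = {f. \<exists>g. has_weak_deriv f g}"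

text \<open>The weak derivative is unique up to null sets, so the choice is immaterial.\<close>

definition weak_deriv :: "(real \<Rightarrow> real) \<Rightarrow> real \<Rightarrow> real" where
  "weak_deriv f = (SOME g. has_weak_deriv f g)"

definition H1_norm :: "(real \<Rightarrow> real) \<Rightarrow> real" where
  "H1_norm f = sqrt ((L2_norm f)\<^sup>2 + (L2_norm (weak_deriv f))\<^sup>2)"

text \<open>\<open>H10\<close> is the closure of the test functions in \<open>H1\<close>.\<close>

definition H10 :: "(real \<Rightarrow> real) set" where
  "H10 = {f \<in> H1. \<forall>e>0. \<exists>\<phi>\<in>test_functions. H1_norm (\<lambda>x. f x - \<phi> x) < e}"

section \<open>Weak solutions of the wave equation\<close>

text \<open>
  A curve \<open>w\<close> of functions is written \<open>w t x\<close>; \<open>N\<close> is the norm of the target space \<open>V\<close>.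
\<close>

definition continuous_curve ::
    "real \<Rightarrow> (real \<Rightarrow> real) set \<Rightarrow> ((real \<Rightarrow> real) \<Rightarrow> real) \<Rightarrow> (real \<Rightarrow> real \<Rightarrow> real) \<Rightarrow> bool" where
  "continuous_curve T V N w \<longleftrightarrow>
     (\<forall>t\<in>{0..T}. w t \<in> V) \<and>
     (\<forall>t\<in>{0..T}. ((\<lambda>s. N (\<lambda>x. w s x - w t x)) \<longlongrightarrow> 0) (at t within {0..T}))"

definition has_L2_time_deriv ::
    "real \<Rightarrow> (real \<Rightarrow> real \<Rightarrow> real) \<Rightarrow> (real \<Rightarrow> real \<Rightarrow> real) \<Rightarrow> bool" where
  "has_L2_time_deriv T u v \<longleftrightarrow>
     (\<forall>t\<in>{0..T}. ((\<lambda>s. L2_norm (\<lambda>x. (u s x - u t x) / (s - t) - v t x)) \<longlongrightarrow> 0)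
        (at t within {0..T}))"

text \<open>
  Weak solutions \<open>u\<close> in \<open>C([0,T];V) \<inter> C\<^sup>1([0,T];L2)\<close>, with \<open>v\<close> the time derivative of \<open>u\<close>. The equation
  is imposed in variational form with test space \<open>V\<close>. The boundary conditions are encoded by \<open>V\<close>:
  \<open>H10\<close> gives the Dirichlet problem, while \<open>H1\<close> gives the Neumann problem, whose boundary condition
  is the natural one of the variational form.
\<close>

definition weak_wave_solution ::
    "(real \<Rightarrow> real) set \<Rightarrow> real \<Rightarrow> (real \<Rightarrow> real) \<Rightarrow> (real \<Rightarrow> real) \<Rightarrow>
     (real \<Rightarrow> real \<Rightarrow> real) \<Rightarrow> (real \<Rightarrow> real \<Rightarrow> real) \<Rightarrow> bool" where
  "weak_wave_solution V T u0 u1 u v \<longleftrightarrow>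
     continuous_curve T V H1_norm u \<and>
     continuous_curve T L2 L2_norm v \<and>
     has_L2_time_deriv T u v \<and>
     (\<forall>w\<in>V. \<forall>t\<in>{0..T}.
        ((\<lambda>s. L2_inner (v s) w) has_real_derivative
           (- L2_inner (weak_deriv (u t)) (weak_deriv w))) (at t within {0..T})) \<and>
     (AE x in lebesgue_on I01. u 0 x = u0 x) \<and>
     (AE x in lebesgue_on I01. v 0 x = u1 x)"

text \<open>
  A curve in \<open>L2\<close> is a family of representatives chosen independently for each time, which need not be
  jointly measurable. Being zero almost everywhere on a subset of \<open>[0,T] \<times> I\<close> therefore refers to a
  jointly measurable representative; it exists for continuous curves and is unique up to null sets.
\<close>

definition vanishes_ae_on :: "real \<Rightarrow> (real \<times> real) set \<Rightarrow> (real \<Rightarrow> real \<Rightarrow> real) \<Rightarrow> bool" where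
  "vanishes_ae_on T G w \<longleftrightarrow>
     (\<exists>W \<in> borel_measurable (lebesgue_on ({0..T} \<times> I01)).
        (AE t in lebesgue_on {0..T}. AE x in lebesgue_on I01. W (t, x) = w t x) \<and>
        (AE p in lebesgue_on ({0..T} \<times> I01). p \<in> G \<longrightarrow> W p = 0))"

section \<open>Characteristics on the labelled double cover\<close>

datatype label = Xi | Eta

definition cover :: "(real \<times> label) measure" where
  "cover = lebesgue_on I01 \<Otimes>\<^sub>M count_space UNIV"

definition folding :: "real \<Rightarrow> real" where
  "folding s = (if s rmod 2 \<le> 1 then s rmod 2 else 2 - s rmod 2)"

fun char_pt :: "real \<times> label \<Rightarrow> real \<Rightarrow> real \<times> real" where
  "char_pt (x, Xi) s = (s, folding (x + s))"
| "char_pt (x, Eta) s = (s, folding (x - s))"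

definition char_line :: "real \<times> label \<Rightarrow> (real \<times> real) set" where
  "char_line y = char_pt y ` {0..}"

text \<open>
  One-dimensional measure (arc length) of the part of a set that lies on a characteristic. In the
  \<open>(t,x)\<close>-plane, the parametrisation \<open>char_pt y\<close> has Euclidean speed \<open>sqrt 2\<close>.
\<close>

definition line_measure :: "real \<times> label \<Rightarrow> (real \<times> real) set \<Rightarrow> ennreal" where
  "line_measure y S = ennreal (sqrt 2) * emeasure lebesgue {s. 0 \<le> s \<and> char_pt y s \<in> S}"

definition weak_GCC :: "real \<Rightarrow> (real \<times> real) set \<Rightarrow> bool" where
  "weak_GCC T G \<longleftrightarrow>
     (AE x in lebesgue_on {0..1}.
        line_measure (x, Eta) (G \<inter> char_pt (x, Eta) ` {0..T}) > 0 \<and>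
        line_measure (x, Xi) (G \<inter> char_pt (x, Xi) ` {0..T}) > 0)"

section \<open>Observable symmetry\<close>

definition M_set :: "(real \<times> label) set \<Rightarrow> (real \<times> real) set" where
  "M_set A = {p \<in> {0..} \<times> I01. \<exists>y\<in>A. \<exists>z\<in>A. y \<noteq> z \<and> p \<in> char_line y \<inter> char_line z}"

definition M_upto :: "(real \<times> label) set \<Rightarrow> real \<Rightarrow> (real \<times> real) set" where
  "M_upto A \<tau> = M_set A \<inter> {p. fst p \<le> \<tau>}"

definition W_set :: "(real \<times> label) set \<Rightarrow> (real \<times> label) set \<Rightarrow> (real \<times> real) set" where
  "W_set E F = {p \<in> {0..} \<times> I01. \<exists>y\<in>E. \<exists>z\<in>F. y \<noteq> z \<and> p \<in> char_line y \<inter> char_line z}"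

definition W_upto :: "(real \<times> label) set \<Rightarrow> (real \<times> label) set \<Rightarrow> real \<Rightarrow> (real \<times> real) set" where
  "W_upto E F \<tau> = W_set E F \<inter> {p. fst p \<le> \<tau>}"

definition observable_symmetric_D ::
    "real \<Rightarrow> (real \<times> real) set \<Rightarrow> (real \<times> label) set \<Rightarrow> bool" where
  "observable_symmetric_D T G A \<longleftrightarrow>
     G - (M_upto A T \<union> M_upto (space cover - A) T) \<in> null_sets lebesgue"

definition trivial_set :: "(real \<times> label) set \<Rightarrow> bool" where
  "trivial_set A \<longleftrightarrow> emeasure cover A = 0 \<or> emeasure cover A = 2"

definition OSC_D :: "real \<Rightarrow> (real \<times> real) set \<Rightarrow> bool" where
  "OSC_D T G \<longleftrightarrow> (\<forall>A\<in>sets cover. \<not> trivial_set A \<longrightarrow> \<not> observable_symmetric_D T G A)"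

definition observable_symmetric_N ::
    "real \<Rightarrow> (real \<times> real) set \<Rightarrow> (real \<times> label) set \<Rightarrow> (real \<times> label) set \<Rightarrow> bool" where
  "observable_symmetric_N T G E F \<longleftrightarrow>
     G - (W_upto E F T \<union> M_upto (space cover - (E \<union> F)) T) \<in> null_sets lebesgue"

definition trivial_pair :: "(real \<times> label) set \<Rightarrow> (real \<times> label) set \<Rightarrow> bool" where
  "trivial_pair E F \<longleftrightarrow> emeasure cover E = 0 \<or> emeasure cover F = 0"

definition OSC_N :: "real \<Rightarrow> (real \<times> real) set \<Rightarrow> bool" where
  "OSC_N T G \<longleftrightarrow>
     (\<forall>E\<in>sets cover. \<forall>F\<in>sets cover.
        E \<inter> F = {} \<and> \<not> trivial_pair E F \<longrightarrow> \<not> observable_symmetric_N T G E F)"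

end

theory Submission
  imports Defs
begin

text \<open>
  Parametrise the labelled double cover by the circle \<open>\<real>/2\<int>\<close>, letting \<open>[x;\<xi>]\<close> correspond to \<open>x\<close>
  and \<open>[x;\<eta>]\<close> to \<open>- x\<close>; the characteristics through \<open>(t,x)\<close> then start from \<open>x - t\<close> and \<open>- x - t\<close>.
  By d'Alembert's formula the velocities \<open>\<partial>\<^sub>t u\<close> of the weak solutions are exactly
  \<open>g (- x - t) + \<kappa> g (x - t)\<close> with \<open>g\<close> square integrable on the circle, where \<open>\<kappa> = - 1\<close> in the Dirichlet
  case and \<open>\<kappa> = 1\<close> in the Neumann case. So \<open>\<partial>\<^sub>t u = 0\<close> on \<open>G\<close> is a relation between the values of \<open>g\<close> at
  the two labels of almost every point of \<open>G\<close>. For \<open>\<kappa> = - 1\<close> the level sets \<open>{g > q}\<close> are observable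
  symmetric; for \<open>\<kappa> = 1\<close> so is the pair \<open>{g > 0}, {g < 0}\<close>, which leaves a \<open>g\<close> of one sign that vanishes
  at both labels of almost every point of \<open>G\<close>, hence almost everywhere by (Weak GCC). Conversely,
  indicator functions of symmetric sets, or of the set of unobserved characteristics, are profiles of
  solutions that are not observed on \<open>G\<close>.

  That every weak solution has this form follows by comparing Fourier coefficients: those of \<open>\<partial>\<^sub>t u\<close> and
  \<open>\<partial>\<^sub>x u\<close> solve a rotation equation, which is the variational equation tested with an eigenfunction.
\<close>

subsection \<open>Square integrable functions\<close>

text \<open>Integrations by parts have no boundary terms because one factor always lies in
  \<open>H10\<close>: the solution or the test function for Dirichlet conditions, the time integral
  of the slope or a sine mode for Neumann conditions. A weak solution is only once differentiable in
  time with values in \<open>L2\<close>, so its slope cannot be differentiated in time; the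
  coefficients of the slope can, once the space derivative has been moved to the mode. Explicit
  solutions use bounded profiles, for which L1 estimates suffice; a given solution yields only a
  square integrable profile, which is handled through its coefficients alone. For \<kappa> = - 1 the
  displacement vanishes at \<open>x = 1\<close> only for profiles of mean zero. Subtracting a
  constant achieves this without changing the velocity, but it makes constant profiles invisible,
  which is why the unobserved set is cut into halves. \<open>G\<close> is merely Lebesgue
  measurable, so its sections along characteristics may be bad; Fubini is applied to a Borel core.
  Null sets pass between circle and plane because at each fixed time the starting points of the
  characteristics through the interval fill the circle exactly once, up to null sets.\<close>

abbreviation LI :: "real measure" where
  "LI \<equiv> lebesgue_on I01"

lemma finite_measure_LI: "finite_measure LI"
  by (rule finite_measure_lebesgue_on) simp

interpretation LI: finite_measure LI
  by (rule finite_measure_LI)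

lemma L2_measurable: "f \<in> L2 \<Longrightarrow> f \<in> borel_measurable LI"
  by (simp add: L2_def)

lemma L2_square_integrable: "f \<in> L2 \<Longrightarrow> integrable LI (\<lambda>x. (f x)\<^sup>2)"
  by (simp add: L2_def)

lemma L2_mult_integrable:
  assumes "f \<in> L2" "g \<in> L2"
  shows "integrable LI (\<lambda>x. f x * g x)"
proof (rule Bochner_Integration.integrable_bound)
  show "integrable LI (\<lambda>x. (f x)\<^sup>2 + (g x)\<^sup>2)"
    using assms by (simp add: L2_def)
  show "(\<lambda>x. f x * g x) \<in> borel_measurable LI"
    using assms[THEN L2_measurable] by simp
  have "\<bar>a * b\<bar> \<le> a\<^sup>2 + b\<^sup>2" for a b :: real
    using sum_squares_bound[of "\<bar>a\<bar>" "\<bar>b\<bar>"] mult_nonneg_nonneg[of "\<bar>a\<bar>" "\<bar>b\<bar>"] by (auto simp: abs_mult simp del: mult_nonneg_nonneg)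
  then show "AE x in LI. norm (f x * g x) \<le> norm ((f x)\<^sup>2 + (g x)\<^sup>2)"
    by simp
qed

lemma L2_bounded:
  assumes "f \<in> borel_measurable LI" "\<And>x. x \<in> I01 \<Longrightarrow> \<bar>f x\<bar> \<le> B"
  shows "f \<in> L2"
proof -
  have "integrable LI (\<lambda>x. (f x)\<^sup>2)"
  proof (rule LI.integrable_const_bound[where B = "B\<^sup>2"])
    show "AE x in LI. norm ((f x)\<^sup>2) \<le> B\<^sup>2"
    proof (rule AE_I2)
      fix x assume "x \<in> space LI"
      with assms(2) have "\<bar>f x\<bar>^2 \<le> B^2" by (intro power_mono) auto
      then show "norm ((f x)\<^sup>2) \<le> B\<^sup>2" by simp
    qed
  qed (use assms in simp)
  with assms show ?thesis by (simp add: L2_def)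
qed

lemma L2_zero: "(\<lambda>x. 0) \<in> L2" by (rule L2_bounded[of _ 0]) auto

lemma L2_const: "(\<lambda>x. c) \<in> L2" by (rule L2_bounded[of _ "\<bar>c\<bar>"]) auto

lemma L2_integrable: "f \<in> L2 \<Longrightarrow> integrable LI f"
  using L2_mult_integrable[OF _ L2_const[of 1]] by simp

lemma L2_add: assumes "f \<in> L2" "g \<in> L2" shows "(\<lambda>x. f x + g x) \<in> L2"
  using assms L2_mult_integrable[OF assms] by (auto simp: L2_def power2_sum mult.assoc)

lemma L2_scale: "f \<in> L2 \<Longrightarrow> (\<lambda>x. c * f x) \<in> L2"
  by (auto simp: L2_def power_mult_distrib)

lemma L2_diff: assumes "f \<in> L2" "g \<in> L2" shows "(\<lambda>x. f x - g x) \<in> L2"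
  using L2_add[OF assms(1) L2_scale[OF assms(2), of "-1"]] by simp

lemma L2_inner_commute: "L2_inner f g = L2_inner g f"
  by (simp add: L2_inner_def mult.commute)

lemma L2_inner_add_left:
  "\<lbrakk>f \<in> L2; g \<in> L2; h \<in> L2\<rbrakk> \<Longrightarrow> L2_inner (\<lambda>x. f x + g x) h = L2_inner f h + L2_inner g h"
  by (simp add: L2_inner_def distrib_right L2_mult_integrable)

lemma L2_inner_diff_left:
  "\<lbrakk>f \<in> L2; g \<in> L2; h \<in> L2\<rbrakk> \<Longrightarrow> L2_inner (\<lambda>x. f x - g x) h = L2_inner f h - L2_inner g h"
  by (simp add: L2_inner_def left_diff_distrib L2_mult_integrable)

lemma L2_inner_scale_left: "L2_inner (\<lambda>x. c * f x) h = c * L2_inner f h"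
  by (simp add: L2_inner_def mult.assoc)

lemma L2_inner_cong_AE:
  assumes "AE x in LI. f x = f' x" "AE x in LI. g x = g' x"
    "f \<in> borel_measurable LI" "f' \<in> borel_measurable LI" "g \<in> borel_measurable LI" "g' \<in> borel_measurable LI"
  shows "L2_inner f g = L2_inner f' g'"
  unfolding L2_inner_def using assms by (intro integral_cong_AE) auto

lemma L2_inner_self_nonneg: "0 \<le> L2_inner f f"
  by (simp add: L2_inner_def)

lemma L2_norm_nonneg: "0 \<le> L2_norm f"
  by (simp add: L2_norm_def L2_inner_self_nonneg)

lemma L2_norm_sq: "(L2_norm f)\<^sup>2 = L2_inner f f"
  by (simp add: L2_norm_def L2_inner_self_nonneg)

lemma L2_norm_cong_AE:
  assumes "AE x in LI. f x = f' x" "f \<in> borel_measurable LI" "f' \<in> borel_measurable LI"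
  shows "L2_norm f = L2_norm f'"
  unfolding L2_norm_def using assms by (subst L2_inner_cong_AE[of f f' f f']) auto

lemma L2_norm_scale: "L2_norm (\<lambda>x. c * f x) = \<bar>c\<bar> * L2_norm f"
proof -
  have "L2_inner (\<lambda>x. c * f x) (\<lambda>x. c * f x) = c\<^sup>2 * L2_inner f f"
    by (simp add: L2_inner_scale_left L2_inner_commute[of f "\<lambda>x. c * f x"] power2_eq_square)
  then show ?thesis by (simp add: L2_norm_def real_sqrt_mult)
qed

lemma L2_norm_minus: "L2_norm (\<lambda>x. - f x) = L2_norm f"
  using L2_norm_scale[of "-1" f] by simp

lemma L2_Cauchy_Schwarz:
  assumes f: "f \<in> L2" and g: "g \<in> L2"
  shows "\<bar>L2_inner f g\<bar> \<le> L2_norm f * L2_norm g"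
proof -
  have *: "0 \<le> s\<^sup>2 * L2_inner f f - 2 * s * t * L2_inner f g + t\<^sup>2 * L2_inner g g" for s t
  proof -
    have "L2_inner (\<lambda>x. s * f x - t * g x) (\<lambda>x. s * f x - t * g x)
        = s * L2_inner f (\<lambda>x. s * f x - t * g x) - t * L2_inner g (\<lambda>x. s * f x - t * g x)"
      using f g by (subst L2_inner_diff_left) (auto intro: L2_scale L2_diff simp: L2_inner_scale_left)
    also have "L2_inner f (\<lambda>x. s * f x - t * g x) = s * L2_inner f f - t * L2_inner f g"
      using f g by (subst L2_inner_commute, subst L2_inner_diff_left)
        (auto intro: L2_scale L2_diff simp: L2_inner_scale_left L2_inner_commute)
    also have "L2_inner g (\<lambda>x. s * f x - t * g x) = s * L2_inner f g - t * L2_inner g g"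
      using f g by (subst L2_inner_commute, subst L2_inner_diff_left)
        (auto intro: L2_scale L2_diff simp: L2_inner_scale_left)
    finally show ?thesis
      using L2_inner_self_nonneg[of "\<lambda>x. s * f x - t * g x"]
      by (simp add: algebra_simps power2_eq_square)
  qed
  have "(L2_inner f g)\<^sup>2 \<le> L2_inner f f * L2_inner g g"
  proof (cases "L2_inner g g = 0")
    case True
    have "L2_inner f g = 0"
    proof (rule ccontr)
      assume "L2_inner f g \<noteq> 0"
      \<comment> \<open>In this degenerate case the quadratic form is affine in \<open>t\<close>;
        the chosen value of \<open>t\<close> would make it equal to -1.\<close>
      moreover have "0 \<le> L2_inner f f - 2 * ((L2_inner f f + 1) / (2 * L2_inner f g)) * L2_inner f g"
        using *[of 1 "(L2_inner f f + 1) / (2 * L2_inner f g)"] True by simp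
      ultimately show False by simp
    qed
    with True show ?thesis by simp
  next
    case False
    then have pos: "L2_inner g g > 0" using L2_inner_self_nonneg[of g] by simp
    have "0 \<le> L2_inner g g * (L2_inner f f * L2_inner g g - (L2_inner f g)\<^sup>2)"
      using *[of "L2_inner g g" "L2_inner f g"] by (simp add: algebra_simps power2_eq_square)
    with pos show ?thesis by (simp add: zero_le_mult_iff)
  qed
  then have "sqrt ((L2_inner f g)\<^sup>2) \<le> sqrt (L2_inner f f * L2_inner g g)"
    by (rule real_sqrt_le_mono)
  then show ?thesis by (simp add: L2_norm_def real_sqrt_mult)
qed

lemma L2_norm_triangle:
  assumes f: "f \<in> L2" and g: "g \<in> L2"
  shows "L2_norm (\<lambda>x. f x + g x) \<le> L2_norm f + L2_norm g"
proof (rule power2_le_imp_le)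
  have "(L2_norm (\<lambda>x. f x + g x))\<^sup>2 = L2_inner f f + 2 * L2_inner f g + L2_inner g g"
    using f g by (simp add: L2_norm_sq L2_inner_add_left L2_add
      L2_inner_commute[of f "\<lambda>x. f x + g x"] L2_inner_commute[of g "\<lambda>x. f x + g x"] L2_inner_commute[of g f])
  also have "\<dots> \<le> L2_inner f f + 2 * (L2_norm f * L2_norm g) + L2_inner g g"
    using L2_Cauchy_Schwarz[OF f g] by simp
  also have "\<dots> = (L2_norm f + L2_norm g)\<^sup>2"
    by (simp add: power2_sum L2_norm_sq)
  finally show "(L2_norm (\<lambda>x. f x + g x))\<^sup>2 \<le> (L2_norm f + L2_norm g)\<^sup>2" .
qed (simp add: L2_norm_nonneg)

lemma L2_norm_eq_0_AE:
  assumes "f \<in> L2" "L2_norm f = 0"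
  shows "AE x in LI. f x = 0"
proof -
  have "(LINT x|LI. (f x)\<^sup>2) = 0"
    using assms(2) by (simp add: L2_norm_def L2_inner_def power2_eq_square)
  then have "AE x in LI. (f x)\<^sup>2 = 0"
    using assms(1) by (subst (asm) integral_nonneg_eq_0_iff_AE) (auto simp: L2_def)
  then show ?thesis by simp
qed

lemma L2_norm_bounded:
  assumes "f \<in> borel_measurable LI" "\<And>x. x \<in> I01 \<Longrightarrow> \<bar>f x\<bar> \<le> B" "0 \<le> B"
  shows "L2_norm f \<le> B"
proof -
  have "L2_inner f f \<le> (LINT x|LI. B\<^sup>2)"
    unfolding L2_inner_def
  proof (rule integral_mono)
    show "integrable LI (\<lambda>x. f x * f x)"
      using L2_bounded[OF assms(1,2)] by (intro L2_mult_integrable)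
    fix x assume "x \<in> space LI"
    then have "\<bar>f x\<bar>^2 \<le> B^2" using assms by (intro power_mono) auto
    then show "f x * f x \<le> B\<^sup>2" by (simp add: power2_eq_square)
  qed simp
  also have "\<dots> = B\<^sup>2" by (simp add: measure_restrict_space)
  finally show ?thesis using assms(3) by (simp add: L2_norm_def real_le_lsqrt)
qed

text \<open>Interpolation between L1 and the supremum norm: along a uniformly bounded family,
  smallness in L1 gives smallness in \<open>L2_norm\<close>. Translation estimates can therefore be
  carried out in L1, where substitution and Fubini act directly.\<close>

lemma L2_norm_le_L1:
  assumes "f \<in> borel_measurable LI" "\<And>x. x \<in> I01 \<Longrightarrow> \<bar>f x\<bar> \<le> B"
  shows "(L2_norm f)\<^sup>2 \<le> B * (LINT x|LI. \<bar>f x\<bar>)"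
proof -
  have f: "f \<in> L2" using L2_bounded[OF assms] .
  have "(L2_norm f)\<^sup>2 \<le> (LINT x|LI. B * \<bar>f x\<bar>)"
    unfolding L2_norm_sq unfolding L2_inner_def
  proof (rule integral_mono)
    fix x assume "x \<in> space LI"
    then have "\<bar>f x\<bar> * \<bar>f x\<bar> \<le> B * \<bar>f x\<bar>" using assms(2) by (intro mult_right_mono) auto
    then show "f x * f x \<le> B * \<bar>f x\<bar>" by simp
  qed (use f L2_integrable L2_mult_integrable in auto)
  then show ?thesis by simp
qed

lemma L2_norm_tendsto_0:
  fixes f :: "nat \<Rightarrow> real \<Rightarrow> real"
  assumes m: "\<And>n. f n \<in> borel_measurable LI" and b: "\<And>n x. x \<in> I01 \<Longrightarrow> \<bar>f n x\<bar> \<le> B"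
    and l: "AE x in LI. (\<lambda>n. f n x) \<longlonglongrightarrow> 0"
  shows "(\<lambda>n. L2_norm (f n)) \<longlonglongrightarrow> 0"
proof -
  have "(\<lambda>n. LINT x|LI. f n x * f n x) \<longlonglongrightarrow> (LINT x|LI. 0)"
  proof (rule integral_dominated_convergence[where w = "\<lambda>x. B * B"])
    show "AE x in LI. (\<lambda>n. f n x * f n x) \<longlonglongrightarrow> 0"
      using l by eventually_elim (auto intro: tendsto_mult_zero)
    fix n
    show "AE x in LI. norm (f n x * f n x) \<le> B * B"
    proof (rule AE_I2)
      fix x assume "x \<in> space LI"
      then have *: "\<bar>f n x\<bar> \<le> B" using b by auto
      then show "norm (f n x * f n x) \<le> B * B"
        unfolding real_norm_def abs_mult by (intro mult_mono) (use order_trans[OF abs_ge_zero *] in auto)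
    qed
  qed (use m in auto)
  then have "(\<lambda>n. L2_inner (f n) (f n)) \<longlonglongrightarrow> 0" by (simp add: L2_inner_def)
  from tendsto_real_sqrt[OF this] show ?thesis by (simp add: L2_norm_def)
qed

subsection \<open>Smooth functions and test functions\<close>

text \<open>Closed under differentiation, so that its members have derivatives of all orders.\<close>

definition flat_exp :: "real poly \<Rightarrow> real \<Rightarrow> real" where
  "flat_exp p y = (if y > 0 then poly p (1 / y) * exp (- (1 / y)) else 0)"

inductive_set smooth_alg :: "(real \<Rightarrow> real) set" where
  smooth_const: "(\<lambda>x. c) \<in> smooth_alg"
| smooth_id: "(\<lambda>x. x) \<in> smooth_alg"
| smooth_flat: "(\<lambda>x. flat_exp p (a * x + b)) \<in> smooth_alg"
| smooth_add: "\<lbrakk>f \<in> smooth_alg; g \<in> smooth_alg\<rbrakk> \<Longrightarrow> (\<lambda>x. f x + g x) \<in> smooth_alg"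
| smooth_mult: "\<lbrakk>f \<in> smooth_alg; g \<in> smooth_alg\<rbrakk> \<Longrightarrow> (\<lambda>x. f x * g x) \<in> smooth_alg"

lemma poly_mult_exp_minus_tendsto_0: "((\<lambda>z. z ^ k * poly p z * exp (- z)) \<longlongrightarrow> (0::real)) at_top"
proof (induction p arbitrary: k)
  case 0
  then show ?case by simp
next
  case (pCons a p)
  have "((\<lambda>z. a * (z ^ k / exp z) + z ^ Suc k * poly p z * exp (- z)) \<longlongrightarrow> a * 0 + 0) at_top"
    by (intro tendsto_intros tendsto_power_div_exp_0 pCons.IH)
  then show ?case by (simp add: algebra_simps exp_minus field_simps)
qed

text \<open>For \<open>y > 0\<close> the product rule gives \<open>(1 / y)^2\<close> times
  \<open>p - p'\<close> at \<open>1 / y\<close>, times the exponential, hence the factor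
  \<open>[:0, 0, 1:]\<close>. At 0 the right difference quotient tends to 0 because the exponential
  beats every polynomial in \<open>1 / y\<close>.\<close>

lemma flat_exp_deriv:
  "(flat_exp p has_real_derivative flat_exp ([:0, 0, 1:] * (p - pderiv p)) y) (at y)"
proof (cases y "0::real" rule: linorder_cases)
  case less
  have "((\<lambda>_. 0) has_real_derivative 0) (at y)" by simp
  moreover have "eventually (\<lambda>x. flat_exp p x = 0) (nhds y)"
    using eventually_nhds_in_open[of "{..<0}" y] less
    by (rule_tac eventually_mono[OF eventually_nhds_in_open[of "{..<0}" y]]) (auto simp: flat_exp_def)
  ultimately show ?thesis using less by (subst DERIV_cong_ev[OF refl _ refl]) (auto simp: flat_exp_def)
next
  case greater
  have "((\<lambda>y. poly p (1 / y) * exp (- (1 / y))) has_real_derivative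
      flat_exp ([:0, 0, 1:] * (p - pderiv p)) y) (at y)"
  proof -
    have i: "((\<lambda>y. 1 / y) has_real_derivative - (1 / y * (1 / y))) (at y)"
      using greater by (auto intro!: derivative_eq_intros simp: field_simps power2_eq_square)
    have "((\<lambda>y. poly p (1 / y) * exp (- (1 / y))) has_real_derivative
        (poly (pderiv p) (1 / y) * - (1 / y * (1 / y))) * exp (- (1 / y))
        + exp (- (1 / y)) * - (- (1 / y * (1 / y))) * poly p (1 / y)) (at y)"
      by (intro DERIV_mult DERIV_chain2[OF poly_DERIV i] DERIV_chain2[OF DERIV_exp] DERIV_minus i)
    then show ?thesis
      by (rule DERIV_cong) (use greater in \<open>simp add: flat_exp_def field_simps\<close>)
  qed
  moreover have "eventually (\<lambda>x. flat_exp p x = poly p (1 / x) * exp (- (1 / x))) (nhds y)"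
    using greater
    by (rule_tac eventually_mono[OF eventually_nhds_in_open[of "{0<..}" y]]) (auto simp: flat_exp_def)
  ultimately show ?thesis by (subst DERIV_cong_ev[OF refl _ refl]) auto
next
  case equal
  have 1: "((\<lambda>h. flat_exp p h / h) \<longlongrightarrow> 0) (at_left 0)"
    by (rule tendsto_eventually) (auto simp: flat_exp_def eventually_at_filter)
  have 2: "((\<lambda>h. flat_exp p h / h) \<longlongrightarrow> 0) (at_right 0)"
  proof -
    have "((\<lambda>h. (inverse h) ^ 1 * poly p (inverse h) * exp (- (inverse h))) \<longlongrightarrow> (0::real)) (at_right 0)"
      by (rule filterlim_compose[OF poly_mult_exp_minus_tendsto_0 filterlim_inverse_at_top_right])
    then show ?thesis
      by (rule Lim_transform_eventually, rule_tac eventually_mono[OF eventually_at_right_less])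
         (auto simp: flat_exp_def field_simps)
  qed
  have "((\<lambda>h. flat_exp p h / h) \<longlongrightarrow> 0) (at 0)"
    using 1 2 by (simp add: filterlim_split_at)
  then show ?thesis using equal by (simp add: DERIV_def flat_exp_def)
qed

lemma smooth_alg_deriv:
  "f \<in> smooth_alg \<Longrightarrow> \<exists>f'\<in>smooth_alg. \<forall>x. (f has_real_derivative f' x) (at x)"
proof (induction rule: smooth_alg.induct)
  case (smooth_const c)
  then show ?case by (intro bexI[of _ "\<lambda>x. 0"]) (auto intro: smooth_alg.intros)
next
  case smooth_id
  then show ?case by (intro bexI[of _ "\<lambda>x. 1"]) (auto intro: smooth_alg.intros)
next
  case (smooth_flat p a b)
  let ?q = "[:0, 0, 1:] * (p - pderiv p)"
  have "((\<lambda>x. flat_exp p (a * x + b)) has_real_derivative a * flat_exp ?q (a * x + b)) (at x)" for x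
  proof -
    have "((\<lambda>x. a * x + b) has_real_derivative a) (at x)"
      by (auto intro!: derivative_eq_intros)
    from DERIV_chain2[OF flat_exp_deriv this, of p] show ?thesis by (simp add: mult.commute)
  qed
  moreover have "(\<lambda>x. a * flat_exp ?q (a * x + b)) \<in> smooth_alg"
    by (intro smooth_alg.smooth_mult smooth_alg.smooth_const smooth_alg.smooth_flat)
  ultimately show ?case by (intro bexI[of _ "\<lambda>x. a * flat_exp ?q (a * x + b)"] allI)
next
  case (smooth_add f g)
  then obtain f' g' where "f' \<in> smooth_alg" "g' \<in> smooth_alg"
    "\<And>x. (f has_real_derivative f' x) (at x)" "\<And>x. (g has_real_derivative g' x) (at x)" by blast
  then show ?case
    by (intro bexI[of _ "\<lambda>x. f' x + g' x"]) (auto intro: smooth_alg.intros derivative_eq_intros)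
next
  case (smooth_mult f g)
  then obtain f' g' where "f' \<in> smooth_alg" "g' \<in> smooth_alg"
    "\<And>x. (f has_real_derivative f' x) (at x)" "\<And>x. (g has_real_derivative g' x) (at x)" by blast
  with smooth_mult.hyps show ?case
    by (intro bexI[of _ "\<lambda>x. f' x * g x + f x * g' x"])
       (auto intro!: smooth_alg.intros derivative_eq_intros)
qed

lemma smooth_alg_iterated_deriv: "f \<in> smooth_alg \<Longrightarrow> (deriv ^^ n) f \<in> smooth_alg"
proof (induction n)
  case (Suc n)
  then obtain f' where f': "f' \<in> smooth_alg" "\<And>x. ((deriv ^^ n) f has_real_derivative f' x) (at x)"
    using smooth_alg_deriv by blast
  then have "deriv ((deriv ^^ n) f) = f'" using DERIV_imp_deriv by blast
  with f' show ?case by simp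
qed simp

lemma smooth_alg_imp_test_function:
  assumes "f \<in> smooth_alg" "0 < a" "b < 1" "\<And>x. x \<notin> {a..b} \<Longrightarrow> f x = 0"
  shows "f \<in> test_functions"
proof -
  have "(deriv ^^ n) f differentiable at x" for n x
    using smooth_alg_deriv[OF smooth_alg_iterated_deriv[OF assms(1), of n]] real_differentiable_def by blast
  then show ?thesis unfolding test_functions_def
    using assms by (auto intro!: exI[of _ "{a..b}"])
qed

lemma smooth_alg_poly: "poly p \<in> smooth_alg"
proof (induction p)
  case (pCons a p)
  have "(\<lambda>x. a + x * poly p x) \<in> smooth_alg"
    by (intro smooth_alg.smooth_add smooth_alg.smooth_mult smooth_alg.smooth_const smooth_alg.smooth_id pCons.IH)
  moreover have "poly (pCons a p) = (\<lambda>x. a + x * poly p x)" by auto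
  ultimately show ?case by simp
qed (simp add: smooth_const)

text \<open>With \<open>m = n + 3\<close> the two arguments are \<open>m * (m * x - 1)\<close> and
  \<open>m * (m * (1 - x) - 1)\<close>. They are both positive exactly for x strictly between
  \<open>1 / m\<close> and \<open>1 - 1 / m\<close>, an interval that the shift by 3 makes nonempty
  for every \<open>n\<close>. At a fixed interior point they grow quadratically in \<open>m\<close>,
  so the bumps tend to 1 without any normalisation.\<close>

definition bump :: "nat \<Rightarrow> real \<Rightarrow> real" where
  "bump n x = flat_exp 1 (real (n + 3)^2 * x + (- real (n + 3))) *
     flat_exp 1 ((- (real (n + 3)^2)) * x + (real (n + 3)^2 - real (n + 3)))"

lemma bump_smooth: "bump n \<in> smooth_alg"
  unfolding bump_def[abs_def] by (intro smooth_mult smooth_flat)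

lemma flat_exp_1_bounds: "0 \<le> flat_exp 1 y" "flat_exp 1 y \<le> 1"
  by (auto simp: flat_exp_def)

lemma bump_bounds: "0 \<le> bump n x" "bump n x \<le> 1"
  unfolding bump_def by (intro mult_nonneg_nonneg mult_le_one flat_exp_1_bounds)+

lemma bump_support:
  assumes "x \<notin> {1 / real (n + 3) .. 1 - 1 / real (n + 3)}" shows "bump n x = 0"
proof -
  let ?m = "real (n + 3)"
  have m: "?m > 0" by simp
  consider "x < 1 / ?m" | "x > 1 - 1 / ?m" using assms by fastforce
  then show ?thesis
  proof cases
    case 1
    with m have "?m^2 * x \<le> ?m^2 * (1 / ?m)" by (intro mult_left_mono) auto
    also have "\<dots> = ?m" using m by (simp add: power2_eq_square)
    finally show ?thesis by (simp add: bump_def flat_exp_def)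
  next
    case 2
    with m have "?m^2 * x \<ge> ?m^2 * (1 - 1 / ?m)" by (intro mult_left_mono) auto
    also have "?m^2 * (1 - 1 / ?m) = ?m^2 - ?m" using m by (simp add: power2_eq_square right_diff_distrib)
    finally show ?thesis by (simp add: bump_def flat_exp_def)
  qed
qed

lemma smooth_mult_bump_test:
  assumes "f \<in> smooth_alg" shows "(\<lambda>x. f x * bump n x) \<in> test_functions"
proof (rule smooth_alg_imp_test_function)
  show "(\<lambda>x. f x * bump n x) \<in> smooth_alg" by (intro smooth_mult assms bump_smooth)
  show "0 < 1 / real (n + 3)" "1 - 1 / real (n + 3) < 1" by auto
  show "f x * bump n x = 0" if "x \<notin> {1 / real (n + 3)..1 - 1 / real (n + 3)}" for x
    using bump_support[OF that] by simp
qed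

lemma flat_exp_1_tendsto_1: "(flat_exp 1 \<longlongrightarrow> 1) at_top"
proof -
  have "((\<lambda>y::real. exp (- (inverse y))) \<longlongrightarrow> exp (- 0)) at_top"
    by (intro tendsto_intros tendsto_inverse_0_at_top filterlim_ident)
  then have "((\<lambda>y::real. exp (- (inverse y))) \<longlongrightarrow> 1) at_top" by simp
  then show ?thesis
    by (rule Lim_transform_eventually)
      (rule eventually_mono[OF eventually_gt_at_top[of 0]], auto simp: flat_exp_def field_simps)
qed

lemma filterlim_quadratic_at_top:
  assumes "c > 0" shows "filterlim (\<lambda>n. real (n + 3)^2 * c - real (n + 3)) at_top sequentially"
proof -
  have 1: "filterlim (\<lambda>n. real (n + 3)) at_top sequentially"
    by (rule filterlim_compose[OF filterlim_real_sequentially filterlim_add_const_nat_at_top])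
  have 2: "filterlim (\<lambda>n. real (n + 3) * c + -1) at_top sequentially"
    by (subst add.commute, rule filterlim_tendsto_add_at_top[OF tendsto_const])
      (subst mult.commute, rule filterlim_tendsto_pos_mult_at_top[OF tendsto_const assms 1])
  have "filterlim (\<lambda>n. real (n + 3) * (real (n + 3) * c + -1)) at_top sequentially"
    by (rule filterlim_at_top_mult_at_top[OF 1 2])
  then show ?thesis by (simp add: algebra_simps power2_eq_square)
qed

lemma bump_tendsto_1:
  assumes "x \<in> I01" shows "(\<lambda>n. bump n x) \<longlonglongrightarrow> 1"
proof -
  have "(\<lambda>n. flat_exp 1 (real (n + 3)^2 * x - real (n + 3)) * flat_exp 1 (real (n + 3)^2 * (1 - x) - real (n + 3)))
      \<longlonglongrightarrow> 1 * 1"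
    using assms by (intro tendsto_mult filterlim_compose[OF flat_exp_1_tendsto_1] filterlim_quadratic_at_top) auto
  then show ?thesis by (simp add: bump_def[abs_def] algebra_simps)
qed

lemma L2_inner_diff_right:
  "\<lbrakk>f \<in> L2; g \<in> L2; h \<in> L2\<rbrakk> \<Longrightarrow> L2_inner h (\<lambda>x. f x - g x) = L2_inner h f - L2_inner h g"
  using L2_inner_diff_left[of f g h] by (simp add: L2_inner_commute)

subsection \<open>Approximation of bounded measurable functions\<close>

text \<open>\<open>measurable_on\<close> already means an almost everywhere limit of continuous
  functions. Clipping these to \<open>[-B, B]\<close> keeps continuity and the limit, which lies in
  that range, and supplies the common bound that dominated convergence asks for.\<close>

lemma bounded_limit_of_continuous:
  fixes f :: "real \<Rightarrow> real"
  assumes f: "f \<in> borel_measurable lebesgue" and b: "\<And>x. \<bar>f x\<bar> \<le> B"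
  obtains g where "\<And>n. continuous_on UNIV (g n)" "\<And>n x. \<bar>g n x\<bar> \<le> B"
    "AE x in lebesgue. (\<lambda>n. g n x) \<longlonglongrightarrow> f x"
proof -
  have B: "0 \<le> B" using b[of 0] by linarith
  have "f measurable_on UNIV"
    by (rule lebesgue_measurable_imp_measurable_on_real) (use f in auto)
  then obtain N g where N: "negligible N" "\<And>n. continuous_on UNIV (g n)"
    "\<And>x. x \<notin> N \<Longrightarrow> (\<lambda>n. g n x) \<longlonglongrightarrow> f x"
    unfolding measurable_on_def by auto
  define h where "h n x = max (- B) (min B (g n x))" for n x
  show thesis
  proof
    show "continuous_on UNIV (h n)" for n
      unfolding h_def[abs_def] by (intro continuous_intros N)
    show "\<bar>h n x\<bar> \<le> B" for n x using B by (auto simp: h_def)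
    have "AE x in lebesgue. x \<notin> N" using N(1) by (simp add: negligible_iff_null_sets AE_not_in)
    then show "AE x in lebesgue. (\<lambda>n. h n x) \<longlonglongrightarrow> f x"
    proof eventually_elim
      case (elim x)
      then have "(\<lambda>n. h n x) \<longlonglongrightarrow> max (- B) (min B (f x))"
        unfolding h_def by (intro tendsto_intros N)
      moreover have "max (- B) (min B (f x)) = f x" using b[of x] by auto
      ultimately show ?case by simp
    qed
  qed
qed

lemma AE_LI_iff: "(AE x in LI. P x) \<longleftrightarrow> (AE x in lebesgue. x \<in> I01 \<longrightarrow> P x)"
  by (simp add: AE_restrict_space_iff)

lemma LI_extend_measurable:
  "f \<in> borel_measurable LI \<Longrightarrow> (\<lambda>x. if x \<in> I01 then f x else 0) \<in> borel_measurable lebesgue"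
  for f :: "real \<Rightarrow> real"
  by (subst borel_measurable_if) auto

text \<open>Weierstrass approximation of the continuous approximants with error
  \<open>1 / Suc n\<close>: the error tends to 0, so the limit survives, and it never exceeds 1, so
  the bound grows by at most 1.\<close>

lemma bounded_limit_of_polynomials:
  fixes p :: "real \<Rightarrow> real"
  assumes p: "p \<in> borel_measurable LI" and b: "\<And>x. x \<in> I01 \<Longrightarrow> \<bar>p x\<bar> \<le> B"
  obtains q :: "nat \<Rightarrow> real poly" where "\<And>n x. x \<in> I01 \<Longrightarrow> \<bar>poly (q n) x\<bar> \<le> B + 1"
    "AE x in LI. (\<lambda>n. poly (q n) x) \<longlonglongrightarrow> p x"
proof -
  have B: "0 \<le> B" using b[of "1/2"] by fastforce
  obtain g where g: "\<And>n. continuous_on UNIV (g n)" "\<And>n x. \<bar>g n x\<bar> \<le> B"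
    "AE x in lebesgue. (\<lambda>n. g n x) \<longlonglongrightarrow> (if x \<in> I01 then p x else 0)"
    by (rule bounded_limit_of_continuous[OF LI_extend_measurable[OF p], of B]) (use b B in auto)
  have "\<exists>q. \<forall>x\<in>{0..1}. \<bar>g n x - poly q x\<bar> < 1 / real (Suc n)" for n
  proof -
    obtain r where r: "real_polynomial_function r" "\<And>x. x \<in> {0..1} \<Longrightarrow> \<bar>g n x - r x\<bar> < 1 / real (Suc n)"
      using Stone_Weierstrass_real_polynomial_function[of "{0..1}" "g n" "1 / real (Suc n)"]
        continuous_on_subset[OF g(1)] by auto
    then obtain a m where "r = (\<lambda>x. \<Sum>i\<le>m. a i * x ^ i)"
      by (auto simp: real_polynomial_function_iff_sum)
    then have "r = poly (\<Sum>i\<le>m. monom (a i) i)" by (simp add: fun_eq_iff poly_sum poly_monom)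
    with r show ?thesis by blast
  qed
  then obtain q where q: "\<And>n x. x \<in> {0..1} \<Longrightarrow> \<bar>g n x - poly (q n) x\<bar> < 1 / real (Suc n)" by metis
  show thesis
  proof
    fix n and x :: real assume "x \<in> I01"
    then have "\<bar>g n x - poly (q n) x\<bar> < 1 / real (Suc n)" by (intro q) auto
    also have "\<dots> \<le> 1" by simp
    finally show "\<bar>poly (q n) x\<bar> \<le> B + 1" using g(2)[of n x] by linarith
  next
    show "AE x in LI. (\<lambda>n. poly (q n) x) \<longlonglongrightarrow> p x"
      unfolding AE_LI_iff using g(3)
    proof eventually_elim
      case (elim x)
      show ?case
      proof
        assume x: "x \<in> I01"
        have "(\<lambda>n. g n x - poly (q n) x) \<longlonglongrightarrow> 0"
        proof (rule Lim_null_comparison)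
          show "\<forall>\<^sub>F n in sequentially. norm (g n x - poly (q n) x) \<le> 1 / real (Suc n)"
            using q[of x] x by (intro always_eventually allI) (simp add: less_imp_le)
          show "(\<lambda>n. 1 / real (Suc n)) \<longlonglongrightarrow> 0" by (rule LIMSEQ_Suc) (rule lim_1_over_n)
        qed
        with elim x have "(\<lambda>n. g n x - (g n x - poly (q n) x)) \<longlonglongrightarrow> p x - 0"
          by (intro tendsto_diff) auto
        then show "(\<lambda>n. poly (q n) x) \<longlonglongrightarrow> p x" by simp
      qed
    qed
  qed
qed

text \<open>The approximating polynomials are cut off by \<open>bump n\<close>. The cut-offs stay
  between 0 and 1 and tend to 1 at every interior point, so neither the bound nor the limit
  suffers.\<close>

lemma bounded_limit_of_test_functions:
  fixes p :: "real \<Rightarrow> real"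
  assumes p: "p \<in> borel_measurable LI" and b: "\<And>x. x \<in> I01 \<Longrightarrow> \<bar>p x\<bar> \<le> B"
  obtains \<psi> where "\<And>n. \<psi> n \<in> test_functions" "\<And>n x. x \<in> I01 \<Longrightarrow> \<bar>\<psi> n x\<bar> \<le> B + 1"
    "AE x in LI. (\<lambda>n. \<psi> n x) \<longlonglongrightarrow> p x"
proof -
  have B: "0 \<le> B" using b[of "1/2"] by fastforce
  obtain q where q: "\<And>n x. x \<in> I01 \<Longrightarrow> \<bar>poly (q n) x\<bar> \<le> B + 1"
    "AE x in LI. (\<lambda>n. poly (q n) x) \<longlonglongrightarrow> p x"
    using bounded_limit_of_polynomials[OF p b] by blast
  show thesis
  proof (rule that[of "\<lambda>n x. poly (q n) x * bump n x"])
    show "(\<lambda>x. poly (q n) x * bump n x) \<in> test_functions" for n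
      by (intro smooth_mult_bump_test smooth_alg_poly)
    show "\<bar>poly (q n) x * bump n x\<bar> \<le> B + 1" if "x \<in> I01" for n x
      unfolding abs_mult using mult_mono[OF q(1)[OF that, of n], of "\<bar>bump n x\<bar>" 1] bump_bounds[of n x] B by simp
    have "AE x in LI. x \<in> I01" by (rule AE_I2) simp
    with q(2) show "AE x in LI. (\<lambda>n. poly (q n) x * bump n x) \<longlonglongrightarrow> p x"
    proof eventually_elim
      case (elim x)
      then show ?case using tendsto_mult[OF elim(1) bump_tendsto_1] by simp
    qed
  qed
qed

text \<open>In the limit, the integral of \<open>h * \<psi> n\<close> becomes the integral of \<open>\<bar>h\<bar>\<close>.\<close>

lemma L2_orthogonal_imp_0:
  assumes h: "h \<in> L2" and m: "\<And>n. \<psi> n \<in> borel_measurable LI"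
    and b: "\<And>n x. x \<in> I01 \<Longrightarrow> \<bar>\<psi> n x\<bar> \<le> B"
    and l: "AE x in LI. (\<lambda>n. \<psi> n x) \<longlonglongrightarrow> sgn (h x)"
    and 0: "\<And>n. L2_inner h (\<psi> n) = 0"
  shows "AE x in LI. h x = 0"
proof -
  have hm[measurable]: "h \<in> borel_measurable LI" by (rule L2_measurable[OF h])
  have "(\<lambda>n. LINT x|LI. h x * \<psi> n x) \<longlonglongrightarrow> (LINT x|LI. h x * sgn (h x))"
  proof (rule integral_dominated_convergence[where w = "\<lambda>x. B * \<bar>h x\<bar>"])
    show "integrable LI (\<lambda>x. B * \<bar>h x\<bar>)" using L2_integrable[OF h] by simp
    show "AE x in LI. (\<lambda>n. h x * \<psi> n x) \<longlonglongrightarrow> h x * sgn (h x)"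
      using l by eventually_elim (intro tendsto_intros)
    show "(\<lambda>x. h x * \<psi> n x) \<in> borel_measurable LI" for n using m by simp
    show "(\<lambda>x. h x * sgn (h x)) \<in> borel_measurable LI" by measurable
    show "AE x in LI. norm (h x * \<psi> n x) \<le> B * \<bar>h x\<bar>" for n
      by (rule AE_I2) (use b in \<open>auto simp: abs_mult mult.commute[of "\<bar>h _\<bar>"] intro!: mult_right_mono\<close>)
  qed
  moreover have "(\<lambda>n. LINT x|LI. h x * \<psi> n x) = (\<lambda>n. 0)" using 0 by (simp add: L2_inner_def)
  ultimately have "(LINT x|LI. h x * sgn (h x)) = 0" by (metis LIMSEQ_const_iff)
  then have "(LINT x|LI. \<bar>h x\<bar>) = 0" by (simp add: abs_sgn)
  then have "AE x in LI. \<bar>h x\<bar> = 0"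
    using L2_integrable[OF h] by (subst (asm) integral_nonneg_eq_0_iff_AE) auto
  then show ?thesis by simp
qed

lemma sgn_L2_measurable: "h \<in> L2 \<Longrightarrow> (\<lambda>x. sgn (h x)) \<in> borel_measurable LI"
  using L2_measurable[of h] unfolding sgn_if by measurable

lemma test_function_deriv:
  assumes "\<phi> \<in> test_functions"
  shows "deriv \<phi> \<in> test_functions" "(\<phi> has_real_derivative deriv \<phi> x) (at x)"
proof -
  from assms obtain K where K: "compact K" "K \<subseteq> I01" "\<And>x. x \<notin> K \<Longrightarrow> \<phi> x = 0"
    and s: "\<And>n x. (deriv ^^ n) \<phi> differentiable at x" by (auto simp: test_functions_def)
  have "deriv \<phi> x = 0" if "x \<notin> K" for x
  proof -
    have "open (- K)" using compact_imp_closed[OF K(1)] by auto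
    then have "eventually (\<lambda>y. y \<in> - K) (nhds x)" using that by (intro eventually_nhds_in_open) auto
    then have "eventually (\<lambda>y. \<phi> y = 0) (nhds x)" by eventually_elim (use K in auto)
    then have "deriv \<phi> x = deriv (\<lambda>_. 0) x" by (intro deriv_cong_ev) auto
    then show ?thesis by simp
  qed
  moreover have "(deriv ^^ n) (deriv \<phi>) differentiable at x" for n x
    using s[of "Suc n" x] by (simp add: funpow_swap1)
  ultimately show "deriv \<phi> \<in> test_functions"
    unfolding test_functions_def using K by blast
  show "(\<phi> has_real_derivative deriv \<phi> x) (at x)"
    using s[of 0 x] by (simp add: DERIV_deriv_iff_real_differentiable)
qed

lemma test_function_continuous: "\<phi> \<in> test_functions \<Longrightarrow> continuous_on A \<phi>"
  using test_function_deriv(2) by (meson DERIV_isCont continuous_at_imp_continuous_on)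

lemma test_function_borel: "\<phi> \<in> test_functions \<Longrightarrow> \<phi> \<in> borel_measurable borel"
  using test_function_continuous by (intro borel_measurable_continuous_onI)

lemma borel_imp_LI: "f \<in> borel_measurable borel \<Longrightarrow> f \<in> borel_measurable LI"
  by (intro measurable_restrict_space1 measurable_completion) simp

lemma continuous_bounded_unit:
  assumes "continuous_on {0..1} f"
  obtains B :: real where "\<And>x::real. x \<in> {0..1} \<Longrightarrow> \<bar>f x\<bar> \<le> B"
proof -
  have "bounded (f ` {0..1})" using assms by (intro compact_imp_bounded compact_continuous_image) auto
  then obtain B where "\<forall>x\<in>{0..1}. \<bar>f x\<bar> \<le> B" by (auto simp: bounded_iff)
  then show thesis by (intro that[of B]) blast
qed

lemma continuous_L2:
  assumes "continuous_on UNIV f" shows "f \<in> L2"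
proof -
  obtain B where "\<And>x. x \<in> {0..1} \<Longrightarrow> \<bar>f x\<bar> \<le> B"
    using continuous_bounded_unit continuous_on_subset[OF assms] by (metis top_greatest)
  moreover have "f \<in> borel_measurable borel" using assms by (rule borel_measurable_continuous_onI)
  ultimately show ?thesis using L2_bounded[of f B] borel_imp_LI by auto
qed

lemma test_function_L2: "\<phi> \<in> test_functions \<Longrightarrow> \<phi> \<in> L2"
  by (intro continuous_L2 test_function_continuous)

text \<open>The fundamental lemma of the calculus of variations, obtained from test functions that
  approach the sign of \<open>h\<close> boundedly and almost everywhere.\<close>

lemma test_orthogonal_imp_0:
  assumes h: "h \<in> L2" and 0: "\<And>\<phi>. \<phi> \<in> test_functions \<Longrightarrow> L2_inner h \<phi> = 0"
  shows "AE x in LI. h x = 0"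
proof -
  obtain \<psi> where "\<And>n. \<psi> n \<in> test_functions" "\<And>n x. x \<in> I01 \<Longrightarrow> \<bar>\<psi> n x\<bar> \<le> 1 + 1"
    "AE x in LI. (\<lambda>n. \<psi> n x) \<longlonglongrightarrow> sgn (h x)"
    by (rule bounded_limit_of_test_functions[OF sgn_L2_measurable[OF h], of 1]) (auto simp: sgn_if)
  then show ?thesis
    using 0 test_function_L2 L2_measurable by (intro L2_orthogonal_imp_0[OF h, of \<psi> 2]) auto
qed

subsection \<open>Weak derivatives\<close>

lemma has_weak_deriv_unique:
  assumes "has_weak_deriv f g" "has_weak_deriv f h"
  shows "AE x in LI. g x = h x"
proof -
  have g: "g \<in> L2" "h \<in> L2" using assms by (auto simp: has_weak_deriv_def)
  have "L2_inner (\<lambda>x. g x - h x) \<phi> = 0" if "\<phi> \<in> test_functions" for \<phi>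
    using assms that g test_function_L2 by (simp add: has_weak_deriv_def L2_inner_diff_left)
  then have "AE x in LI. g x - h x = 0" by (intro test_orthogonal_imp_0 L2_diff g)
  then show ?thesis by simp
qed

lemma has_weak_deriv_weak_deriv: "f \<in> H1 \<Longrightarrow> has_weak_deriv f (weak_deriv f)"
  unfolding H1_def weak_deriv_def using someI_ex[of "has_weak_deriv f"] by blast

lemma weak_deriv_AE_eq: "has_weak_deriv f g \<Longrightarrow> AE x in LI. weak_deriv f x = g x"
  by (rule has_weak_deriv_unique[OF has_weak_deriv_weak_deriv]) (auto simp: H1_def)

lemma has_weak_deriv_imp_H1: "has_weak_deriv f g \<Longrightarrow> f \<in> H1"
  by (auto simp: H1_def)

lemma has_weak_deriv_L2: assumes "has_weak_deriv f g" shows "f \<in> L2" "g \<in> L2"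
  using assms by (auto simp: has_weak_deriv_def)

lemma H1_imp_L2: assumes "f \<in> H1" shows "f \<in> L2" "weak_deriv f \<in> L2"
  using has_weak_deriv_L2[OF has_weak_deriv_weak_deriv[OF assms]] by auto

lemma H10_imp_H1: "f \<in> H10 \<Longrightarrow> f \<in> H1"
  by (simp add: H10_def)

lemma has_weak_deriv_diff:
  assumes "has_weak_deriv f f'" "has_weak_deriv g g'"
  shows "has_weak_deriv (\<lambda>x. f x - g x) (\<lambda>x. f' x - g' x)"
  using assms test_function_L2 test_function_deriv(1)
  by (auto simp: has_weak_deriv_def L2_inner_diff_left L2_diff)

lemma has_weak_deriv_inner:
  assumes "has_weak_deriv f g" "w \<in> L2" shows "L2_inner (weak_deriv f) w = L2_inner g w"
proof (rule L2_inner_cong_AE)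
  have f: "f \<in> H1" using assms has_weak_deriv_imp_H1 by blast
  show "AE x in LI. weak_deriv f x = g x" using weak_deriv_AE_eq assms by blast
qed (use assms L2_measurable has_weak_deriv_L2 H1_imp_L2 has_weak_deriv_imp_H1 in \<open>blast | simp\<close>)+

lemma H1_norm_eq:
  assumes "has_weak_deriv f g" shows "H1_norm f = sqrt ((L2_norm f)\<^sup>2 + (L2_norm g)\<^sup>2)"
proof -
  have "L2_norm (weak_deriv f) = L2_norm g"
    using assms has_weak_deriv_imp_H1 H1_imp_L2 has_weak_deriv_L2 L2_measurable
    by (intro L2_norm_cong_AE weak_deriv_AE_eq) blast+
  then show ?thesis by (simp add: H1_norm_def)
qed

lemma H1_norm_bounds:
  assumes "has_weak_deriv f g" shows "L2_norm f \<le> H1_norm f" "L2_norm g \<le> H1_norm f"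
  unfolding H1_norm_eq[OF assms] by (rule real_le_rsqrt; simp)+

lemma H1_norm_le:
  assumes "has_weak_deriv f g" shows "H1_norm f \<le> L2_norm f + L2_norm g"
  unfolding H1_norm_eq[OF assms] by (rule sqrt_sum_squares_le_sum) (auto intro: L2_norm_nonneg)

lemma LI_integral_eq_LBINT:
  assumes "f \<in> borel_measurable borel"
  shows "(LINT x|LI. f x) = (LBINT x=0..1. f x)"
proof -
  have "(LINT x|LI. f x) = (LINT x|lebesgue. indicator I01 x *\<^sub>R f x)"
    by (subst integral_restrict_space) auto
  also have "\<dots> = (LINT x|lborel. indicator I01 x *\<^sub>R f x)"
    using assms by (intro integral_completion) simp
  also have "\<dots> = (LBINT x=0..1. f x)"
    by (simp add: interval_lebesgue_integral_def set_lebesgue_integral_def zero_ereal_def one_ereal_def)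
  finally show ?thesis .
qed

text \<open>The integral of \<open>P * deriv \<phi>\<close> is turned into that of \<open>p * \<phi>\<close> by Fubini's theorem on a triangle.\<close>

lemma primitive_has_weak_deriv:
  fixes p P :: "real \<Rightarrow> real"
  assumes p[measurable]: "p \<in> borel_measurable borel" and b: "\<And>x. x \<in> I01 \<Longrightarrow> \<bar>p x\<bar> \<le> B"
    and P: "\<And>x. x \<in> I01 \<Longrightarrow> P x = C + (LBINT z=0..x. p z)"
    and Pm: "P \<in> borel_measurable LI"
  shows "has_weak_deriv P p"
proof -
  have B: "0 \<le> B" using b[of "1/2"] by fastforce
  have P': "P x = C + (\<integral>z. indicator {0<..<x} z * p z \<partial>lborel)" if "x \<in> I01" for x
    using that P by (simp add: interval_lebesgue_integral_def set_lebesgue_integral_def zero_ereal_def)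
  have Pb: "\<bar>P x\<bar> \<le> \<bar>C\<bar> + B" if x: "x \<in> I01" for x
  proof -
    have i: "integrable lborel (\<lambda>z. B * indicator {0<..<1::real} z)" by simp
    have *: "norm (indicator {0<..<x} z * p z) \<le> B * indicator {0<..<1} z" for z
      using x b[of z] B by (auto simp: indicator_def)
    have i2: "integrable lborel (\<lambda>z. norm (indicator {0<..<x} z * p z))"
      by (rule Bochner_Integration.integrable_bound[OF i]) (use * in \<open>auto intro: order_trans[OF _ abs_ge_self]\<close>)
    have "norm (\<integral>z. indicator {0<..<x} z * p z \<partial>lborel) \<le> (\<integral>z. norm (indicator {0<..<x} z * p z) \<partial>lborel)"
      by (rule Bochner_Integration.integral_norm_bound)
    also have "\<dots> \<le> (\<integral>z. B * indicator {0<..<1::real} z \<partial>lborel)"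
      using i2 i * by (intro Bochner_Integration.integral_mono)
    also have "\<dots> = B" by simp
    finally show ?thesis using P'[OF x] by simp
  qed
  have L2: "P \<in> L2" "p \<in> L2"
    using L2_bounded[OF Pm Pb] L2_bounded[OF borel_imp_LI[OF p] b] by auto
  moreover have "L2_inner P (deriv \<phi>) = - L2_inner p \<phi>" if \<phi>: "\<phi> \<in> test_functions" for \<phi>
  proof -
    note d = test_function_deriv[OF \<phi>]
    have [measurable]: "\<phi> \<in> borel_measurable borel" "deriv \<phi> \<in> borel_measurable borel"
      using test_function_borel \<phi> d by auto
    obtain D where D: "\<And>x. x \<in> {0..1} \<Longrightarrow> \<bar>deriv \<phi> x\<bar> \<le> D"
      using continuous_bounded_unit test_function_continuous[OF d(1)] by metis
    have D0: "0 \<le> D" using D[of 0] by fastforce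
    have \<phi>01: "\<phi> 0 = 0" "\<phi> 1 = 0" using \<phi> by (auto simp: test_functions_def)
    define F where "F x z = indicator {0<..<1} x * indicator {0<..<x} z * p z * deriv \<phi> x" for x z :: real
    have F: "integrable (lborel \<Otimes>\<^sub>M lborel) (case_prod F)"
    proof (rule Bochner_Integration.integrable_bound)
      show "integrable (lborel \<Otimes>\<^sub>M lborel) (\<lambda>y. B * D * indicator ({0<..<1::real} \<times> {0<..<1::real}) y)"
        by (intro integrable_mult_right integrable_real_indicator)
          (auto simp: lborel.emeasure_pair_measure_Times)
      have "(\<lambda>(x, z). indicator {0<..<1} x * indicator {y. 0 < snd y \<and> snd y < fst y} (x, z) * p z * deriv \<phi> x)
          \<in> borel_measurable (lborel \<Otimes>\<^sub>M lborel)" by measurable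
      also have "(\<lambda>(x, z). indicator {0<..<1} x * indicator {y. 0 < snd y \<and> snd y < fst y} (x, z) * p z * deriv \<phi> x)
          = case_prod F" by (auto simp: F_def fun_eq_iff indicator_def)
      finally show "case_prod F \<in> borel_measurable (lborel \<Otimes>\<^sub>M lborel)" .
      have "norm (F x z) \<le> B * D * indicator ({0<..<1::real} \<times> {0<..<1::real}) (x, z)" for x z
        using b[of z] D[of x] B D0 by (auto simp: F_def indicator_def abs_mult intro!: mult_mono)
      then show "AE y in lborel \<Otimes>\<^sub>M lborel. norm (case_prod F y) \<le> norm (B * D * indicator ({0<..<1} \<times> {0<..<1}) y)"
        using B D0 by (intro AE_I2) (auto simp: split_beta)
    qed
    have 1: "(\<integral>z. F x z \<partial>lborel) = indicator {0<..<1} x * (P x - C) * deriv \<phi> x" for x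
      using P'[of x] by (auto simp: F_def indicator_def[of "{0<..<1}"])
    have 2: "(\<integral>x. F x z \<partial>lborel) = - (indicator {0<..<1} z * p z * \<phi> z)" for z
    proof (cases "z \<in> I01")
      case True
      have "(\<integral>x. F x z \<partial>lborel) = p z * (\<integral>x. indicator {z<..<1} x *\<^sub>R deriv \<phi> x \<partial>lborel)"
        using True by (subst integral_mult_right_zero[symmetric], intro Bochner_Integration.integral_cong)
           (auto simp: F_def indicator_def)
      also have "(\<integral>x. indicator {z<..<1} x *\<^sub>R deriv \<phi> x \<partial>lborel) = (LBINT x=z..1. deriv \<phi> x)"
        using True by (simp add: interval_lebesgue_integral_def set_lebesgue_integral_def one_ereal_def)
      also have "\<dots> = \<phi> 1 - \<phi> z"
        using True d(2) test_function_continuous[OF d(1)] unfolding one_ereal_def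
        by (intro interval_integral_FTC_finite)
          (auto simp: has_real_derivative_iff_has_vector_derivative[symmetric] intro: DERIV_subset)
      finally show ?thesis using True \<phi>01 by simp
    qed (auto simp: F_def indicator_def intro!: integral_eq_zero_AE AE_I2)
    have 3: "(\<integral>x. indicator {0<..<1} x * (P x - C) * deriv \<phi> x \<partial>lborel) = - (\<integral>z. indicator {0<..<1} z * p z * \<phi> z \<partial>lborel)"
      using lborel_pair.Fubini_integral[OF F] by (simp add: 1 2)
    have Pm': "(\<lambda>x. indicator {0<..<1} x * (P x - C) * deriv \<phi> x) \<in> borel_measurable lborel"
      using lborel.borel_measurable_lebesgue_integral[OF borel_measurable_integrable[OF F]] by (simp add: 1)
    have "L2_inner (\<lambda>x. P x - C) (deriv \<phi>) = (\<integral>x. indicator {0<..<1} x * (P x - C) * deriv \<phi> x \<partial>lebesgue)"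
      unfolding L2_inner_def by (subst integral_restrict_space) (auto simp: mult.assoc)
    also have "\<dots> = (\<integral>x. indicator {0<..<1} x * (P x - C) * deriv \<phi> x \<partial>lborel)"
      using Pm' by (rule integral_completion)
    also have "\<dots> = - (LINT z|lebesgue. indicator {0<..<1} z * p z * \<phi> z)"
      unfolding 3 by (subst integral_completion) auto
    also have "\<dots> = - L2_inner p \<phi>"
      unfolding L2_inner_def by (subst integral_restrict_space) (auto simp: mult.assoc)
    finally have 4: "L2_inner (\<lambda>x. P x - C) (deriv \<phi>) = - L2_inner p \<phi>" .
    have "L2_inner (\<lambda>x. C) (deriv \<phi>) = C * (LBINT x=0..1. deriv \<phi> x)"
      unfolding L2_inner_def using LI_integral_eq_LBINT[of "deriv \<phi>"] by simp
    also have "(LBINT x=0..1. deriv \<phi> x) = \<phi> 1 - \<phi> 0"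
      using d(2) test_function_continuous[OF d(1)] unfolding one_ereal_def zero_ereal_def
      by (intro interval_integral_FTC_finite)
        (auto simp: has_real_derivative_iff_has_vector_derivative[symmetric] intro: DERIV_subset)
    finally have "L2_inner (\<lambda>x. C) (deriv \<phi>) = 0" using \<phi>01 by simp
    with 4 show ?thesis
      using L2 L2_const[of C] test_function_L2[OF d(1)] by (simp add: L2_inner_diff_left)
  qed
  ultimately show ?thesis by (simp add: has_weak_deriv_def)
qed

lemma C1_has_weak_deriv:
  assumes d: "\<And>x. (f has_real_derivative f' x) (at x)" and c: "continuous_on UNIV f'"
  shows "has_weak_deriv f f'"
proof -
  obtain B where B: "\<And>x. x \<in> {0..1} \<Longrightarrow> \<bar>f' x\<bar> \<le> B"
    using continuous_bounded_unit[OF continuous_on_subset[OF c subset_UNIV]] by blast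
  have "continuous_on UNIV f" using d by (intro continuous_at_imp_continuous_on ballI DERIV_isCont)
  show ?thesis
  proof (rule primitive_has_weak_deriv[where B = B])
    show "f x = f 0 + (LBINT z=0..x. f' z)" if "x \<in> I01" for x
    proof -
      have "(LBINT z=0..x. f' z) = f x - f 0"
        unfolding zero_ereal_def
      proof (rule interval_integral_FTC_finite)
        show "continuous_on {min 0 x..max 0 x} f'" by (rule continuous_on_subset[OF c]) simp
        show "(f has_vector_derivative f' y) (at y within {min 0 x..max 0 x})" for y
          using has_field_derivative_at_within[OF d] by (simp add: has_real_derivative_iff_has_vector_derivative)
      qed
      then show ?thesis by simp
    qed
    show "f \<in> borel_measurable LI"
      using \<open>continuous_on UNIV f\<close> by (intro L2_measurable continuous_L2)
    show "f' \<in> borel_measurable borel" using c by (rule borel_measurable_continuous_onI)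
    show "\<bar>f' x\<bar> \<le> B" if "x \<in> I01" for x using B that by simp
  qed
qed

lemma test_has_weak_deriv: "\<phi> \<in> test_functions \<Longrightarrow> has_weak_deriv \<phi> (deriv \<phi>)"
  by (intro C1_has_weak_deriv test_function_deriv test_function_continuous)

text \<open>For a test function in place of \<open>w\<close> this is the definition of the weak
  derivative. Both sides are continuous in \<open>w\<close> for \<open>H1_norm\<close>, and
  \<open>H10\<close> is the closure of the test functions, so no boundary values ever have to be
  defined.\<close>

lemma H1_H10_integration_by_parts:
  assumes f: "has_weak_deriv f f'" and w: "w \<in> H10" and w': "has_weak_deriv w w'"
  shows "L2_inner f' w = - L2_inner f w'"
proof -
  note L2 = has_weak_deriv_L2[OF f] has_weak_deriv_L2[OF w']
  have "\<bar>L2_inner f' w + L2_inner f w'\<bar> \<le> (L2_norm f' + L2_norm f) * e" if e: "e > 0" for e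
  proof -
    obtain \<phi> where \<phi>: "\<phi> \<in> test_functions" "H1_norm (\<lambda>x. w x - \<phi> x) < e"
      using w e by (auto simp: H10_def)
    note \<phi>' = test_has_weak_deriv[OF \<phi>(1)]
    note wd = has_weak_deriv_diff[OF w' \<phi>']
    note L2\<phi> = has_weak_deriv_L2[OF \<phi>'] has_weak_deriv_L2[OF wd]
    have n: "L2_norm (\<lambda>x. w x - \<phi> x) \<le> e" "L2_norm (\<lambda>x. w' x - deriv \<phi> x) \<le> e"
      using H1_norm_bounds[OF wd] \<phi>(2) by auto
    have "L2_inner f (deriv \<phi>) = - L2_inner f' \<phi>" using f \<phi>(1) by (simp add: has_weak_deriv_def)
    moreover have "L2_inner f' (\<lambda>x. w x - \<phi> x) = L2_inner f' w - L2_inner f' \<phi>"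
      "L2_inner f (\<lambda>x. w' x - deriv \<phi> x) = L2_inner f w' - L2_inner f (deriv \<phi>)"
      by (rule L2_inner_diff_right; fact L2 L2\<phi>)+
    ultimately have "\<bar>L2_inner f' w + L2_inner f w'\<bar>
        = \<bar>L2_inner f' (\<lambda>x. w x - \<phi> x) + L2_inner f (\<lambda>x. w' x - deriv \<phi> x)\<bar>"
      by simp
    also have "\<dots> \<le> L2_norm f' * L2_norm (\<lambda>x. w x - \<phi> x) + L2_norm f * L2_norm (\<lambda>x. w' x - deriv \<phi> x)"
      by (intro order_trans[OF abs_triangle_ineq] add_mono L2_Cauchy_Schwarz L2 L2\<phi>)
    also have "\<dots> \<le> L2_norm f' * e + L2_norm f * e"
      by (intro add_mono mult_left_mono n L2_norm_nonneg)
    finally show ?thesis by (simp add: distrib_right)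
  qed
  note * = this
  have "\<bar>L2_inner f' w + L2_inner f w'\<bar> \<le> 0"
  proof (rule field_le_epsilon)
    fix e :: real assume e: "e > 0"
    \<comment> \<open>The added 1 keeps the divisor positive even if both norms vanish.\<close>
    let ?S = "L2_norm f' + L2_norm f + 1"
    have S: "?S > 0" using L2_norm_nonneg[of f] L2_norm_nonneg[of f'] by linarith
    have "\<bar>L2_inner f' w + L2_inner f w'\<bar> \<le> (L2_norm f' + L2_norm f) * (e / ?S)"
      by (rule *) (use e S in simp)
    also have "\<dots> \<le> ?S * (e / ?S)" using e S by (intro mult_right_mono) simp_all
    also have "\<dots> = e" using S by simp
    finally show "\<bar>L2_inner f' w + L2_inner f w'\<bar> \<le> 0 + e" by simp
  qed
  then show ?thesis by linarith
qed

text \<open>The primitive is constant on each side of the support. It vanishes at 0 by normalisation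
  and at 1 because the integral is zero, so both constants are 0 and the support stays
  compact.\<close>

lemma test_function_antiderivative:
  assumes \<psi>: "\<psi> \<in> test_functions" and 0: "(LBINT z=0..1. \<psi> z) = 0"
  obtains \<phi> where "\<phi> \<in> test_functions" "deriv \<phi> = \<psi>" "\<phi> 0 = 0"
proof -
  obtain \<phi>0 where \<phi>0: "\<And>x. (\<phi>0 has_vector_derivative \<psi> x) (at x)"
    using einterval_antiderivative[of "-\<infinity>" "\<infinity>" \<psi>] test_function_continuous[OF \<psi>, of UNIV]
    by (auto simp: continuous_on_eq_continuous_at)
  define \<phi> where "\<phi> x = \<phi>0 x - \<phi>0 0" for x
  have d: "(\<phi> has_real_derivative \<psi> x) (at x)" for x
    unfolding \<phi>_def[abs_def] using \<phi>0[of x] 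
    by (auto intro!: derivative_eq_intros simp: has_real_derivative_iff_has_vector_derivative[symmetric])
  then have deriv: "deriv \<phi> = \<psi>" using DERIV_imp_deriv by blast
  have ftc: "(LBINT z=0..1. \<psi> z) = \<phi> 1 - \<phi> 0"
    using d test_function_continuous[OF \<psi>] unfolding one_ereal_def zero_ereal_def
    by (intro interval_integral_FTC_finite)
      (auto simp: has_real_derivative_iff_has_vector_derivative[symmetric] intro: DERIV_subset)
  have \<phi>01: "\<phi> 0 = 0" "\<phi> 1 = 0" using ftc 0 by (auto simp: \<phi>_def)
  from \<psi> obtain K where K: "compact K" "K \<subseteq> I01" "\<And>x. x \<notin> K \<Longrightarrow> \<psi> x = 0"
    and s: "\<And>n x. (deriv ^^ n) \<psi> differentiable at x" by (auto simp: test_functions_def)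
  obtain a b where ab: "0 < a" "a \<le> b" "b < 1" "K \<subseteq> {a..b}"
  proof (cases "K = {}")
    case True then show thesis using that[of "1/2" "1/2"] by auto
  next
    case False
    then obtain a b where "a \<in> K" "b \<in> K" "\<And>x. x \<in> K \<Longrightarrow> a \<le> x" "\<And>x. x \<in> K \<Longrightarrow> x \<le> b"
      using compact_attains_inf[OF K(1)] compact_attains_sup[OF K(1)] by metis
    then show thesis using K(2) that[of a b] by fastforce
  qed
  have l: "\<phi> x = 0" if "x < a" for x
  proof -
    have "\<exists>c. \<forall>x\<in>{..<a}. \<phi> x = c"
    proof (rule has_field_derivative_zero_constant)
      fix x assume "x \<in> {..<a}"
      then have "x \<notin> K" using ab by auto
      then show "(\<phi> has_real_derivative 0) (at x within {..<a})"
        using has_field_derivative_at_within[OF d[of x]] K(3)[of x] by simp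
    qed simp
    then show ?thesis using \<phi>01(1) ab that by force
  qed
  have r: "\<phi> x = 0" if "x > b" for x
  proof -
    have "\<exists>c. \<forall>x\<in>{b<..}. \<phi> x = c"
    proof (rule has_field_derivative_zero_constant)
      fix x assume "x \<in> {b<..}"
      then have "x \<notin> K" using ab by auto
      then show "(\<phi> has_real_derivative 0) (at x within {b<..})"
        using has_field_derivative_at_within[OF d[of x]] K(3)[of x] by simp
    qed simp
    then show ?thesis using \<phi>01(2) ab that by force
  qed
  have "(deriv ^^ n) \<phi> differentiable at x" for n x
  proof (cases n)
    case 0 then show ?thesis using d[of x] real_differentiable_def by auto
  next
    case (Suc m) then show ?thesis using s[of m x] by (simp add: funpow_swap1 deriv)
  qed
  then have "\<phi> \<in> test_functions"
    unfolding test_functions_def using l r ab by (auto intro!: exI[of _ "{a..b}"] simp: not_le) 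
  then show thesis using that deriv \<phi>01 by blast
qed

lemma iterated_deriv_diff_scale:
  assumes "f \<in> test_functions" "g \<in> test_functions"
  shows "(deriv ^^ n) (\<lambda>x. f x - c * g x) = (\<lambda>x. (deriv ^^ n) f x - c * (deriv ^^ n) g x)"
  using assms
proof (induction n arbitrary: f g)
  case (Suc n)
  have "deriv (\<lambda>x. f x - c * g x) = (\<lambda>x. deriv f x - c * deriv g x)"
    by (rule ext, rule DERIV_imp_deriv)
      (intro DERIV_diff DERIV_cmult test_function_deriv(2) Suc.prems)
  then show ?case
    using Suc.IH[OF test_function_deriv(1)[OF Suc.prems(1)] test_function_deriv(1)[OF Suc.prems(2)]]
    by (simp add: funpow_swap1)
qed simp

lemma test_function_diff_scale:
  assumes "f \<in> test_functions" "g \<in> test_functions"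
  shows "(\<lambda>x. f x - c * g x) \<in> test_functions"
proof -
  from assms obtain K L where K: "compact K" "K \<subseteq> I01" "\<And>x. x \<notin> K \<Longrightarrow> f x = 0"
    and L: "compact L" "L \<subseteq> I01" "\<And>x. x \<notin> L \<Longrightarrow> g x = 0" by (auto simp: test_functions_def)
  have s: "(deriv ^^ n) f differentiable at x" "(deriv ^^ n) g differentiable at x" for n x
    using assms by (auto simp: test_functions_def)
  have "(deriv ^^ n) (\<lambda>x. f x - c * g x) differentiable at x" for n x
    unfolding iterated_deriv_diff_scale[OF assms] using s by (intro derivative_intros)
  moreover have "compact (K \<union> L)" "K \<union> L \<subseteq> I01" "\<forall>x. x \<notin> K \<union> L \<longrightarrow> f x - c * g x = 0"
    using K L by auto
  ultimately show ?thesis unfolding test_functions_def by blast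
qed

lemma LI_integral_abs_le_L2_norm:
  assumes "f \<in> L2" shows "(LINT x|LI. \<bar>f x\<bar>) \<le> L2_norm f"
proof -
  have f: "(\<lambda>x. \<bar>f x\<bar>) \<in> L2"
    using assms by (auto simp: L2_def)
  have "(LINT x|LI. \<bar>f x\<bar>) = L2_inner (\<lambda>x. \<bar>f x\<bar>) (\<lambda>x. 1)" by (simp add: L2_inner_def)
  also have "\<dots> \<le> L2_norm (\<lambda>x. \<bar>f x\<bar>) * L2_norm (\<lambda>x. 1)"
    using L2_Cauchy_Schwarz[OF f L2_const[of 1]] by linarith
  also have "L2_norm (\<lambda>x. \<bar>f x\<bar>) = L2_norm f" by (simp add: L2_norm_def L2_inner_def)
  also have "L2_norm (\<lambda>x. 1) = 1" by (simp add: L2_norm_def L2_inner_def measure_restrict_space)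
  finally show ?thesis by simp
qed

lemma Ioo_integrable_bounded:
  fixes p :: "real \<Rightarrow> real"
  assumes [measurable]: "p \<in> borel_measurable borel" and b: "\<And>x. x \<in> {a<..<b} \<Longrightarrow> \<bar>p x\<bar> \<le> B"
  shows "integrable lborel (\<lambda>x. indicator {a<..<b} x * p x)"
proof (rule Bochner_Integration.integrable_bound)
  have "emeasure lborel {a<..<b} < \<infinity>" by (cases "a \<le> b") auto
  then show "integrable lborel (\<lambda>x. B * indicator {a<..<b} x)"
    by (intro integrable_mult_right integrable_real_indicator) auto
  have "norm (indicator {a<..<b} x * p x) \<le> norm (B * indicator {a<..<b} x)" for x
    using b[of x] by (auto simp: indicator_def)
  then show "AE x in lborel. norm (indicator {a<..<b} x * p x) \<le> norm (B * indicator {a<..<b} x)"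
    by (intro AE_I2)
qed measurable

lemma LBINT_eq_indicator:
  "a \<le> b \<Longrightarrow> (LBINT z=ereal a..ereal b. p z) = (\<integral>z. indicator {a<..<b} z * p z \<partial>lborel)" for p :: "real \<Rightarrow> real"
  by (simp add: interval_lebesgue_integral_def set_lebesgue_integral_def)

lemma LBINT_abs_le_LI:
  fixes p :: "real \<Rightarrow> real" and x :: real
  assumes [measurable]: "p \<in> borel_measurable borel" and b: "\<And>x. x \<in> I01 \<Longrightarrow> \<bar>p x\<bar> \<le> B"
    and x: "x \<in> {0..1}"
  shows "\<bar>LBINT z=0..x. p z\<bar> \<le> (LINT z|LI. \<bar>p z\<bar>)"
proof -
  have i: "integrable lborel (\<lambda>z. indicator {0<..<1} z * \<bar>p z\<bar>)"
    by (rule Ioo_integrable_bounded[where B = B]) (use b in auto)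
  have i2: "integrable lborel (\<lambda>z. indicator {0<..<x} z * \<bar>p z\<bar>)"
    by (rule Ioo_integrable_bounded[where B = B]) (use x b in auto)
  have "(LBINT z=0..x. p z) = (\<integral>z. indicator {0<..<x} z * p z \<partial>lborel)"
    using LBINT_eq_indicator[of 0 x p] x by (simp add: zero_ereal_def)
  then have "\<bar>LBINT z=0..x. p z\<bar> \<le> (\<integral>z. norm (indicator {0<..<x} z * p z) \<partial>lborel)"
    using Bochner_Integration.integral_norm_bound[of lborel "\<lambda>z. indicator {0<..<x} z * p z"] by simp
  also have "\<dots> = (\<integral>z. indicator {0<..<x} z * \<bar>p z\<bar> \<partial>lborel)"
    by (simp add: abs_mult)
  also have "\<dots> \<le> (\<integral>z. indicator {0<..<1} z * \<bar>p z\<bar> \<partial>lborel)"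
    using x i i2 by (intro Bochner_Integration.integral_mono) (auto simp: indicator_def)
  also have "\<dots> = (LINT z|LI. \<bar>p z\<bar>)"
    using LBINT_eq_indicator[of 0 1 "\<lambda>z. \<bar>p z\<bar>"] LI_integral_eq_LBINT[of "\<lambda>z. \<bar>p z\<bar>"]
    by (simp add: zero_ereal_def one_ereal_def)
  finally show ?thesis .
qed

lemma interval_lebesgue_integrable_bounded:
  fixes p :: "real \<Rightarrow> real"
  assumes [measurable]: "p \<in> borel_measurable borel" and b: "\<And>x. x \<in> {min a b<..<max a b} \<Longrightarrow> \<bar>p x\<bar> \<le> B"
  shows "interval_lebesgue_integrable lborel (ereal a) (ereal b) p"
  using Ioo_integrable_bounded[where p = p and a = a and b = b and B = B]
    Ioo_integrable_bounded[where p = p and a = b and b = a and B = B] b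
  by (auto simp: interval_lebesgue_integrable_def set_integrable_def min_def max_def split: if_splits)

text \<open>\<open>p\<close> is approximated by test functions whose integrals are corrected to
  zero; their primitives are then test functions as well. On the unit interval the supremum of a
  primitive is at most the L1 norm of its integrand, hence at most its \<open>L2_norm\<close>, so
  the error of the derivatives controls both parts of \<open>H1_norm\<close>.\<close>

lemma primitive_in_H10:
  fixes p P :: "real \<Rightarrow> real"
  assumes p[measurable]: "p \<in> borel_measurable borel" and b: "\<And>x. x \<in> I01 \<Longrightarrow> \<bar>p x\<bar> \<le> B"
    and P: "\<And>x. x \<in> I01 \<Longrightarrow> P x = (LBINT z=0..x. p z)"
    and 0: "(LBINT z=0..1. p z) = 0" and Pm: "P \<in> borel_measurable LI"
  shows "P \<in> H10"
proof -
  have wd: "has_weak_deriv P p"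
    by (rule primitive_has_weak_deriv[OF p b _ Pm, where C = 0]) (use P in auto)
  have "\<exists>\<theta>\<in>test_functions. (LINT x|LI. \<theta> x) = 1"
  proof -
    obtain \<psi> where \<psi>: "\<And>n. \<psi> n \<in> test_functions" "\<And>n x. x \<in> I01 \<Longrightarrow> \<bar>\<psi> n x\<bar> \<le> 1 + 1"
      "AE x in LI. (\<lambda>n. \<psi> n x) \<longlonglongrightarrow> 1"
      using bounded_limit_of_test_functions[of "\<lambda>x. 1" 1] by auto
    have "(\<lambda>n. LINT x|LI. \<psi> n x) \<longlonglongrightarrow> (LINT x|LI. 1)"
      using \<psi> L2_measurable[OF test_function_L2[OF \<psi>(1)]]
      by (intro integral_dominated_convergence[where w = "\<lambda>x. 2"]) auto
    then have "(\<lambda>n. LINT x|LI. \<psi> n x) \<longlonglongrightarrow> 1" by (simp add: measure_restrict_space)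
    then have "eventually (\<lambda>n. (LINT x|LI. \<psi> n x) > 0) sequentially"
      by (rule order_tendstoD) simp
    then obtain n where n: "(LINT x|LI. \<psi> n x) > 0" by (auto simp: eventually_sequentially)
    \<comment> \<open>Chosen so that \<open>1 - ?c\<close> is the reciprocal of the integral:
      rescaling to integral 1 is written as a difference in order to use
      \<open>test_function_diff_scale\<close>.\<close>
    let ?c = "1 - 1 / (LINT x|LI. \<psi> n x)"
    have "(\<lambda>x. \<psi> n x - ?c * \<psi> n x) \<in> test_functions" by (intro test_function_diff_scale \<psi>)
    moreover have "(LINT x|LI. \<psi> n x - ?c * \<psi> n x) = 1"
      using n L2_integrable[OF test_function_L2[OF \<psi>(1)]] by (simp add: left_diff_distrib)
    ultimately show ?thesis by blast
  qed
  then obtain \<theta> where \<theta>: "\<theta> \<in> test_functions" "(LINT x|LI. \<theta> x) = 1" by blast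
  obtain D where D: "\<And>x. x \<in> {0..1} \<Longrightarrow> \<bar>\<theta> x\<bar> \<le> D"
    using continuous_bounded_unit[OF test_function_continuous[OF \<theta>(1)]] by blast
  obtain \<psi> where \<psi>: "\<And>n. \<psi> n \<in> test_functions" "\<And>n x. x \<in> I01 \<Longrightarrow> \<bar>\<psi> n x\<bar> \<le> B + 1"
    "AE x in LI. (\<lambda>n. \<psi> n x) \<longlonglongrightarrow> p x"
    using bounded_limit_of_test_functions[OF borel_imp_LI[OF p] b] by metis
  have [measurable]: "\<theta> \<in> borel_measurable borel" "\<And>n. \<psi> n \<in> borel_measurable borel"
    using \<theta> \<psi> test_function_borel by auto
  define m where "m n = (LINT x|LI. \<psi> n x)" for n
  have "(\<lambda>n. m n) \<longlonglongrightarrow> (LINT x|LI. p x)"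
    unfolding m_def using \<psi> borel_imp_LI[OF p] L2_measurable[OF test_function_L2[OF \<psi>(1)]]
    by (intro integral_dominated_convergence[where w = "\<lambda>x. B + 1"]) auto
  then have m: "m \<longlonglongrightarrow> 0" using 0 LI_integral_eq_LBINT[OF p] by simp
  have mb: "\<bar>m n\<bar> \<le> B + 1" for n
  proof -
    have "\<bar>m n\<bar> \<le> (LINT x|LI. \<bar>\<psi> n x\<bar>)" unfolding m_def by simp
    also have "\<dots> \<le> (LINT x|LI. B + 1)"
      using \<psi>(2) L2_integrable[OF test_function_L2[OF \<psi>(1)]]
      by (intro Bochner_Integration.integral_mono) auto
    finally show ?thesis by (simp add: measure_restrict_space)
  qed
  \<comment> \<open>Subtracting the integral times \<theta> makes the integral zero, as
    \<open>test_function_antiderivative\<close> demands. Since \<open>p\<close> has integral zero,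
    \<open>m n\<close> tends to 0 and the correction disappears in the limit.\<close>
  define \<omega> where "\<omega> n x = \<psi> n x - m n * \<theta> x" for n x
  have \<omega>: "\<omega> n \<in> test_functions" for n
    unfolding \<omega>_def[abs_def] by (intro test_function_diff_scale \<psi> \<theta>)
  have [measurable]: "\<omega> n \<in> borel_measurable borel" for n using \<omega> test_function_borel by auto
  have \<omega>0: "(LBINT z=0..1. \<omega> n z) = 0" for n
  proof -
    have "(LINT x|LI. \<omega> n x) = m n - m n * 1"
      unfolding \<omega>_def using L2_integrable[OF test_function_L2[OF \<psi>(1)]] L2_integrable[OF test_function_L2[OF \<theta>(1)]] \<theta>(2)
      by (simp add: m_def)
    then show ?thesis using LI_integral_eq_LBINT[of "\<omega> n"] by simp
  qed
  have "\<exists>\<phi>\<in>test_functions. deriv \<phi> = \<omega> n \<and> \<phi> 0 = 0" for n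
    using test_function_antiderivative[OF \<omega> \<omega>0] by metis
  then obtain \<phi> where \<phi>: "\<And>n. \<phi> n \<in> test_functions" "\<And>n. deriv (\<phi> n) = \<omega> n" "\<And>n. \<phi> n 0 = 0" by metis
  define d where "d n x = p x - \<omega> n x" for n x
  have [measurable]: "d n \<in> borel_measurable borel" for n unfolding d_def[abs_def] by measurable
  have db: "\<bar>d n x\<bar> \<le> B + ((B + 1) + (B + 1) * D)" if x: "x \<in> I01" for n x
  proof -
    have "\<bar>m n * \<theta> x\<bar> \<le> (B + 1) * D"
      unfolding abs_mult using mb[of n] D[of x] x by (intro mult_mono) auto
    then show ?thesis using b[OF x] \<psi>(2)[OF x, of n] by (simp add: d_def \<omega>_def)
  qed
  have dL2: "d n \<in> L2" for n by (rule L2_bounded[OF borel_imp_LI db]) auto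
  have "AE x in LI. (\<lambda>n. d n x) \<longlonglongrightarrow> 0"
    using \<psi>(3)
  proof eventually_elim
    case (elim x)
    have "(\<lambda>n. p x - (\<psi> n x - m n * \<theta> x)) \<longlonglongrightarrow> p x - (p x - 0 * \<theta> x)"
      by (intro tendsto_intros elim m)
    then show ?case by (simp add: d_def \<omega>_def)
  qed
  then have dn: "(\<lambda>n. L2_norm (d n)) \<longlonglongrightarrow> 0"
    using db by (intro L2_norm_tendsto_0 borel_imp_LI) auto
  have le: "H1_norm (\<lambda>x. P x - \<phi> n x) \<le> L2_norm (d n) + L2_norm (d n)" for n
  proof -
    have eq: "P x - \<phi> n x = (LBINT z=0..x. d n z)" if x: "x \<in> I01" for x
    proof -
      have "(LBINT z=0..x. \<omega> n z) = \<phi> n x - \<phi> n 0"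
        unfolding zero_ereal_def
      proof (rule interval_integral_FTC_finite)
        show "continuous_on {min 0 x..max 0 x} (\<omega> n)" by (rule test_function_continuous[OF \<omega>])
        show "(\<phi> n has_vector_derivative \<omega> n y) (at y within {min 0 x..max 0 x})" for y
          using has_field_derivative_at_within[OF test_function_deriv(2)[OF \<phi>(1)]] \<phi>(2)
          by (simp add: has_real_derivative_iff_has_vector_derivative)
      qed
      moreover have "(LBINT z=0..x. d n z) = (LBINT z=0..x. p z) - (LBINT z=0..x. \<omega> n z)"
        unfolding d_def zero_ereal_def
      proof (intro interval_lebesgue_integral_diff)
        show "interval_lebesgue_integrable lborel (ereal 0) (ereal x) p"
          using x b by (intro interval_lebesgue_integrable_bounded[where B = B]) auto
        have "continuous_on {min 0 x..max 0 x} (\<omega> n)" by (rule test_function_continuous[OF \<omega>])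
        then show "interval_lebesgue_integrable lborel (ereal 0) (ereal x) (\<omega> n)"
          using x by (intro interval_integrable_continuous_on) (auto simp: min_def max_def)
      qed
      ultimately show ?thesis using P[OF x] \<phi>(3) by simp
    qed
    have "\<bar>P x - \<phi> n x\<bar> \<le> L2_norm (d n)" if x: "x \<in> I01" for x
      unfolding eq[OF x]
      using LBINT_abs_le_LI[of "d n" _ x, OF _ db] x LI_integral_abs_le_L2_norm[OF dL2[of n]] by force
    then have "L2_norm (\<lambda>x. P x - \<phi> n x) \<le> L2_norm (d n)"
      using Pm L2_measurable[OF test_function_L2[OF \<phi>(1)]] by (intro L2_norm_bounded L2_norm_nonneg) auto
    moreover have "has_weak_deriv (\<lambda>x. P x - \<phi> n x) (\<lambda>x. p x - deriv (\<phi> n) x)"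
      by (intro has_weak_deriv_diff wd test_has_weak_deriv \<phi>)
    ultimately show ?thesis using H1_norm_le[of "\<lambda>x. P x - \<phi> n x"] by (fastforce simp: \<phi> d_def[abs_def])
  qed
  have "\<exists>\<phi>\<in>test_functions. H1_norm (\<lambda>x. P x - \<phi> x) < e" if e: "e > 0" for e
  proof -
    have "(\<lambda>n. L2_norm (d n) + L2_norm (d n)) \<longlonglongrightarrow> 0 + 0" by (intro tendsto_add dn)
    then have "eventually (\<lambda>n. L2_norm (d n) + L2_norm (d n) < e) sequentially"
      using e by (intro order_tendstoD) auto
    then obtain n where "L2_norm (d n) + L2_norm (d n) < e" by (auto simp: eventually_sequentially)
    with le[of n] \<phi>(1)[of n] show ?thesis by (intro bexI[of _ "\<phi> n"]) auto
  qed
  then show ?thesis using has_weak_deriv_imp_H1[OF wd] by (simp add: H10_def)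
qed

subsection \<open>Completeness of the sines and cosines\<close>

text \<open>On the unit interval \<open>x\<close> equals \<open>arccos (cos (pi * x)) / pi\<close>,
  so a polynomial in \<open>x\<close> is a continuous function of the cosine and hence a uniform
  limit of polynomials in the cosine. Orthogonality to cosine powers therefore extends to all
  polynomials, which approximate the sign of \<open>h\<close>.\<close>

lemma cos_powers_complete:
  assumes h: "h \<in> L2" and 0: "\<And>i. L2_inner h (\<lambda>x. cos (pi * x) ^ i) = 0"
  shows "AE x in LI. h x = 0"
proof -
  have cosL2: "(\<lambda>x. r (cos (pi * x))) \<in> L2" if "continuous_on UNIV r" for r
    by (intro continuous_L2 continuous_intros continuous_on_compose2[OF that]) auto
  have r: "L2_inner h (\<lambda>x. \<Sum>i\<le>m. a i * cos (pi * x) ^ i) = 0" for a :: "nat \<Rightarrow> real" and m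
  proof (induction m)
    case 0 show ?case using assms(2)[of 0] L2_inner_scale_left[of "a 0" "\<lambda>x. 1" h]
      by (simp add: L2_inner_commute)
  next
    case (Suc m)
    have "L2_inner (\<lambda>x. (\<Sum>i\<le>m. a i * cos (pi * x) ^ i) + a (Suc m) * cos (pi * x) ^ Suc m) h
      = L2_inner (\<lambda>x. \<Sum>i\<le>m. a i * cos (pi * x) ^ i) h + L2_inner (\<lambda>x. a (Suc m) * cos (pi * x) ^ Suc m) h"
      by (intro L2_inner_add_left h cosL2[of "\<lambda>y. \<Sum>i\<le>m. a i * y ^ i"] cosL2[of "\<lambda>y. a (Suc m) * y ^ Suc m"] continuous_intros)
    then show ?case
      using Suc assms(2)[of "Suc m"] L2_inner_scale_left[of "a (Suc m)" "\<lambda>x. cos (pi * x) ^ Suc m" h]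
      by (simp add: L2_inner_commute[of _ h] del: power_Suc)
  qed
  have q0: "L2_inner h (poly q) = 0" for q
  proof -
    have "\<bar>L2_inner h (poly q)\<bar> \<le> L2_norm h * e" if e: "e > 0" for e
    proof -
      have "continuous_on {-1..1} (\<lambda>y. poly q (arccos y / pi))"
        by (intro continuous_intros continuous_on_arccos) auto
      then obtain r where r': "real_polynomial_function r" "\<And>y. y \<in> {-1..1} \<Longrightarrow> \<bar>poly q (arccos y / pi) - r y\<bar> < e"
        using Stone_Weierstrass_real_polynomial_function[of "{-1..1}"] e compact_Icc by metis
      then obtain a m where a: "r = (\<lambda>x. \<Sum>i\<le>m. a i * x ^ i)"
        by (auto simp: real_polynomial_function_iff_sum)
      have L2: "(\<lambda>x. r (cos (pi * x))) \<in> L2" "poly q \<in> L2"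
        unfolding a by (rule cosL2, intro continuous_intros) (intro continuous_L2 continuous_intros)
      have "L2_inner h (poly q) = L2_inner h (\<lambda>x. poly q x - r (cos (pi * x)))"
        using L2_inner_diff_right[OF L2(2,1) h] r[of a m] by (simp add: a)
      also have "\<bar>L2_inner h (\<lambda>x. poly q x - r (cos (pi * x)))\<bar>
          \<le> L2_norm h * L2_norm (\<lambda>x. poly q x - r (cos (pi * x)))"
        by (intro L2_Cauchy_Schwarz h L2_diff L2)
      also have "L2_norm (\<lambda>x. poly q x - r (cos (pi * x))) \<le> e"
      proof (rule L2_norm_bounded)
        show "(\<lambda>x. poly q x - r (cos (pi * x))) \<in> borel_measurable LI"
          by (intro L2_measurable L2_diff L2)
        fix x :: real assume x: "x \<in> I01"
        then have "arccos (cos (pi * x)) = pi * x" by (intro arccos_cos) auto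
        then show "\<bar>poly q x - r (cos (pi * x))\<bar> \<le> e" using r'(2)[of "cos (pi * x)"] by simp
      qed (use e in simp)
      finally show ?thesis by (simp add: L2_norm_nonneg mult_left_mono)
    qed
    note * = this
    have "\<bar>L2_inner h (poly q)\<bar> \<le> 0 + e" if e: "e > 0" for e
    proof -
      have S: "L2_norm h + 1 > 0" using L2_norm_nonneg[of h] by linarith
      have "\<bar>L2_inner h (poly q)\<bar> \<le> L2_norm h * (e / (L2_norm h + 1))"
        by (rule *) (use e S in simp)
      also have "\<dots> \<le> (L2_norm h + 1) * (e / (L2_norm h + 1))"
        using e S by (intro mult_right_mono) simp_all
      finally show ?thesis using S by simp
    qed
    then have "\<bar>L2_inner h (poly q)\<bar> \<le> 0" by (rule field_le_epsilon)
    then show ?thesis by simp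
  qed
  obtain q :: "nat \<Rightarrow> real poly" where q: "\<And>n x. x \<in> I01 \<Longrightarrow> \<bar>poly (q n) x\<bar> \<le> 1 + 1"
    "AE x in LI. (\<lambda>n. poly (q n) x) \<longlonglongrightarrow> sgn (h x)"
    by (rule bounded_limit_of_polynomials[OF sgn_L2_measurable[OF h], of 1]) (auto simp: sgn_if)
  show ?thesis
    by (rule L2_orthogonal_imp_0[OF h _ q q0]) (intro L2_measurable continuous_L2 continuous_intros)
qed

text \<open>The recursion \<open>2 cos(\<pi>x) e\<^sub>k = e\<^sub>k\<^sub>+\<^sub>1 + e\<^sub>k\<^sub>-\<^sub>1\<close> is satisfied by sines and by cosines.\<close>

lemma trig_family_cos_power_inner:
  fixes e :: "int \<Rightarrow> real \<Rightarrow> real"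
  assumes h: "h \<in> L2" and c: "\<And>k. continuous_on UNIV (e k)"
    and rec: "\<And>k x. 2 * cos (pi * x) * e k x = e (k + 1) x + e (k - 1) x"
    and 0: "\<And>k. L2_inner h (e k) = 0"
  shows "L2_inner h (\<lambda>x. cos (pi * x) ^ i * e k x) = 0"
proof (induction i arbitrary: k)
  case 0 then show ?case using assms(4) by simp
next
  case (Suc i)
  have L2: "(\<lambda>x. cos (pi * x) ^ i * e k x) \<in> L2" for k
    by (intro continuous_L2 continuous_intros c)
  have eq: "cos (pi * x) ^ Suc i * e k x
      = (1/2) * (cos (pi * x) ^ i * e (k + 1) x + cos (pi * x) ^ i * e (k - 1) x)" for x
  proof -
    have "cos (pi * x) ^ Suc i * e k x = (1/2) * (cos (pi * x) ^ i * (2 * cos (pi * x) * e k x))"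
      by (simp add: algebra_simps)
    then show ?thesis unfolding rec by (simp add: algebra_simps)
  qed
  show ?case
    unfolding eq using Suc L2_inner_add_left[OF L2 L2 h, of "k+1" "k-1"]
      L2_inner_scale_left[of "1/2" "\<lambda>x. cos (pi * x) ^ i * e (k + 1) x + cos (pi * x) ^ i * e (k - 1) x" h]
    by (simp add: L2_inner_commute[of _ h])
qed

text \<open>The recursion is used at index 0, where the mode is the constant 1 and bare cosine
  powers remain. The index runs over the integers because the recursion steps below 0; evenness of
  the cosine brings negative frequencies back to the hypothesis.\<close>

lemma cos_complete:
  assumes h: "h \<in> L2" and 0: "\<And>k::nat. L2_inner h (\<lambda>x. cos (real k * pi * x)) = 0"
  shows "AE x in LI. h x = 0"
proof (rule cos_powers_complete[OF h])
  fix i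
  let ?e = "\<lambda>(k::int) x. cos (of_int k * pi * x)"
  have "L2_inner h (\<lambda>x. cos (pi * x) ^ i * ?e 0 x) = 0"
  proof (rule trig_family_cos_power_inner[OF h])
    show "continuous_on UNIV (?e k)" for k by (intro continuous_intros)
    show "2 * cos (pi * x) * ?e k x = ?e (k + 1) x + ?e (k - 1) x" for k x
      by (simp add: algebra_simps cos_add cos_diff)
    fix k :: int
    have "?e k = (\<lambda>x. cos (real (nat \<bar>k\<bar>) * pi * x))"
    proof (rule ext)
      fix x
      have "cos (real (nat \<bar>k\<bar>) * pi * x) = cos \<bar>of_int k * (pi * x)\<bar>"
        by (cases "k \<ge> 0") (auto simp: abs_if mult.assoc split: if_splits) 
      then show "?e k x = cos (real (nat \<bar>k\<bar>) * pi * x)" by (simp add: mult.assoc)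
    qed
    then show "L2_inner h (?e k) = 0" using 0[of "nat \<bar>k\<bar>"] by (simp only:)
  qed
  then show "L2_inner h (\<lambda>x. cos (pi * x) ^ i) = 0" by simp
qed

text \<open>The sine of index 0 is zero, so the recursion is used at index 1. It shows that
  \<open>h\<close> times \<open>sin (pi * x)\<close> is orthogonal to all cosine powers, and this
  sine can be divided out because it is positive inside the interval.\<close>

lemma sin_complete:
  assumes h: "h \<in> L2" and 0: "\<And>k::nat. L2_inner h (\<lambda>x. sin (real k * pi * x)) = 0"
  shows "AE x in LI. h x = 0"
proof -
  let ?e = "\<lambda>(k::int) x. sin (of_int k * pi * x)"
  have [measurable]: "h \<in> borel_measurable LI" by (rule L2_measurable[OF h])
  have sL2: "(\<lambda>x. h x * sin (pi * x)) \<in> L2"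
  proof -
    have m: "(\<lambda>x. sin (pi * x)) \<in> borel_measurable LI"
      by (intro L2_measurable continuous_L2 continuous_intros)
    have "integrable LI (\<lambda>x. (h x * sin (pi * x))\<^sup>2)"
    proof (rule Bochner_Integration.integrable_bound[OF L2_square_integrable[OF h]])
      have "\<bar>(h x * sin (pi * x))\<^sup>2\<bar> \<le> \<bar>(h x)\<^sup>2\<bar>" for x
        by (simp add: power_mult_distrib mult_left_le abs_square_le_1)
      then show "AE x in LI. norm ((h x * sin (pi * x))\<^sup>2) \<le> norm ((h x)\<^sup>2)" by simp
    qed (use m in measurable)
    then show ?thesis using m by (simp add: L2_def)
  qed
  have *: "L2_inner h (\<lambda>x. cos (pi * x) ^ i * ?e 1 x) = 0" for i
  proof (rule trig_family_cos_power_inner[OF h])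
    show "continuous_on UNIV (?e k)" for k by (intro continuous_intros)
    show "2 * cos (pi * x) * ?e k x = ?e (k + 1) x + ?e (k - 1) x" for k x
      by (simp add: algebra_simps sin_add sin_diff)
    fix k :: int
    show "L2_inner h (?e k) = 0"
    proof (cases "k \<ge> 0")
      case True
      then have "?e k = (\<lambda>x. sin (real (nat k) * pi * x))" by simp
      then show ?thesis using 0 by simp
    next
      case False
      then have "?e k = (\<lambda>x. -1 * sin (real (nat (-k)) * pi * x))" by simp
      then have "L2_inner (?e k) h = -1 * L2_inner (\<lambda>x. sin (real (nat (-k)) * pi * x)) h"
        by (simp only: L2_inner_scale_left)
      then show ?thesis using 0 by (simp add: L2_inner_commute[of _ h])
    qed
  qed
  have "AE x in LI. h x * sin (pi * x) = 0"
  proof (rule cos_powers_complete[OF sL2])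
    show "L2_inner (\<lambda>x. h x * sin (pi * x)) (\<lambda>x. cos (pi * x) ^ i) = 0" for i
      using *[of i] by (simp add: L2_inner_def ac_simps)
  qed
  moreover have "AE x in LI. x \<in> I01" by (rule AE_I2) simp
  ultimately show ?thesis
  proof eventually_elim
    case (elim x)
    have "sin (pi * x) > 0" using elim(2) by (intro sin_gt_zero) auto
    then show ?case using elim by simp
  qed
qed

lemma cos_inner_const:
  assumes "k > 0" shows "L2_inner (\<lambda>x. c) (\<lambda>x. cos (real k * pi * x)) = 0"
proof -
  have "(LINT x|LI. cos (real k * pi * x)) = (LBINT x=0..1. cos (real k * pi * x))"
    by (intro LI_integral_eq_LBINT borel_measurable_continuous_onI continuous_intros)
  also have "\<dots> = 0"
    using integral_cos[of "real k * pi" 0 1] assms by (simp add: zero_ereal_def one_ereal_def sin_npi)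
  finally show ?thesis by (simp add: L2_inner_def)
qed

lemma cos_complete_const:
  assumes h: "h \<in> L2" and 0: "\<And>k::nat. k > 0 \<Longrightarrow> L2_inner h (\<lambda>x. cos (real k * pi * x)) = 0"
  shows "AE x in LI. h x = L2_inner h (\<lambda>x. 1)"
proof -
  let ?c = "L2_inner h (\<lambda>x. 1)"
  have "AE x in LI. h x - ?c = 0"
  proof (rule cos_complete[OF L2_diff[OF h L2_const]])
    fix k :: nat
    have c: "(\<lambda>x. cos (real k * pi * x)) \<in> L2" by (intro continuous_L2 continuous_intros)
    show "L2_inner (\<lambda>x. h x - ?c) (\<lambda>x. cos (real k * pi * x)) = 0"
    proof (cases "k = 0")
      case True
      have "L2_inner (\<lambda>x. ?c) (\<lambda>x. 1) = ?c" by (simp add: L2_inner_def measure_restrict_space)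
      then show ?thesis using L2_inner_diff_left[OF h L2_const[of ?c] c] True by simp
    next
      case False
      then show ?thesis using L2_inner_diff_left[OF h L2_const[of ?c] c] 0 cos_inner_const by simp
    qed
  qed
  then show ?thesis by simp
qed

lemma sin_has_weak_deriv:
  "has_weak_deriv (\<lambda>x. sin (real k * pi * x)) (\<lambda>x. real k * pi * cos (real k * pi * x))"
  by (rule C1_has_weak_deriv) (auto intro!: derivative_eq_intros continuous_intros)

lemma cos_has_weak_deriv:
  "has_weak_deriv (\<lambda>x. cos (real k * pi * x)) (\<lambda>x. - (real k * pi) * sin (real k * pi * x))"
  by (rule C1_has_weak_deriv) (auto intro!: derivative_eq_intros continuous_intros)

lemma sin_in_H10: "(\<lambda>x. sin (real k * pi * x)) \<in> H10"
proof (rule primitive_in_H10[where p = "\<lambda>x. real k * pi * cos (real k * pi * x)" and B = "real k * pi"])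
  show "(\<lambda>x. real k * pi * cos (real k * pi * x)) \<in> borel_measurable borel"
    by (intro borel_measurable_continuous_onI continuous_intros)
  show "\<bar>real k * pi * cos (real k * pi * x)\<bar> \<le> real k * pi" for x
    by (simp add: abs_mult mult_left_le)
  have *: "(LBINT z=0..x. real k * pi * cos (real k * pi * z)) = sin (real k * pi * x)" for x :: real
    using integral_cos[of "real k * pi" 0 x] by (cases "k = 0") (simp_all add: zero_ereal_def)
  show "sin (real k * pi * x) = (LBINT z=0..x. real k * pi * cos (real k * pi * z))" for x
    using * by simp
  show "(LBINT z=0..1. real k * pi * cos (real k * pi * z)) = 0"
    using *[of 1] by (simp add: one_ereal_def sin_npi)
  show "(\<lambda>x. sin (real k * pi * x)) \<in> borel_measurable LI"
    by (intro L2_measurable continuous_L2 continuous_intros)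
qed

subsection \<open>Continuity of translations\<close>

lemma Icc_integrable_bounded:
  fixes f :: "real \<Rightarrow> real"
  assumes [measurable]: "f \<in> borel_measurable borel" and b: "\<And>x. x \<in> {a..b} \<Longrightarrow> \<bar>f x\<bar> \<le> B"
  shows "integrable lborel (\<lambda>x. indicator {a..b} x * f x)"
proof (rule Bochner_Integration.integrable_bound)
  have "emeasure lborel {a..b} < \<infinity>" by (cases "a \<le> b") auto
  then show "integrable lborel (\<lambda>x. B * indicator {a..b} x)"
    by (intro integrable_mult_right integrable_real_indicator) auto
  have "norm (indicator {a..b} x * f x) \<le> norm (B * indicator {a..b} x)" for x
    using b[of x] by (auto simp: indicator_def)
  then show "AE x in lborel. norm (indicator {a..b} x * f x) \<le> norm (B * indicator {a..b} x)"
    by (intro AE_I2)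
qed measurable

text \<open>The L1 modulus of continuity under translation, restricted to a window because a
  periodic function is in general not integrable over the whole line.\<close>

definition trans_modulus :: "(real \<Rightarrow> real) \<Rightarrow> real \<Rightarrow> real \<Rightarrow> real" where
  "trans_modulus g K r = (\<integral>y. indicator {-K..K} y * \<bar>g (y - r) - g y\<bar> \<partial>lborel)"

text \<open>\<open>g\<close> is replaced by a bounded continuous function close to it in L1 on the
  window enlarged by 1, which contains every translate of the window by less than 1. On that compact
  set the replacement is uniformly continuous.\<close>

lemma trans_modulus_tendsto_0:
  fixes g :: "real \<Rightarrow> real"
  assumes g[measurable]: "g \<in> borel_measurable borel" and b: "\<And>x. \<bar>g x\<bar> \<le> B" and K: "K > 0"
  shows "((trans_modulus g K) \<longlongrightarrow> 0) (at 0)"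
  unfolding tendsto_iff
proof (intro allI impI)
  fix e :: real assume e: "e > 0"
  have gl: "g \<in> borel_measurable lebesgue" by (intro measurable_completion) simp
  obtain h where h: "\<And>n. continuous_on UNIV (h n)" "\<And>n x. \<bar>h n x\<bar> \<le> B"
    "AE x in lebesgue. (\<lambda>n. h n x) \<longlonglongrightarrow> g x"
    using bounded_limit_of_continuous[OF gl b] by metis
  have hm[measurable]: "h n \<in> borel_measurable borel" for n
    using h(1) by (rule borel_measurable_continuous_onI)
  let ?J = "indicator {-K-1..K+1} :: real \<Rightarrow> real"
  have "(\<lambda>n. \<integral>y. ?J y * \<bar>g y - h n y\<bar> \<partial>lborel) \<longlonglongrightarrow> (\<integral>y. 0 \<partial>(lborel :: real measure))"
  proof (rule integral_dominated_convergence[where w = "\<lambda>y. 2 * B * ?J y"])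
    show "integrable lborel (\<lambda>y. 2 * B * ?J y)"
      using Icc_integrable_bounded[of "\<lambda>y. 2 * B" "-K-1" "K+1" "\<bar>2 * B\<bar>"] by (simp add: mult.commute)
    have "AE x in lborel. (\<lambda>n. h n x) \<longlonglongrightarrow> g x" using h(3) by (simp add: AE_completion_iff)
    then show "AE y in lborel. (\<lambda>n. ?J y * \<bar>g y - h n y\<bar>) \<longlonglongrightarrow> 0"
    proof eventually_elim
      case (elim y)
      have "(\<lambda>n. ?J y * \<bar>g y - h n y\<bar>) \<longlonglongrightarrow> ?J y * \<bar>g y - g y\<bar>"
        by (intro tendsto_intros elim)
      then show ?case by simp
    qed
    have "norm (?J y * \<bar>g y - h n y\<bar>) \<le> 2 * B * ?J y" for n y
      using b[of y] h(2)[of n y] by (auto simp: indicator_def)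
    then show "AE y in lborel. norm (?J y * \<bar>g y - h n y\<bar>) \<le> 2 * B * ?J y" for n
      by (intro AE_I2)
  qed measurable
  then have "eventually (\<lambda>n. (\<integral>y. ?J y * \<bar>g y - h n y\<bar> \<partial>lborel) < e / 4) sequentially"
    using e by (intro order_tendstoD) auto
  then obtain n where n: "(\<integral>y. ?J y * \<bar>g y - h n y\<bar> \<partial>lborel) < e / 4"
    by (auto simp: eventually_sequentially)
  define c where "c = h n"
  have [measurable]: "c \<in> borel_measurable borel" by (simp add: c_def)
  have cb: "\<bar>c x\<bar> \<le> B" for x using h(2) by (simp add: c_def)
  have B: "0 \<le> B" using b[of 0] by linarith
  have cd: "\<bar>c x - c y\<bar> \<le> 2 * B" and gd: "\<bar>g x - g y\<bar> \<le> 2 * B" for x y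
    using cb[of x] cb[of y] b[of x] b[of y] by linarith+
  have gc: "\<bar>g y - c y\<bar> \<le> 2 * B" for y using b[of y] cb[of y] by linarith
  have "uniformly_continuous_on {-K-1..K+1} c"
    using continuous_on_subset[OF h(1)[of n]] by (intro compact_uniformly_continuous) (auto simp: c_def)
  \<comment> \<open>The window has length \<open>2 * K\<close>, so this pointwise bound contributes
    \<open>e / 4\<close>, like each of the two approximation errors; the total stays strictly below
    \<open>e\<close>.\<close>
  moreover have "e / (8 * K) > 0" using e K by simp
  ultimately obtain d where d: "d > 0" "\<And>x y. \<lbrakk>x \<in> {-K-1..K+1}; y \<in> {-K-1..K+1}; dist y x < d\<rbrakk> \<Longrightarrow> dist (c y) (c x) < e / (8 * K)"
    unfolding uniformly_continuous_on_def by blast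
  have "trans_modulus g K r < e" if r: "\<bar>r\<bar> < min d 1" for r
  proof -
    let ?I = "indicator {-K..K} :: real \<Rightarrow> real"
    have i1: "integrable lborel (\<lambda>y. ?I y * \<bar>g (y - r) - c (y - r)\<bar>)"
      by (rule Icc_integrable_bounded[where B = "2 * B"]) (use gc in auto)
    have i2: "integrable lborel (\<lambda>y. ?I y * \<bar>c (y - r) - c y\<bar>)"
      by (rule Icc_integrable_bounded[where B = "2 * B"]) (use cd in auto)
    have i3: "integrable lborel (\<lambda>y. ?I y * \<bar>g y - c y\<bar>)"
      by (rule Icc_integrable_bounded[where B = "2 * B"]) (use gc in auto)
    have i4: "integrable lborel (\<lambda>y. ?I y * \<bar>g (y - r) - g y\<bar>)"
      by (rule Icc_integrable_bounded[where B = "2 * B"]) (use gd in auto)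
    have iJ: "integrable lborel (\<lambda>y. ?J y * \<bar>g y - c y\<bar>)"
      by (rule Icc_integrable_bounded[where B = "2 * B"]) (use gc in auto)
    have "trans_modulus g K r \<le> (\<integral>y. ?I y * \<bar>g (y - r) - c (y - r)\<bar> + ?I y * \<bar>c (y - r) - c y\<bar> + ?I y * \<bar>g y - c y\<bar> \<partial>lborel)"
      unfolding trans_modulus_def using i1 i2 i3 i4
      by (intro Bochner_Integration.integral_mono Bochner_Integration.integrable_add) (auto simp: indicator_def)
    also have "\<dots> = (\<integral>y. ?I y * \<bar>g (y - r) - c (y - r)\<bar> \<partial>lborel) + (\<integral>y. ?I y * \<bar>c (y - r) - c y\<bar> \<partial>lborel)
        + (\<integral>y. ?I y * \<bar>g y - c y\<bar> \<partial>lborel)" using i1 i2 i3 by simp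
    also have "(\<integral>y. ?I y * \<bar>g (y - r) - c (y - r)\<bar> \<partial>lborel) = (\<integral>y. ?I (r + 1 * y) * \<bar>g (r + 1 * y - r) - c (r + 1 * y - r)\<bar> \<partial>lborel)"
      by (subst lborel_integral_real_affine[where c = 1 and t = r]) simp_all
    also have "\<dots> \<le> (\<integral>y. ?J y * \<bar>g y - c y\<bar> \<partial>lborel)"
    proof (rule Bochner_Integration.integral_mono[OF _ iJ])
      show "integrable lborel (\<lambda>y. ?I (r + 1 * y) * \<bar>g (r + 1 * y - r) - c (r + 1 * y - r)\<bar>)"
        by (rule lborel_integrable_real_affine[OF i1]) simp
    qed (use r in \<open>auto simp: indicator_def\<close>)
    also have "\<dots> < e / 4" using n by (simp add: c_def)
    also have "(\<integral>y. ?I y * \<bar>g y - c y\<bar> \<partial>lborel) \<le> (\<integral>y. ?J y * \<bar>g y - c y\<bar> \<partial>lborel)"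
      by (intro Bochner_Integration.integral_mono i3 iJ) (auto simp: indicator_def)
    also have "(\<integral>y. ?J y * \<bar>g y - c y\<bar> \<partial>lborel) < e / 4" using n by (simp add: c_def)
    also have "(\<integral>y. ?I y * \<bar>c (y - r) - c y\<bar> \<partial>lborel) \<le> (\<integral>y. ?I y * (e / (8 * K)) \<partial>lborel)"
    proof (intro Bochner_Integration.integral_mono i2)
      show "integrable lborel (\<lambda>y. ?I y * (e / (8 * K)))"
        by (rule Icc_integrable_bounded[where B = "\<bar>e / (8 * K)\<bar>"]) auto
      fix y
      show "?I y * \<bar>c (y - r) - c y\<bar> \<le> ?I y * (e / (8 * K))"
      proof (cases "y \<in> {-K..K}")
        case True
        then have "y \<in> {-K-1..K+1}" "y - r \<in> {-K-1..K+1}" using r by auto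
        then have "\<bar>c (y - r) - c y\<bar> < e / (8 * K)"
          using d(2)[of y "y - r"] r by (simp add: dist_real_def)
        then show ?thesis by (simp add: indicator_def)
      qed simp
    qed
    also have "(\<integral>y. ?I y * (e / (8 * K)) \<partial>lborel) = e / 4" using K by simp
    finally show ?thesis using e by simp
  qed
  moreover have "0 \<le> trans_modulus g K r" for r
    unfolding trans_modulus_def by (intro Bochner_Integration.integral_nonneg) auto
  ultimately have "dist (trans_modulus g K r) 0 < e" if "\<bar>r\<bar> < min d 1" for r
    using that by (simp add: dist_real_def)
  then show "\<forall>\<^sub>F r in at 0. dist (trans_modulus g K r) 0 < e"
    unfolding eventually_at using d(1) by (intro exI[of _ "min d 1"]) (auto simp: dist_real_def)
qed

lemma trans_modulus_measurable[measurable]: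
  assumes [measurable]: "g \<in> borel_measurable borel"
  shows "trans_modulus g K \<in> borel_measurable borel"
  unfolding trans_modulus_def[abs_def] by measurable

text \<open>The substitution \<open>y = \<sigma> * x - t\<close> preserves length and sends the unit
  interval into the window of radius \<open>\<bar>t\<bar> + 1\<close>. The two signs of \<sigma> are
  the two families of characteristics.\<close>

lemma LI_integral_affine_le:
  fixes f :: "real \<Rightarrow> real"
  assumes f[measurable]: "f \<in> borel_measurable borel" and b: "\<And>y. \<bar>f y\<bar> \<le> M" and nn: "\<And>y. 0 \<le> f y"
    and \<sigma>: "\<bar>\<sigma>\<bar> = 1"
  shows "(LINT x|LI. f (\<sigma> * x - t)) \<le> (\<integral>y. indicator {-(\<bar>t\<bar> + 1)..\<bar>t\<bar> + 1} y * f y \<partial>lborel)"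
proof -
  have i: "integrable lborel (\<lambda>y. indicator {0<..<1} y * f (\<sigma> * y - t))"
    by (rule Ioo_integrable_bounded[where B = M]) (use b in auto)
  have "(LINT x|LI. f (\<sigma> * x - t)) = (LBINT x=0..1. f (\<sigma> * x - t))"
    by (intro LI_integral_eq_LBINT) measurable
  also have "\<dots> = (\<integral>x. indicator {0<..<1} x * f (\<sigma> * x - t) \<partial>lborel)"
    using LBINT_eq_indicator[of 0 1] by (simp add: zero_ereal_def one_ereal_def)
  also have "\<dots> = (\<integral>x. indicator {0<..<1} (\<sigma> * t + \<sigma> * x) * f (\<sigma> * (\<sigma> * t + \<sigma> * x) - t) \<partial>lborel)"
    using \<sigma> by (subst lborel_integral_real_affine[where c = \<sigma> and t = "\<sigma> * t"]) auto
  also have "\<dots> \<le> (\<integral>y. indicator {-(\<bar>t\<bar> + 1)..\<bar>t\<bar> + 1} y * f y \<partial>lborel)"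
  proof (rule Bochner_Integration.integral_mono)
    show "integrable lborel (\<lambda>x. indicator {0<..<1} (\<sigma> * t + \<sigma> * x) * f (\<sigma> * (\<sigma> * t + \<sigma> * x) - t))"
      by (rule lborel_integrable_real_affine[OF i]) (use \<sigma> in auto)
    show "integrable lborel (\<lambda>y. indicator {-(\<bar>t\<bar> + 1)..\<bar>t\<bar> + 1} y * f y)"
      by (rule Icc_integrable_bounded[where B = M]) (use b in auto)
    fix x :: real
    from \<sigma> have "\<sigma> = 1 \<or> \<sigma> = -1" by (auto simp: abs_if split: if_splits)
    then show "indicator {0<..<1} (\<sigma> * t + \<sigma> * x) * f (\<sigma> * (\<sigma> * t + \<sigma> * x) - t) \<le> indicator {-(\<bar>t\<bar> + 1)..\<bar>t\<bar> + 1} x * f x"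
      using nn by (auto simp: indicator_def)
  qed
  finally show ?thesis .
qed

lemma shift_L2_continuous:
  fixes g :: "real \<Rightarrow> real"
  assumes g[measurable]: "g \<in> borel_measurable borel" and b: "\<And>x. \<bar>g x\<bar> \<le> B" and \<sigma>: "\<bar>\<sigma>\<bar> = 1"
  shows "((\<lambda>s. L2_norm (\<lambda>x. g (\<sigma> * x - s) - g (\<sigma> * x - t))) \<longlongrightarrow> 0) (at t)"
proof -
  have d: "\<bar>g x - g y\<bar> \<le> 2 * B" for x y using b[of x] b[of y] by linarith
  have B: "0 \<le> B" using b[of 0] by linarith
  have le: "(L2_norm (\<lambda>x. g (\<sigma> * x - s) - g (\<sigma> * x - t)))\<^sup>2 \<le> 2 * B * trans_modulus g (\<bar>t\<bar> + 1) (s - t)" for s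
  proof -
    have "(L2_norm (\<lambda>x. g (\<sigma> * x - s) - g (\<sigma> * x - t)))\<^sup>2 \<le> 2 * B * (LINT x|LI. \<bar>g (\<sigma> * x - s) - g (\<sigma> * x - t)\<bar>)"
      by (intro L2_norm_le_L1 borel_imp_LI d) measurable
    also have "(LINT x|LI. \<bar>g (\<sigma> * x - s) - g (\<sigma> * x - t)\<bar>) \<le> trans_modulus g (\<bar>t\<bar> + 1) (s - t)"
      using LI_integral_affine_le[of "\<lambda>y. \<bar>g (y - (s - t)) - g y\<bar>" "2 * B" \<sigma> t] d \<sigma>
      by (simp add: trans_modulus_def)
    finally show ?thesis using B by (simp add: mult_left_mono)
  qed
  have "((\<lambda>s. trans_modulus g (\<bar>t\<bar> + 1) (s - t)) \<longlongrightarrow> 0) (at t)"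
    by (rule LIM_offset_zero_cancel) (use trans_modulus_tendsto_0[OF g b, of "\<bar>t\<bar> + 1"] in simp)
  then have "((\<lambda>s. sqrt (2 * B * trans_modulus g (\<bar>t\<bar> + 1) (s - t))) \<longlongrightarrow> sqrt (2 * B * 0)) (at t)"
    by (intro tendsto_intros)
  then have l: "((\<lambda>s. sqrt (2 * B * trans_modulus g (\<bar>t\<bar> + 1) (s - t))) \<longlongrightarrow> 0) (at t)" by simp
  show ?thesis
    by (rule tendsto_sandwich[OF _ _ tendsto_const l])
      (auto intro!: always_eventually L2_norm_nonneg real_le_rsqrt le)
qed

section \<open>Primitives of bounded functions and their difference quotients\<close>

lemma indefinite_integral_lipschitz:
  fixes g :: "real \<Rightarrow> real"
  assumes g: "g \<in> borel_measurable borel" and bnd: "\<And>x. \<bar>g x\<bar> \<le> B"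
    and G: "\<And>a b. G b - G a = (LBINT z=ereal a..ereal b. g z)"
  shows "\<bar>G b - G a\<bar> \<le> B * \<bar>b - a\<bar>"
proof -
  have B: "0 \<le> B" using bnd[of 0] by linarith
  have *: "\<bar>G b - G a\<bar> \<le> B * (b - a)" if "a \<le> b" for a b
  proof -
    have "G b - G a = (\<integral>z. indicator {a<..<b} z * g z \<partial>lborel)"
      using G LBINT_eq_indicator[OF that] by simp
    also have "\<bar>\<integral>z. indicator {a<..<b} z * g z \<partial>lborel\<bar> \<le> (\<integral>z. B * indicator {a<..<b} z \<partial>lborel)"
    proof (rule order_trans[OF integral_abs_bound], rule Bochner_Integration.integral_mono)
      show "integrable lborel (\<lambda>z. \<bar>indicator {a<..<b} z * g z\<bar>)"
        using Ioo_integrable_bounded[OF g bnd] by simp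
      show "integrable lborel (\<lambda>z. B * indicator {a<..<b} z)"
        using Ioo_integrable_bounded[of "\<lambda>_. B" a b B] B by (simp add: mult.commute)
      show "\<bar>indicator {a<..<b} z * g z\<bar> \<le> B * indicator {a<..<b} z" for z
        using bnd[of z] by (auto simp: indicator_def)
    qed
    also have "\<dots> = B * (b - a)" using that by simp
    finally show ?thesis .
  qed
  show ?thesis using *[of a b] *[of b a] by (cases "a \<le> b") (auto simp: abs_minus_commute)
qed

lemma lipschitz_borel_measurable:
  fixes G :: "real \<Rightarrow> real"
  assumes "\<And>a b. \<bar>G b - G a\<bar> \<le> B * \<bar>b - a\<bar>" and B: "0 \<le> B"
  shows "G \<in> borel_measurable borel"
proof (rule borel_measurable_continuous_onI)
  have "B-lipschitz_on UNIV G"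
    by (rule lipschitz_onI) (use assms in \<open>auto simp: dist_real_def\<close>)
  then show "continuous_on UNIV G" by (rule lipschitz_on_continuous_on)
qed

text \<open>The error of the difference quotient of a primitive is an average of translation errors.\<close>

lemma shift_difference_quotient:
  fixes g :: "real \<Rightarrow> real"
  assumes g[measurable]: "g \<in> borel_measurable borel" and b: "\<And>x. \<bar>g x\<bar> \<le> B" and \<sigma>: "\<bar>\<sigma>\<bar> = 1"
    and G: "\<And>a b. G b - G a = (LBINT z=ereal a..ereal b. g z)"
  shows "((\<lambda>s. L2_norm (\<lambda>x. (G (\<sigma> * x - s) - G (\<sigma> * x - t)) / (s - t) + g (\<sigma> * x - t))) \<longlongrightarrow> 0) (at t)"
proof -
  have B: "0 \<le> B" using b[of 0] by linarith
  have gd: "\<bar>g x - g y\<bar> \<le> 2 * B" for x y using b[of x] b[of y] by linarith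
  define Q where "Q r y = (G (y - r) - G y) / r + g y" for r y
  note Gle = indefinite_integral_lipschitz[OF g b G]
  have Gm[measurable]: "G \<in> borel_measurable borel" by (rule lipschitz_borel_measurable[OF Gle B])
  have Qm[measurable]: "Q r \<in> borel_measurable borel" for r unfolding Q_def[abs_def] by measurable
  have Qb: "\<bar>Q r y\<bar> \<le> 2 * B" for r y
  proof (cases "r = 0")
    case False
    have "\<bar>(G (y - r) - G y) / r\<bar> \<le> B" using Gle[of "y - r" y] False by (simp add: abs_divide field_simps)
    then show ?thesis unfolding Q_def using b[of y] by linarith
  qed (use b[of y] B in \<open>simp add: Q_def\<close>)
  have Qle: "\<bar>Q r y\<bar> \<le> (\<integral>\<rho>. indicator {-\<bar>r\<bar>..\<bar>r\<bar>} \<rho> * \<bar>g (y - \<rho>) - g y\<bar> \<partial>lborel) / \<bar>r\<bar>" if r: "r \<noteq> 0" for r y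
  proof -
    let ?lo = "min (y - r) y" and ?hi = "max (y - r) y"
    have i: "integrable lborel (\<lambda>z. indicator {?lo<..<?hi} z * g z)"
      "integrable lborel (\<lambda>z. indicator {?lo<..<?hi} z * g y)"
      "integrable lborel (\<lambda>z. indicator {?lo<..<?hi} z * \<bar>g z - g y\<bar>)"
      by (rule Ioo_integrable_bounded[where B = "2 * B"]; use b B gd in \<open>auto intro: order_trans[of _ B]\<close>)+
    have iR: "integrable lborel (\<lambda>\<rho>. indicator {-\<bar>r\<bar>..\<bar>r\<bar>} \<rho> * \<bar>g (y - \<rho>) - g y\<bar>)"
      by (rule Icc_integrable_bounded[where B = "2 * B"]) (use gd in auto)
    have "\<bar>Q r y\<bar> * \<bar>r\<bar> = \<bar>(G ?hi - G ?lo) - (?hi - ?lo) * g y\<bar>"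
    proof -
      have "Q r y * r = G (y - r) - G y + r * g y" using r by (simp add: Q_def field_simps)
      then have "\<bar>Q r y\<bar> * \<bar>r\<bar> = \<bar>G (y - r) - G y + r * g y\<bar>" by (metis abs_mult)
      then show ?thesis by (auto simp: min_def max_def algebra_simps)
    qed
    also have "(G ?hi - G ?lo) - (?hi - ?lo) * g y = (\<integral>z. indicator {?lo<..<?hi} z * g z - indicator {?lo<..<?hi} z * g y \<partial>lborel)"
      using G[of ?hi ?lo] LBINT_eq_indicator[of ?lo ?hi g] i by simp
    also have "\<bar>\<dots>\<bar> \<le> (\<integral>z. indicator {?lo<..<?hi} z * \<bar>g z - g y\<bar> \<partial>lborel)"
      by (rule order_trans[OF integral_abs_bound], rule eq_refl, rule Bochner_Integration.integral_cong)
        (auto simp: indicator_def)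
    also have "\<dots> = (\<integral>\<rho>. indicator {?lo<..<?hi} (y + (-1) * \<rho>) * \<bar>g (y + (-1) * \<rho>) - g y\<bar> \<partial>lborel)"
      by (subst lborel_integral_real_affine[where c = "-1" and t = y]) simp_all
    also have "\<dots> \<le> (\<integral>\<rho>. indicator {-\<bar>r\<bar>..\<bar>r\<bar>} \<rho> * \<bar>g (y - \<rho>) - g y\<bar> \<partial>lborel)"
    proof (rule Bochner_Integration.integral_mono[OF _ iR])
      show "integrable lborel (\<lambda>\<rho>. indicator {?lo<..<?hi} (y + (-1) * \<rho>) * \<bar>g (y + (-1) * \<rho>) - g y\<bar>)"
        by (rule lborel_integrable_real_affine[OF i(3)]) simp
    qed (auto simp: indicator_def min_def max_def split: if_splits)
    finally show ?thesis using r by (simp add: field_simps)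
  qed
  let ?K = "\<bar>t\<bar> + 1"
  let ?I = "indicator {-?K..?K} :: real \<Rightarrow> real"
  \<comment> \<open>Fubini turns the averaged error into an average of \<open>trans_modulus\<close>.
    The shifts range over an interval of length \<open>2 * \<bar>r\<bar>\<close>, symmetric so as to
    cover both signs of \<open>r\<close>, while the quotient divides by
    \<open>\<bar>r\<bar>\<close>; this is the factor 2.\<close>
  have L1: "(\<integral>y. ?I y * \<bar>Q r y\<bar> \<partial>lborel) \<le> 2 * e"
    if r: "r \<noteq> 0" and e: "\<And>\<rho>. \<bar>\<rho>\<bar> \<le> \<bar>r\<bar> \<Longrightarrow> trans_modulus g ?K \<rho> \<le> e" for r e
  proof -
    let ?R = "indicator {-\<bar>r\<bar>..\<bar>r\<bar>} :: real \<Rightarrow> real"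
    define F where "F y \<rho> = ?I y * ?R \<rho> * \<bar>g (y - \<rho>) - g y\<bar>" for y \<rho>
    have F: "integrable (lborel \<Otimes>\<^sub>M lborel) (case_prod F)"
    proof (rule Bochner_Integration.integrable_bound)
      show "integrable (lborel \<Otimes>\<^sub>M lborel) (\<lambda>y. 2 * B * indicator ({-?K..?K} \<times> {-\<bar>r\<bar>..\<bar>r\<bar>}) y)"
        by (intro integrable_mult_right integrable_real_indicator)
          (auto simp: lborel.emeasure_pair_measure_Times ennreal_mult_less_top)
      show "case_prod F \<in> borel_measurable (lborel \<Otimes>\<^sub>M lborel)" unfolding F_def[abs_def] by measurable
      have "norm (case_prod F y) \<le> norm (2 * B * indicator ({-?K..?K} \<times> {-\<bar>r\<bar>..\<bar>r\<bar>}) y)" for y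
        using gd[of "fst y - snd y" "fst y"] B by (cases y) (auto simp: F_def indicator_def)
      then show "AE y in lborel \<Otimes>\<^sub>M lborel. norm (case_prod F y) \<le> norm (2 * B * indicator ({-?K..?K} \<times> {-\<bar>r\<bar>..\<bar>r\<bar>}) y)"
        by (intro AE_I2)
    qed
    have F1: "(\<integral>\<rho>. F y \<rho> \<partial>lborel) = ?I y * (\<integral>\<rho>. ?R \<rho> * \<bar>g (y - \<rho>) - g y\<bar> \<partial>lborel)" for y
      by (simp add: F_def mult.assoc)
    have F2: "(\<integral>y. F y \<rho> \<partial>lborel) = ?R \<rho> * trans_modulus g ?K \<rho>" for \<rho>
      unfolding F_def trans_modulus_def by (subst integral_mult_right_zero[symmetric]) (simp add: ac_simps)
    have iF1: "integrable lborel (\<lambda>y. ?I y * (\<integral>\<rho>. ?R \<rho> * \<bar>g (y - \<rho>) - g y\<bar> \<partial>lborel))"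
      using lborel_pair.integrable_fst[OF F] by (simp add: F1)
    have iF2: "integrable lborel (\<lambda>\<rho>. ?R \<rho> * trans_modulus g ?K \<rho>)"
      using lborel_pair.integrable_snd[OF F] by (simp add: F2)
    have "(\<integral>y. ?I y * \<bar>Q r y\<bar> \<partial>lborel) \<le> (\<integral>y. (1 / \<bar>r\<bar>) * (?I y * (\<integral>\<rho>. ?R \<rho> * \<bar>g (y - \<rho>) - g y\<bar> \<partial>lborel)) \<partial>lborel)"
    proof (rule Bochner_Integration.integral_mono)
      show "integrable lborel (\<lambda>y. ?I y * \<bar>Q r y\<bar>)"
        by (rule Icc_integrable_bounded[where B = "2 * B"]) (use Qb in auto)
      show "integrable lborel (\<lambda>y. (1 / \<bar>r\<bar>) * (?I y * (\<integral>\<rho>. ?R \<rho> * \<bar>g (y - \<rho>) - g y\<bar> \<partial>lborel)))"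
        using iF1 by (rule integrable_mult_right)
      show "?I y * \<bar>Q r y\<bar> \<le> (1 / \<bar>r\<bar>) * (?I y * (\<integral>\<rho>. ?R \<rho> * \<bar>g (y - \<rho>) - g y\<bar> \<partial>lborel))" for y
        using mult_left_mono[OF Qle[OF r, of y], of "?I y"] by simp
    qed
    also have "\<dots> = (1 / \<bar>r\<bar>) * (\<integral>\<rho>. ?R \<rho> * trans_modulus g ?K \<rho> \<partial>lborel)"
      using lborel_pair.Fubini_integral[OF F] by (simp add: F1 F2)
    also have "\<dots> \<le> (1 / \<bar>r\<bar>) * (\<integral>\<rho>. ?R \<rho> * e \<partial>lborel)"
    proof (rule mult_left_mono, rule Bochner_Integration.integral_mono[OF iF2])
      show "integrable lborel (\<lambda>\<rho>. ?R \<rho> * e)"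
        by (rule Icc_integrable_bounded[where B = "\<bar>e\<bar>"]) auto
      show "?R \<rho> * trans_modulus g ?K \<rho> \<le> ?R \<rho> * e" for \<rho>
        using e[of \<rho>] by (auto simp: indicator_def)
    qed simp
    also have "\<dots> = 2 * e" using r by simp
    finally show ?thesis .
  qed
  have tm0: "trans_modulus g ?K 0 = 0" by (simp add: trans_modulus_def)
  show ?thesis
    unfolding tendsto_iff
  proof (intro allI impI)
    fix e :: real assume e: "e > 0"
    \<comment> \<open>The squared norm will be at most \<open>2 * B * (2 * e')\<close>, which is
      then less than \<open>e^2\<close>; \<open>B + 1\<close> instead of \<open>B\<close> avoids a
      division by zero.\<close>
    define e' where "e' = e\<^sup>2 / (8 * (B + 1))"
    have e': "e' > 0" using e B by (simp add: e'_def)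
    have "\<forall>\<^sub>F r in at 0. dist (trans_modulus g ?K r) 0 < e'"
      using trans_modulus_tendsto_0[OF g b, of ?K] e' unfolding tendsto_iff by (auto simp: add_pos_nonneg)
    then obtain d where d: "d > 0" "\<And>r. \<lbrakk>r \<noteq> 0; \<bar>r\<bar> < d\<rbrakk> \<Longrightarrow> \<bar>trans_modulus g ?K r\<bar> < e'"
      unfolding eventually_at by (auto simp: dist_real_def)
    have "L2_norm (\<lambda>x. (G (\<sigma> * x - s) - G (\<sigma> * x - t)) / (s - t) + g (\<sigma> * x - t)) < e"
      if s: "s \<noteq> t" "\<bar>s - t\<bar> < d" for s
    proof -
      have eq: "(G (\<sigma> * x - s) - G (\<sigma> * x - t)) / (s - t) + g (\<sigma> * x - t) = Q (s - t) (\<sigma> * x - t)" for x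
        by (simp add: Q_def)
      have "(L2_norm (\<lambda>x. Q (s - t) (\<sigma> * x - t)))\<^sup>2 \<le> 2 * B * (LINT x|LI. \<bar>Q (s - t) (\<sigma> * x - t)\<bar>)"
        by (intro L2_norm_le_L1 borel_imp_LI Qb) measurable
      also have "\<dots> \<le> 2 * B * (\<integral>y. ?I y * \<bar>Q (s - t) y\<bar> \<partial>lborel)"
        using LI_integral_affine_le[of "\<lambda>y. \<bar>Q (s - t) y\<bar>" "2 * B" \<sigma> t] Qb \<sigma> B
        by (intro mult_left_mono) auto
      also have "\<dots> \<le> 2 * B * (2 * e')"
      proof (intro mult_left_mono L1)
        fix \<rho> assume "\<bar>\<rho>\<bar> \<le> \<bar>s - t\<bar>"
        then show "trans_modulus g ?K \<rho> \<le> e'"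
          using d(2)[of \<rho>] s e' tm0 by (cases "\<rho> = 0") auto
      qed (use s B in auto)
      also have "\<dots> = e\<^sup>2 * (B / (2 * (B + 1)))" using B by (simp add: e'_def field_simps)
      also have "\<dots> < e\<^sup>2 * 1" using B e by (intro mult_strict_left_mono) (auto simp: field_simps)
      finally have "(L2_norm (\<lambda>x. Q (s - t) (\<sigma> * x - t)))\<^sup>2 < e\<^sup>2" by simp
      then show ?thesis unfolding eq using e by (intro power2_less_imp_less[of _ e]) auto
    qed
    then show "\<forall>\<^sub>F s in at t. dist (L2_norm (\<lambda>x. (G (\<sigma> * x - s) - G (\<sigma> * x - t)) / (s - t) + g (\<sigma> * x - t))) 0 < e"
      unfolding eventually_at using d(1) by (intro exI[of _ d]) (auto simp: dist_real_def L2_norm_nonneg)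
  qed
qed

subsection \<open>Periodic functions\<close>

lemma nn_integral_indicator_shift:
  fixes f :: "real \<Rightarrow> ennreal"
  assumes [measurable]: "f \<in> borel_measurable borel"
  shows "(\<integral>\<^sup>+y. indicator {a..<b} y * f (y + c) \<partial>lborel) = (\<integral>\<^sup>+y. indicator {a + c..<b + c} y * f y \<partial>lborel)"
proof -
  have "(\<integral>\<^sup>+y. indicator {a + c..<b + c} y * f y \<partial>lborel)
      = (\<integral>\<^sup>+y. indicator {a + c..<b + c} (c + 1 * y) * f (c + 1 * y) \<partial>lborel)"
    by (subst nn_integral_real_affine[where c = 1 and t = c]) simp_all
  also have "\<dots> = (\<integral>\<^sup>+y. indicator {a..<b} y * f (y + c) \<partial>lborel)"
    by (intro nn_integral_cong) (auto simp: indicator_def add.commute)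
  finally show ?thesis by simp
qed

lemma periodic_add_int:
  fixes f :: "real \<Rightarrow> 'a"
  assumes "\<And>y. f (y + 2) = f y" shows "f (y + 2 * of_int n) = f y"
proof -
  have *: "f (y + 2 * of_nat m) = f y" for m y
  proof (induction m)
    case (Suc m)
    have "f (y + 2 * of_nat (Suc m)) = f ((y + 2 * of_nat m) + 2)" by (simp add: algebra_simps)
    with Suc assms show ?case by metis
  qed simp
  show ?thesis
  proof (cases "n \<ge> 0")
    case True then show ?thesis using *[of y "nat n"] by simp
  next
    case False then show ?thesis using *[of "y + 2 * of_int n" "nat (-n)"] by simp
  qed
qed

text \<open>Every window of length 2 is cut at the even integer it contains to the right of its left
  end, and the right piece is moved back by one period. This compares it with the window
  \<open>[0, 2)\<close>.\<close>

lemma nn_integral_periodic: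
  fixes f :: "real \<Rightarrow> ennreal"
  assumes f[measurable]: "f \<in> borel_measurable borel" and per: "\<And>y. f (y + 2) = f y"
  shows "(\<integral>\<^sup>+y. indicator {a..<a + 2} y * f y \<partial>lborel) = (\<integral>\<^sup>+y. indicator {b..<b + 2} y * f y \<partial>lborel)"
proof -
  have *: "(\<integral>\<^sup>+y. indicator {a..<a + 2} y * f y \<partial>lborel) = (\<integral>\<^sup>+y. indicator {0..<2} y * f y \<partial>lborel)" for a
  proof -
    define m where "m = \<lfloor>a / 2\<rfloor>"
    have m: "2 * of_int m \<le> a" "a < 2 * of_int m + 2"
      unfolding m_def by linarith+
    let ?m = "2 * of_int m :: real"
    have "(\<integral>\<^sup>+y. indicator {a..<a + 2} y * f y \<partial>lborel)
        = (\<integral>\<^sup>+y. indicator {a..<?m + 2} y * f y + indicator {?m + 2..<a + 2} y * f y \<partial>lborel)"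
      using m by (intro nn_integral_cong) (auto simp: indicator_def)
    also have "\<dots> = (\<integral>\<^sup>+y. indicator {a..<?m + 2} y * f y \<partial>lborel) + (\<integral>\<^sup>+y. indicator {?m + 2..<a + 2} y * f y \<partial>lborel)"
      by (rule nn_integral_add) measurable
    also have "(\<integral>\<^sup>+y. indicator {?m + 2..<a + 2} y * f y \<partial>lborel) = (\<integral>\<^sup>+y. indicator {?m..<a} y * f y \<partial>lborel)"
      using nn_integral_indicator_shift[OF f, of ?m a 2] per by simp
    also have "(\<integral>\<^sup>+y. indicator {a..<?m + 2} y * f y \<partial>lborel) + (\<integral>\<^sup>+y. indicator {?m..<a} y * f y \<partial>lborel)
        = (\<integral>\<^sup>+y. indicator {a..<?m + 2} y * f y + indicator {?m..<a} y * f y \<partial>lborel)"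
      by (rule nn_integral_add[symmetric]) measurable
    also have "\<dots> = (\<integral>\<^sup>+y. indicator {?m..<?m + 2} y * f y \<partial>lborel)"
      using m by (intro nn_integral_cong) (auto simp: indicator_def)
    also have "\<dots> = (\<integral>\<^sup>+y. indicator {0..<2} y * f y \<partial>lborel)"
      using nn_integral_indicator_shift[OF f, of 0 2 ?m] periodic_add_int[of f, OF per] by (simp add: add.commute)
    finally show ?thesis .
  qed
  show ?thesis using *[of a] *[of b] by simp
qed

subsection \<open>d'Alembert solutions\<close>

definition primitive :: "(real \<Rightarrow> real) \<Rightarrow> real \<Rightarrow> real" where
  "primitive g y = (LBINT z=ereal 0..ereal y. g z)"

lemma primitive_diff:
  assumes "g \<in> borel_measurable borel" "\<And>x. \<bar>g x\<bar> \<le> B"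
  shows "primitive g b - primitive g a = (LBINT z=ereal a..ereal b. g z)"
proof -
  have "interval_lebesgue_integrable lborel (min (ereal 0) (min (ereal a) (ereal b))) (max (ereal 0) (max (ereal a) (ereal b))) g"
    using interval_lebesgue_integrable_bounded[OF assms(1), of "min 0 (min a b)" "max 0 (max a b)" B] assms(2)
    by (simp add: min_def max_def split: if_splits)
  then have "(LBINT z=ereal 0..ereal a. g z) + (LBINT z=ereal a..ereal b. g z) = (LBINT z=ereal 0..ereal b. g z)"
    by (rule interval_integral_sum)
  then show ?thesis by (simp add: primitive_def)
qed

lemma LBINT_shift:
  fixes g :: "real \<Rightarrow> real"
  assumes x: "0 \<le> x"
  shows "(LBINT z=ereal 0..ereal x. g (z - t)) = (LBINT z=ereal (-t)..ereal (x - t). g z)"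
    "(LBINT z=ereal 0..ereal x. g (- z - t)) = (LBINT z=ereal (-x-t)..ereal (- t). g z)"
proof -
  have "(\<integral>z. indicator {-t<..<x - t} z * g z \<partial>lborel) = (\<integral>z. indicator {-t<..<x - t} (-t + 1 * z) * g (- t + 1 * z) \<partial>lborel)"
    by (subst lborel_integral_real_affine[where c = 1 and t = "-t"]) simp_all
  also have "\<dots> = (\<integral>z. indicator {0<..<x} z * g (z - t) \<partial>lborel)"
    by (intro Bochner_Integration.integral_cong) (auto simp: indicator_def)
  finally show "(LBINT z=ereal 0..ereal x. g (z - t)) = (LBINT z=ereal (-t)..ereal (x - t). g z)"
    using x LBINT_eq_indicator[of 0 x "\<lambda>z. g (z - t)"] LBINT_eq_indicator[of "-t" "x-t" g] by simp
  have "(\<integral>z. indicator {-x-t<..<- t} z * g z \<partial>lborel) = (\<integral>z. indicator {-x-t<..<- t} (-t + (-1) * z) * g (- t + (-1) * z) \<partial>lborel)"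
    by (subst lborel_integral_real_affine[where c = "-1" and t = "-t"]) simp_all
  also have "\<dots> = (\<integral>z. indicator {0<..<x} z * g (- z - t) \<partial>lborel)"
    by (intro Bochner_Integration.integral_cong) (auto simp: indicator_def algebra_simps)
  finally show "(LBINT z=ereal 0..ereal x. g (- z - t)) = (LBINT z=ereal (-x-t)..ereal (- t). g z)"
    using x LBINT_eq_indicator[of 0 x "\<lambda>z. g (- z - t)"] LBINT_eq_indicator[of "-x-t" "-t" g] by simp
qed

text \<open>Profiles of the solutions that are constructed explicitly. They are built from indicator
  functions, so a bound can be imposed; it makes the primitive Lipschitz and lets L1 estimates
  control \<open>L2_norm\<close>.\<close>

locale periodic_profile =
  fixes g :: "real \<Rightarrow> real" and B :: real
  assumes g_measurable[measurable]: "g \<in> borel_measurable borel"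
    and g_bounded: "\<bar>g x\<bar> \<le> B" and g_periodic: "g (x + 2) = g x"
begin

abbreviation G :: "real \<Rightarrow> real" where "G \<equiv> primitive g"

lemma B_nonneg: "0 \<le> B"
  using g_bounded[of 0] by linarith

lemma G_diff: "G b - G a = (LBINT z=ereal a..ereal b. g z)"
  by (rule primitive_diff[OF g_measurable g_bounded])

lemma G_lipschitz: "\<bar>G b - G a\<bar> \<le> B * \<bar>b - a\<bar>"
  by (rule indefinite_integral_lipschitz[OF g_measurable g_bounded G_diff])

lemma G_measurable[measurable]: "G \<in> borel_measurable borel"
  by (rule lipschitz_borel_measurable[OF G_lipschitz B_nonneg])

text \<open>Shifting the window of integration by a period does not change the integral of
  \<open>g\<close>. Boundary values at \<open>x = 1\<close> involve \<open>G (1 - t)\<close> and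
  \<open>G (- 1 - t)\<close>, whose difference is thereby the same for all times.\<close>

lemma G_period: "G (y + 2) - G y = G 1 - G (-1)"
proof -
  have *: "G (y + 2) - G y = G 2 - G 0" if "0 \<le> y" for y
  proof -
    have "G (y + 2) - G 2 = (LBINT z=ereal 0..ereal y. g (z + 2))"
      using LBINT_shift(1)[OF that, of g "-2"] by (simp add: G_diff)
    also have "\<dots> = G y - G 0" by (simp add: g_periodic G_diff)
    finally show ?thesis by simp
  qed
  have **: "G (y + 2) - G y = G 2 - G 0" if "y \<le> 0" for y
  proof -
    show ?thesis
    proof -
      have "G 2 - G (y + 2) = (LBINT z=ereal 0..ereal (-y). g (z - (- (y + 2))))"
        using LBINT_shift(1)[of "-y" g "-(y+2)"] that by (simp add: G_diff add.commute)
      also have "\<dots> = (LBINT z=ereal 0..ereal (-y). g (z - (- y)))"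
      proof -
        have "g (z - (- (y + 2))) = g (z - (- y))" for z
          using g_periodic[of "z + y"] by (simp add: algebra_simps)
        then show ?thesis by simp
      qed
      also have "\<dots> = G 0 - G y"
        using LBINT_shift(1)[of "-y" g "-y"] that by (simp add: G_diff)
      finally show ?thesis by simp
    qed
  qed
  have "G 1 - G (-1) = G 2 - G 0" using **[of "-1"] by simp
  then show ?thesis using *[of y] **[of y] by (cases "0 \<le> y") auto
qed

lemma travelling_wave_increment:
  assumes x: "0 \<le> x"
  shows "a * G (x - t) + b * G (- x - t) - (a * G (- t) + b * G (- t))
    = (LBINT z=ereal 0..ereal x. a * g (z - t) - b * g (- z - t))"
proof -
  have "(LBINT z=ereal 0..ereal x. a * g (z - t) - b * g (- z - t))
      = (LBINT z=ereal 0..ereal x. a * g (z - t)) - (LBINT z=ereal 0..ereal x. b * g (- z - t))"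
  proof (intro interval_lebesgue_integral_diff)
    show "interval_lebesgue_integrable lborel (ereal 0) (ereal x) (\<lambda>z. a * g (z - t))"
      "interval_lebesgue_integrable lborel (ereal 0) (ereal x) (\<lambda>z. b * g (- z - t))"
      by (intro interval_lebesgue_integrable_mult_right interval_lebesgue_integrable_bounded[where B = B] g_bounded; measurable)+
  qed
  also have "(LBINT z=ereal 0..ereal x. a * g (z - t)) = a * (G (x - t) - G (- t))"
    using LBINT_shift(1)[OF x, of g t] by (simp add: G_diff)
  also have "(LBINT z=ereal 0..ereal x. b * g (- z - t)) = b * (G (- t) - G (- x - t))"
    using LBINT_shift(2)[OF x, of g t] by (simp add: G_diff)
  finally show ?thesis by (simp add: algebra_simps)
qed

lemma sum_shift_bounded: "\<bar>a * g y - b * g z\<bar> \<le> (\<bar>a\<bar> + \<bar>b\<bar>) * B"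
proof -
  have "\<bar>a * g y\<bar> \<le> \<bar>a\<bar> * B" "\<bar>b * g z\<bar> \<le> \<bar>b\<bar> * B"
    unfolding abs_mult by (intro mult_left_mono g_bounded abs_ge_zero)+
  then show ?thesis by (simp add: distrib_right)
qed

lemma travelling_wave_weak_deriv:
  "has_weak_deriv (\<lambda>x. c + a * G (x - t) + b * G (- x - t)) (\<lambda>x. a * g (x - t) - b * g (- x - t))"
proof (rule primitive_has_weak_deriv[where B = "(\<bar>a\<bar> + \<bar>b\<bar>) * B"])
  show "(\<lambda>x. a * g (x - t) - b * g (- x - t)) \<in> borel_measurable borel" by measurable
  show "\<bar>a * g (x - t) - b * g (- x - t)\<bar> \<le> (\<bar>a\<bar> + \<bar>b\<bar>) * B" for x by (rule sum_shift_bounded)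
  show "c + a * G (x - t) + b * G (- x - t)
      = (c + a * G (- t) + b * G (- t)) + (LBINT z=0..x. a * g (z - t) - b * g (- z - t))" if "x \<in> I01" for x
    using travelling_wave_increment[of x a t b] that by (simp add: zero_ereal_def)
  show "(\<lambda>x. c + a * G (x - t) + b * G (- x - t)) \<in> borel_measurable LI"
    by (rule borel_imp_LI) measurable
qed

text \<open>The two hypotheses express vanishing at \<open>x = 0\<close> and at
  \<open>x = 1\<close>. Two times and four coefficients are allowed so that the lemma covers both
  the displacement at one time and the flux between two times.\<close>

lemma two_travelling_waves_in_H10:
  assumes 0: "a * G (- t) + b * G (- t) + a' * G (- s) + b' * G (- s) = 0"
    and 1: "a * G (1 - t) + b * G (- 1 - t) + a' * G (1 - s) + b' * G (- 1 - s) = 0"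
  shows "(\<lambda>x. a * G (x - t) + b * G (- x - t) + a' * G (x - s) + b' * G (- x - s)) \<in> H10"
proof (rule primitive_in_H10[where B = "(\<bar>a\<bar> + \<bar>b\<bar>) * B + (\<bar>a'\<bar> + \<bar>b'\<bar>) * B" and
    p = "\<lambda>x. (a * g (x - t) - b * g (- x - t)) + (a' * g (x - s) - b' * g (- x - s))"])
  show "\<bar>(a * g (x - t) - b * g (- x - t)) + (a' * g (x - s) - b' * g (- x - s))\<bar> \<le> (\<bar>a\<bar> + \<bar>b\<bar>) * B + (\<bar>a'\<bar> + \<bar>b'\<bar>) * B" for x
    by (intro order_trans[OF abs_triangle_ineq] add_mono sum_shift_bounded)
  have *: "a * G (x - t) + b * G (- x - t) + a' * G (x - s) + b' * G (- x - s)
      = (LBINT z=ereal 0..ereal x. (a * g (z - t) - b * g (- z - t)) + (a' * g (z - s) - b' * g (- z - s)))" if x: "0 \<le> x" for x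
  proof -
    have "(LBINT z=ereal 0..ereal x. (a * g (z - t) - b * g (- z - t)) + (a' * g (z - s) - b' * g (- z - s)))
        = (LBINT z=ereal 0..ereal x. a * g (z - t) - b * g (- z - t)) + (LBINT z=ereal 0..ereal x. a' * g (z - s) - b' * g (- z - s))"
      by (intro interval_lebesgue_integral_add; rule interval_lebesgue_integrable_bounded[OF _ sum_shift_bounded]; measurable)
    then show ?thesis
      using travelling_wave_increment[OF x, of a t b] travelling_wave_increment[OF x, of a' s b'] 0 by simp
  qed
  show "a * G (x - t) + b * G (- x - t) + a' * G (x - s) + b' * G (- x - s)
      = (LBINT z=0..x. (a * g (z - t) - b * g (- z - t)) + (a' * g (z - s) - b' * g (- z - s)))" if "x \<in> I01" for x
    using *[of x] that by (simp add: zero_ereal_def)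
  show "(LBINT z=0..1. (a * g (z - t) - b * g (- z - t)) + (a' * g (z - s) - b' * g (- z - s))) = 0"
    using *[of 1] 1 by (simp add: zero_ereal_def one_ereal_def)
  show "(\<lambda>x. a * G (x - t) + b * G (- x - t) + a' * G (x - s) + b' * G (- x - s)) \<in> borel_measurable LI"
    by (rule borel_imp_LI) measurable
qed measurable

lemma shift_in_L2: "(\<lambda>x. g (c * x - t)) \<in> L2"
  by (rule L2_bounded[OF borel_imp_LI g_bounded]) measurable

lemma shift_tendsto:
  assumes "\<bar>\<sigma>\<bar> = 1"
  shows "((\<lambda>s. L2_norm (\<lambda>x. g (\<sigma> * x - s) - g (\<sigma> * x - t))) \<longlongrightarrow> 0) (at t)"
  by (rule shift_L2_continuous[OF g_measurable g_bounded assms])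

lemma quotient_tendsto:
  assumes "\<bar>\<sigma>\<bar> = 1"
  shows "((\<lambda>s. L2_norm (\<lambda>x. (G (\<sigma> * x - s) - G (\<sigma> * x - t)) / (s - t) + g (\<sigma> * x - t))) \<longlongrightarrow> 0) (at t)"
  by (rule shift_difference_quotient[OF g_measurable g_bounded assms G_diff])

lemma quotient_in_L2: "(\<lambda>x. (G (\<sigma> * x - s) - G (\<sigma> * x - t)) / (s - t) + g (\<sigma> * x - t)) \<in> L2"
proof (rule L2_bounded[where B = "B * \<bar>s - t\<bar> / \<bar>s - t\<bar> + B"])
  show "(\<lambda>x. (G (\<sigma> * x - s) - G (\<sigma> * x - t)) / (s - t) + g (\<sigma> * x - t)) \<in> borel_measurable LI"
    by (rule borel_imp_LI) measurable
  fix x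
  have "\<bar>(G (\<sigma> * x - s) - G (\<sigma> * x - t)) / (s - t)\<bar> \<le> B * \<bar>s - t\<bar> / \<bar>s - t\<bar>"
    unfolding abs_divide using G_lipschitz[of "\<sigma> * x - s" "\<sigma> * x - t"]
    by (intro divide_right_mono) (auto simp: abs_minus_commute)
  then show "\<bar>(G (\<sigma> * x - s) - G (\<sigma> * x - t)) / (s - t) + g (\<sigma> * x - t)\<bar> \<le> B * \<bar>s - t\<bar> / \<bar>s - t\<bar> + B"
    using g_bounded[of "\<sigma> * x - t"] by linarith
qed

lemma combination_tendsto_0:
  fixes p q :: "real \<Rightarrow> real \<Rightarrow> real"
  assumes "((\<lambda>s. L2_norm (p s)) \<longlongrightarrow> 0) F" "((\<lambda>s. L2_norm (q s)) \<longlongrightarrow> 0) F"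
    and "\<And>s. p s \<in> L2" "\<And>s. q s \<in> L2"
  shows "((\<lambda>s. L2_norm (\<lambda>x. a * p s x + b * q s x)) \<longlongrightarrow> 0) F"
proof -
  have "((\<lambda>s. \<bar>a\<bar> * L2_norm (p s) + \<bar>b\<bar> * L2_norm (q s)) \<longlongrightarrow> \<bar>a\<bar> * 0 + \<bar>b\<bar> * 0) F"
    by (intro tendsto_intros assms)
  then have l: "((\<lambda>s. \<bar>a\<bar> * L2_norm (p s) + \<bar>b\<bar> * L2_norm (q s)) \<longlongrightarrow> 0) F" by simp
  have "L2_norm (\<lambda>x. a * p s x + b * q s x) \<le> \<bar>a\<bar> * L2_norm (p s) + \<bar>b\<bar> * L2_norm (q s)" for s
    using L2_norm_triangle[OF L2_scale[OF assms(3)] L2_scale[OF assms(4)], of a s b s] by (simp add: L2_norm_scale)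
  then show ?thesis
    by (intro tendsto_sandwich[OF _ _ tendsto_const l]) (auto intro!: always_eventually L2_norm_nonneg)
qed

text \<open>
  Dirichlet conditions correspond to \<open>\<kappa> = - 1\<close> and Neumann conditions to \<open>\<kappa> = 1\<close>. The increment
  \<open>v s - v t\<close> is the weak derivative of the time integral of \<open>u\<^sub>x\<close>, which is again a
  combination of translates of \<open>G\<close>; this turns the variational equation into an integration by parts.
\<close>

definition wave_u :: "real \<Rightarrow> real \<Rightarrow> real \<Rightarrow> real" where
  "wave_u \<kappa> t x = - \<kappa> * G (x - t) - G (- x - t)"

definition wave_v :: "real \<Rightarrow> real \<Rightarrow> real \<Rightarrow> real" where
  "wave_v \<kappa> t x = g (- x - t) + \<kappa> * g (x - t)"

definition wave_ux :: "real \<Rightarrow> real \<Rightarrow> real \<Rightarrow> real" where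
  "wave_ux \<kappa> t x = g (- x - t) - \<kappa> * g (x - t)"

definition wave_flux :: "real \<Rightarrow> real \<Rightarrow> real \<Rightarrow> real \<Rightarrow> real" where
  "wave_flux \<kappa> s t x = \<kappa> * (G (x - s) - G (x - t)) - (G (- x - s) - G (- x - t))"

lemma wave_u_weak_deriv: "has_weak_deriv (wave_u \<kappa> t) (wave_ux \<kappa> t)"
  using travelling_wave_weak_deriv[of 0 "-\<kappa>" t "-1"]
  by (simp add: wave_u_def[abs_def] wave_ux_def[abs_def])

lemma wave_v_L2: "wave_v \<kappa> t \<in> L2"
  unfolding wave_v_def[abs_def]
  using L2_add[OF shift_in_L2[of "-1" t] L2_scale[OF shift_in_L2[of 1 t], of \<kappa>]] by simp

lemma wave_flux_weak_deriv: "has_weak_deriv (wave_flux \<kappa> s t) (\<lambda>x. wave_v \<kappa> s x - wave_v \<kappa> t x)"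
  using has_weak_deriv_diff[OF travelling_wave_weak_deriv[of 0 \<kappa> s "-1"] travelling_wave_weak_deriv[of 0 \<kappa> t "-1"]]
  by (simp add: wave_flux_def[abs_def] wave_v_def algebra_simps)

text \<open>The Neumann condition integrated in time: at \<open>x = 0\<close> the two brackets
  cancel for \<kappa> = 1, and at \<open>x = 1\<close> they cancel by
  \<open>G_period\<close>.\<close>

lemma wave_flux_H10:
  assumes "\<kappa> = 1" shows "wave_flux \<kappa> s t \<in> H10"
proof -
  have "G (- 1 - s) - G (1 - s) = G (-1 - t) - G (1 - t)"
    using G_period[of "-1-s"] G_period[of "-1-t"] by simp
  then have "(\<lambda>x. 1 * G (x - s) + (-1) * G (- x - s) + (-1) * G (x - t) + 1 * G (- x - t)) \<in> H10"
    by (intro two_travelling_waves_in_H10) auto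
  then show ?thesis using assms by (simp add: wave_flux_def[abs_def] algebra_simps)
qed

text \<open>For \<kappa> = - 1 the two waves cancel at \<open>x = 0\<close>. At \<open>x = 1\<close>
  they differ by the integral of \<open>g\<close> over a period, so the Dirichlet condition there is
  the mean zero condition \<open>G 1 = G (-1)\<close>.\<close>

lemma wave_u_H10:
  assumes "\<kappa> = -1" "G 1 = G (-1)" shows "wave_u \<kappa> t \<in> H10"
proof -
  have "G (1 - t) = G (-1 - t)"
    using G_period[of "-1-t"] assms by simp
  then have "(\<lambda>x. 1 * G (x - t) + (-1) * G (- x - t) + 0 * G (x - t) + 0 * G (- x - t)) \<in> H10"
    by (intro two_travelling_waves_in_H10) auto
  then show ?thesis using assms by (simp add: wave_u_def[abs_def] algebra_simps)
qed

lemma wave_u_lipschitz: "\<bar>wave_u \<kappa> s x - wave_u \<kappa> t x\<bar> \<le> (\<bar>\<kappa>\<bar> + 1) * B * \<bar>s - t\<bar>"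
proof -
  have "\<bar>wave_u \<kappa> s x - wave_u \<kappa> t x\<bar> \<le> \<bar>\<kappa> * (G (x - t) - G (x - s))\<bar> + \<bar>G (- x - t) - G (- x - s)\<bar>"
    unfolding wave_u_def by (simp add: algebra_simps)
  also have "\<dots> \<le> \<bar>\<kappa>\<bar> * (B * \<bar>s - t\<bar>) + B * \<bar>s - t\<bar>"
    unfolding abs_mult using G_lipschitz[of "x - t" "x - s"] G_lipschitz[of "- x - t" "- x - s"]
    by (intro add_mono mult_left_mono) auto
  finally show ?thesis by (simp add: algebra_simps)
qed

lemma dalembert_weak_solution:
  assumes V: "(V = H10 \<and> \<kappa> = -1 \<and> G 1 = G (-1)) \<or> (V = H1 \<and> \<kappa> = 1)"
  shows "weak_wave_solution V T (wave_u \<kappa> 0) (wave_v \<kappa> 0) (wave_u \<kappa>) (wave_v \<kappa>)"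
proof -
  have uV: "wave_u \<kappa> t \<in> V" for t
    using V wave_u_H10 has_weak_deriv_imp_H1[OF wave_u_weak_deriv] by auto
  have shift: "((\<lambda>s. L2_norm (\<lambda>x. a * (g (- x - s) - g (- x - t)) + b * (g (x - s) - g (x - t)))) \<longlongrightarrow> 0) (at t)" for a b t
    using combination_tendsto_0[OF shift_tendsto[of "-1" t] shift_tendsto[of 1 t] L2_diff[OF shift_in_L2 shift_in_L2] L2_diff[OF shift_in_L2 shift_in_L2], of a b] by simp
  have quot: "((\<lambda>s. L2_norm (\<lambda>x. a * ((G (- x - s) - G (- x - t)) / (s - t) + g (- x - t)) + b * ((G (x - s) - G (x - t)) / (s - t) + g (x - t)))) \<longlongrightarrow> 0) (at t)" for a b t
    using combination_tendsto_0[OF quotient_tendsto[of "-1" t] quotient_tendsto[of 1 t] quotient_in_L2 quotient_in_L2, of a b] by simp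
  have 1: "continuous_curve T V H1_norm (wave_u \<kappa>)"
    unfolding continuous_curve_def
  proof (intro conjI ballI uV)
    fix t
    let ?D = "\<lambda>s. L2_norm (\<lambda>x. 1 * (g (- x - s) - g (- x - t)) + (-\<kappa>) * (g (x - s) - g (x - t)))"
    have "((\<lambda>s. (\<bar>\<kappa>\<bar> + 1) * B * \<bar>s - t\<bar> + ?D s) \<longlongrightarrow> (\<bar>\<kappa>\<bar> + 1) * B * \<bar>t - t\<bar> + 0) (at t)"
      by (intro tendsto_intros shift)
    then have l: "((\<lambda>s. (\<bar>\<kappa>\<bar> + 1) * B * \<bar>s - t\<bar> + ?D s) \<longlongrightarrow> 0) (at t)" by simp
    have le: "H1_norm (\<lambda>x. wave_u \<kappa> s x - wave_u \<kappa> t x) \<le> (\<bar>\<kappa>\<bar> + 1) * B * \<bar>s - t\<bar> + ?D s" for s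
    proof -
      have wd: "has_weak_deriv (\<lambda>x. wave_u \<kappa> s x - wave_u \<kappa> t x) (\<lambda>x. wave_ux \<kappa> s x - wave_ux \<kappa> t x)"
        by (intro has_weak_deriv_diff wave_u_weak_deriv)
      have "L2_norm (\<lambda>x. wave_u \<kappa> s x - wave_u \<kappa> t x) \<le> (\<bar>\<kappa>\<bar> + 1) * B * \<bar>s - t\<bar>"
        using has_weak_deriv_L2(1)[OF wd] B_nonneg
        by (intro L2_norm_bounded wave_u_lipschitz L2_measurable) auto
      moreover have "(\<lambda>x. wave_ux \<kappa> s x - wave_ux \<kappa> t x) = (\<lambda>x. 1 * (g (- x - s) - g (- x - t)) + (-\<kappa>) * (g (x - s) - g (x - t)))"
        by (auto simp: wave_ux_def algebra_simps)
      ultimately show ?thesis using H1_norm_le[OF wd] by simp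
    qed
    have "((\<lambda>s. H1_norm (\<lambda>x. wave_u \<kappa> s x - wave_u \<kappa> t x)) \<longlongrightarrow> 0) (at t)"
    proof (rule tendsto_sandwich[OF _ _ tendsto_const l])
      show "\<forall>\<^sub>F s in at t. 0 \<le> H1_norm (\<lambda>x. wave_u \<kappa> s x - wave_u \<kappa> t x)"
        by (simp add: H1_norm_def)
      show "\<forall>\<^sub>F s in at t. H1_norm (\<lambda>x. wave_u \<kappa> s x - wave_u \<kappa> t x) \<le> (\<bar>\<kappa>\<bar> + 1) * B * \<bar>s - t\<bar> + ?D s"
        by (intro always_eventually allI le)
    qed
    then show "((\<lambda>s. H1_norm (\<lambda>x. wave_u \<kappa> s x - wave_u \<kappa> t x)) \<longlongrightarrow> 0) (at t within {0..T})"
      by (rule tendsto_within_subset) simp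
  qed
  have 2: "continuous_curve T L2 L2_norm (wave_v \<kappa>)"
    unfolding continuous_curve_def
  proof (intro conjI ballI wave_v_L2)
    fix t
    have "((\<lambda>s. L2_norm (\<lambda>x. wave_v \<kappa> s x - wave_v \<kappa> t x)) \<longlongrightarrow> 0) (at t)"
      using shift[of 1 t \<kappa>] by (simp add: wave_v_def algebra_simps)
    then show "((\<lambda>s. L2_norm (\<lambda>x. wave_v \<kappa> s x - wave_v \<kappa> t x)) \<longlongrightarrow> 0) (at t within {0..T})"
      by (rule tendsto_within_subset) simp
  qed
  have 3: "has_L2_time_deriv T (wave_u \<kappa>) (wave_v \<kappa>)"
    unfolding has_L2_time_deriv_def
  proof (intro ballI)
    fix t
    have "(wave_u \<kappa> s x - wave_u \<kappa> t x) / (s - t) - wave_v \<kappa> t x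
      = (-1) * ((G (- x - s) - G (- x - t)) / (s - t) + g (- x - t)) + (-\<kappa>) * ((G (x - s) - G (x - t)) / (s - t) + g (x - t))" for s x
      by (simp add: wave_u_def wave_v_def diff_divide_distrib add_divide_distrib algebra_simps)
    then have "((\<lambda>s. L2_norm (\<lambda>x. (wave_u \<kappa> s x - wave_u \<kappa> t x) / (s - t) - wave_v \<kappa> t x)) \<longlongrightarrow> 0) (at t)"
      using quot[of "-1" t "-\<kappa>"] by simp
    then show "((\<lambda>s. L2_norm (\<lambda>x. (wave_u \<kappa> s x - wave_u \<kappa> t x) / (s - t) - wave_v \<kappa> t x)) \<longlongrightarrow> 0) (at t within {0..T})"
      by (rule tendsto_within_subset) simp
  qed
  have 4: "((\<lambda>s. L2_inner (wave_v \<kappa> s) w) has_real_derivative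
      - L2_inner (weak_deriv (wave_u \<kappa> t)) (weak_deriv w)) (at t within {0..T})" if w: "w \<in> V" for w t
  proof -
    have wH1: "w \<in> H1" using w V H10_imp_H1 by auto
    note wd = has_weak_deriv_weak_deriv[OF wH1]
    note L2 = H1_imp_L2[OF wH1]
    let ?w' = "weak_deriv w"
    \<comment> \<open>Some factor vanishes at the boundary in each case: the flux for \<kappa> = 1,
      where \<open>w\<close> is an arbitrary member of \<open>H1\<close>, and \<open>w\<close>
      itself in the Dirichlet case.\<close>
    have ibp: "L2_inner (\<lambda>x. wave_v \<kappa> s x - wave_v \<kappa> t x) w = - L2_inner (wave_flux \<kappa> s t) ?w'" for s
    proof (cases "\<kappa> = 1")
      case True
      show ?thesis
        using H1_H10_integration_by_parts[OF wd wave_flux_H10[OF True] wave_flux_weak_deriv, of s t]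
        by (simp add: L2_inner_commute[of w] L2_inner_commute[of "?w'"])
    next
      case False
      then have "w \<in> H10" using V w by auto
      then show ?thesis using H1_H10_integration_by_parts[OF wave_flux_weak_deriv _ wd] by simp
    qed
    let ?E = "\<lambda>s x. (-1) * ((G (- x - s) - G (- x - t)) / (s - t) + g (- x - t)) + \<kappa> * ((G (x - s) - G (x - t)) / (s - t) + g (x - t))"
    have EL2: "?E s \<in> L2" for s
      using L2_add[OF L2_scale[OF quotient_in_L2[of "-1" s t], of "-1"] L2_scale[OF quotient_in_L2[of 1 s t], of \<kappa>]] by simp
    have uxL2: "wave_ux \<kappa> t \<in> L2" using has_weak_deriv_L2[OF wave_u_weak_deriv] by blast
    have eq: "(L2_inner (wave_v \<kappa> s) w - L2_inner (wave_v \<kappa> t) w) / (s - t) - (- L2_inner (wave_ux \<kappa> t) ?w') = - L2_inner (?E s) ?w'"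
      if "s \<noteq> t" for s
    proof -
      have E: "?E s x = (1 / (s - t)) * wave_flux \<kappa> s t x - wave_ux \<kappa> t x" for x
        by (simp add: wave_flux_def wave_ux_def diff_divide_distrib add_divide_distrib algebra_simps)
      have "L2_inner (?E s) ?w' = (1 / (s - t)) * L2_inner (wave_flux \<kappa> s t) ?w' - L2_inner (wave_ux \<kappa> t) ?w'"
        unfolding E using has_weak_deriv_L2(1)[OF wave_flux_weak_deriv] uxL2 L2(2)
        by (subst L2_inner_diff_left) (auto intro: L2_scale simp only: L2_inner_scale_left)
      moreover have "L2_inner (wave_v \<kappa> s) w - L2_inner (wave_v \<kappa> t) w = - L2_inner (wave_flux \<kappa> s t) ?w'"
        using ibp[of s] L2_inner_diff_left[OF wave_v_L2 wave_v_L2 L2(1)] by simp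
      ultimately show ?thesis by simp
    qed
    have "((\<lambda>s. (L2_inner (wave_v \<kappa> s) w - L2_inner (wave_v \<kappa> t) w) / (s - t) - (- L2_inner (wave_ux \<kappa> t) ?w')) \<longlongrightarrow> 0) (at t)"
    proof (rule Lim_null_comparison)
      show "\<forall>\<^sub>F s in at t. norm ((L2_inner (wave_v \<kappa> s) w - L2_inner (wave_v \<kappa> t) w) / (s - t) - (- L2_inner (wave_ux \<kappa> t) ?w'))
          \<le> L2_norm (?E s) * L2_norm ?w'"
        unfolding eventually_at_filter
      proof (intro always_eventually allI impI)
        fix s assume "s \<noteq> t"
        show "norm ((L2_inner (wave_v \<kappa> s) w - L2_inner (wave_v \<kappa> t) w) / (s - t) - (- L2_inner (wave_ux \<kappa> t) ?w'))
            \<le> L2_norm (?E s) * L2_norm ?w'"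
          unfolding eq[OF \<open>s \<noteq> t\<close>] real_norm_def abs_minus_cancel by (rule L2_Cauchy_Schwarz[OF EL2 L2(2)])
      qed
      show "((\<lambda>s. L2_norm (?E s) * L2_norm ?w') \<longlongrightarrow> 0) (at t)"
        using tendsto_mult_right[OF quot[of "-1" t \<kappa>], of "L2_norm ?w'"] by simp
    qed
    then have "((\<lambda>s. (L2_inner (wave_v \<kappa> s) w - L2_inner (wave_v \<kappa> t) w) / (s - t)) \<longlongrightarrow> - L2_inner (wave_ux \<kappa> t) ?w') (at t)"
      using LIM_zero_iff by blast
    then have "((\<lambda>s. L2_inner (wave_v \<kappa> s) w) has_real_derivative - L2_inner (wave_ux \<kappa> t) ?w') (at t)"
      by (simp add: has_field_derivative_iff)
    moreover have "L2_inner (weak_deriv (wave_u \<kappa> t)) ?w' = L2_inner (wave_ux \<kappa> t) ?w'"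
      by (rule has_weak_deriv_inner[OF wave_u_weak_deriv L2(2)])
    ultimately show ?thesis by (simp add: has_field_derivative_at_within)
  qed
  show ?thesis unfolding weak_wave_solution_def using 1 2 3 4 by auto
qed

end

section \<open>Integrals over the circle as pairs of integrals over the interval\<close>

lemma nn_integral_LI_eq:
  assumes [measurable]: "f \<in> borel_measurable borel"
  shows "(\<integral>\<^sup>+x. f x \<partial>LI) = (\<integral>\<^sup>+x. indicator I01 x * f x \<partial>lborel)"
proof -
  have "(\<integral>\<^sup>+x. f x \<partial>LI) = (\<integral>\<^sup>+x. f x * indicator I01 x \<partial>lebesgue)"
    by (rule nn_integral_restrict_space) simp
  also have "\<dots> = (\<integral>\<^sup>+x. f x * indicator I01 x \<partial>lborel)"
    by (rule nn_integral_completion)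
  finally show ?thesis by (simp add: mult.commute)
qed

lemma AE_indicator_Ioo_Ico:
  "AE y in lborel. indicator {a<..<b} y * h y = indicator {a..<b} y * h y" for h :: "real \<Rightarrow> ennreal"
  using AE_lborel_singleton[of a] by eventually_elim (auto simp: indicator_def)

text \<open>The maps \<open>x - t\<close> and \<open>- x - t\<close> carry the unit interval onto
  two adjacent intervals that together form one period. Read backwards along characteristics, the
  points at time \<open>t\<close> fill the circle of starting points once, which is why the
  right-hand side does not depend on \<open>t\<close>.\<close>

lemma nn_integral_unfold:
  fixes f :: "real \<Rightarrow> ennreal"
  assumes f[measurable]: "f \<in> borel_measurable borel" and per: "\<And>y. f (y + 2) = f y"
  shows "(\<integral>\<^sup>+x. f (x - t) \<partial>LI) + (\<integral>\<^sup>+x. f (- x - t) \<partial>LI) = (\<integral>\<^sup>+y. indicator {-1..<1} y * f y \<partial>lborel)"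
proof -
  have "(\<integral>\<^sup>+x. f (x - t) \<partial>LI) = (\<integral>\<^sup>+x. indicator I01 x * f (x - t) \<partial>lborel)"
    by (rule nn_integral_LI_eq) measurable
  also have "\<dots> = (\<integral>\<^sup>+x. indicator I01 (t + 1 * x) * f (t + 1 * x - t) \<partial>lborel)"
    by (subst nn_integral_real_affine[where c = 1 and t = t]) simp_all
  also have "\<dots> = (\<integral>\<^sup>+x. indicator {-t<..<1-t} x * f x \<partial>lborel)"
    by (intro nn_integral_cong) (auto simp: indicator_def)
  also have "\<dots> = (\<integral>\<^sup>+x. indicator {-t..<1-t} x * f x \<partial>lborel)"
    by (rule nn_integral_cong_AE[OF AE_indicator_Ioo_Ico])
  finally have 1: "(\<integral>\<^sup>+x. f (x - t) \<partial>LI) = (\<integral>\<^sup>+x. indicator {-t..<1-t} x * f x \<partial>lborel)" .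
  have "(\<integral>\<^sup>+x. f (- x - t) \<partial>LI) = (\<integral>\<^sup>+x. indicator I01 x * f (- x - t) \<partial>lborel)"
    by (rule nn_integral_LI_eq) measurable
  also have "\<dots> = (\<integral>\<^sup>+x. indicator I01 (-t + (-1) * x) * f (- (- t + (-1) * x) - t) \<partial>lborel)"
    by (subst nn_integral_real_affine[where c = "-1" and t = "-t"]) simp_all
  also have "\<dots> = (\<integral>\<^sup>+x. indicator {-1-t<..<-t} x * f x \<partial>lborel)"
    by (intro nn_integral_cong) (auto simp: indicator_def)
  also have "\<dots> = (\<integral>\<^sup>+x. indicator {-1-t..<-t} x * f x \<partial>lborel)"
    by (rule nn_integral_cong_AE[OF AE_indicator_Ioo_Ico])
  finally have 2: "(\<integral>\<^sup>+x. f (- x - t) \<partial>LI) = (\<integral>\<^sup>+x. indicator {-1-t..<-t} x * f x \<partial>lborel)" .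
  have "(\<integral>\<^sup>+x. f (x - t) \<partial>LI) + (\<integral>\<^sup>+x. f (- x - t) \<partial>LI)
      = (\<integral>\<^sup>+x. indicator {-t..<1-t} x * f x + indicator {-1-t..<-t} x * f x \<partial>lborel)"
    unfolding 1 2 by (rule nn_integral_add[symmetric]) measurable
  also have "\<dots> = (\<integral>\<^sup>+x. indicator {-1-t..<(-1-t)+2} x * f x \<partial>lborel)"
    by (intro nn_integral_cong) (auto simp: indicator_def)
  also have "\<dots> = (\<integral>\<^sup>+x. indicator {-1..<-1+2} x * f x \<partial>lborel)"
    by (rule nn_integral_periodic[OF f per])
  finally show ?thesis by simp
qed

lemma integral_unfold:
  fixes f :: "real \<Rightarrow> real"
  assumes f[measurable]: "f \<in> borel_measurable borel" and per: "\<And>y. f (y + 2) = f y"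
    and i: "integrable lborel (\<lambda>y. indicator {-1..<1} y * f y)"
  shows "integrable LI (\<lambda>x. f (x - t))" "integrable LI (\<lambda>x. f (- x - t))"
    "(LINT x|LI. f (x - t)) + (LINT x|LI. f (- x - t)) = (\<integral>y. indicator {-1..<1} y * f y \<partial>lborel)"
proof -
  have ind: "ennreal (indicator {-1..<1} y * f y) = indicator {-1..<1} y * ennreal (f y)"
    "ennreal (- (indicator {-1..<1} y * f y)) = indicator {-1..<1} y * ennreal (- f y)"
    "ennreal (norm (indicator {-1..<1} y * f y)) = indicator {-1..<1} y * ennreal \<bar>f y\<bar>" for y
    by (auto simp: indicator_def)
  have fin: "(\<integral>\<^sup>+x. ennreal \<bar>f (x - t)\<bar> \<partial>LI) + (\<integral>\<^sup>+x. ennreal \<bar>f (- x - t)\<bar> \<partial>LI) < \<infinity>"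
    using i by (subst nn_integral_unfold) (simp_all add: per integrable_iff_bounded ind del: real_norm_def)
  have m: "(\<lambda>x. f (x - t)) \<in> borel_measurable LI" "(\<lambda>x. f (- x - t)) \<in> borel_measurable LI"
    by (rule borel_imp_LI, measurable)+
  show i1: "integrable LI (\<lambda>x. f (x - t))" and i2: "integrable LI (\<lambda>x. f (- x - t))"
    using fin m by (auto simp: integrable_iff_bounded less_top[symmetric])
  have bnd: "(\<integral>\<^sup>+x. ennreal (c * h x) \<partial>M) < top" if "integrable M h" "\<bar>c\<bar> = 1" for h :: "real \<Rightarrow> real" and M c
  proof -
    have "(\<integral>\<^sup>+x. ennreal (c * h x) \<partial>M) \<le> (\<integral>\<^sup>+x. ennreal (norm (h x)) \<partial>M)"
    proof (intro nn_integral_mono ennreal_leI)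
      fix x have "c * h x \<le> \<bar>c\<bar> * \<bar>h x\<bar>" unfolding abs_mult[symmetric] by simp
      then show "c * h x \<le> norm (h x)" using that by simp
    qed
    then show ?thesis using that(1) by (auto simp: integrable_iff_bounded)
  qed
  have fin: "(\<integral>\<^sup>+x. ennreal (f (x - t)) \<partial>LI) < top" "(\<integral>\<^sup>+x. ennreal (f (- x - t)) \<partial>LI) < top"
    "(\<integral>\<^sup>+x. ennreal (- f (x - t)) \<partial>LI) < top" "(\<integral>\<^sup>+x. ennreal (- f (- x - t)) \<partial>LI) < top"
    using bnd[OF i1, of 1] bnd[OF i2, of 1] bnd[OF i1, of "-1"] bnd[OF i2, of "-1"] by auto
  have pos: "(\<integral>\<^sup>+x. ennreal (f (x - t)) \<partial>LI) + (\<integral>\<^sup>+x. ennreal (f (- x - t)) \<partial>LI)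
      = (\<integral>\<^sup>+y. ennreal (indicator {-1..<1} y * f y) \<partial>lborel)"
    and neg: "(\<integral>\<^sup>+x. ennreal (- f (x - t)) \<partial>LI) + (\<integral>\<^sup>+x. ennreal (- f (- x - t)) \<partial>LI)
      = (\<integral>\<^sup>+y. ennreal (- (indicator {-1..<1} y * f y)) \<partial>lborel)"
    unfolding ind by (rule nn_integral_unfold; simp add: per)+
  show "(LINT x|LI. f (x - t)) + (LINT x|LI. f (- x - t)) = (\<integral>y. indicator {-1..<1} y * f y \<partial>lborel)"
    unfolding real_lebesgue_integral_def[OF i1] real_lebesgue_integral_def[OF i2] real_lebesgue_integral_def[OF i]
      pos[symmetric] neg[symmetric]
    using fin by (simp add: enn2real_plus)
qed

subsection \<open>Fourier coefficients of weak solutions\<close>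

text \<open>The eigenmodes for the boundary condition coded by \<open>\<kappa>\<close>; those of \<open>u\<^sub>x\<close> are \<open>mode (- \<kappa>) k\<close>.\<close>

definition mode :: "real \<Rightarrow> nat \<Rightarrow> real \<Rightarrow> real" where
  "mode \<kappa> k x = (if \<kappa> = 1 then cos (real k * pi * x) else sin (real k * pi * x))"

lemma mode_minus: "\<bar>\<kappa>\<bar> = 1 \<Longrightarrow> mode \<kappa> k (- x) = \<kappa> * mode \<kappa> k x"
  by (auto simp: mode_def abs_if split: if_splits)

lemma mode_add:
  "\<bar>\<kappa>\<bar> = 1 \<Longrightarrow> mode \<kappa> k (y + t) = mode \<kappa> k y * cos (real k * pi * t) - \<kappa> * mode (- \<kappa>) k y * sin (real k * pi * t)"
  by (auto simp: mode_def abs_if distrib_left sin_add cos_add split: if_splits)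

lemma mode_periodic: "mode \<kappa> k (y + 2) = mode \<kappa> k y"
proof -
  have s: "sin (real k * pi * 2) = 0" "cos (real k * pi * 2) = 1"
    using sin_npi[of "2 * k"] cos_npi[of "2 * k"] by (simp_all add: ac_simps)
  show ?thesis by (simp add: mode_def distrib_left sin_add cos_add s)
qed

lemma mode_continuous: "continuous_on A (mode \<kappa> k)"
  unfolding mode_def[abs_def] by (cases "\<kappa> = 1") (auto intro!: continuous_intros)

lemma mode_measurable[measurable]: "mode \<kappa> k \<in> borel_measurable borel"
  by (intro borel_measurable_continuous_onI mode_continuous)

lemma mode_bounded: "\<bar>mode \<kappa> k x\<bar> \<le> 1"
  by (simp add: mode_def)

lemma mode_L2: "mode \<kappa> k \<in> L2"
  by (intro continuous_L2 mode_continuous)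

lemma mode_weak_deriv:
  "\<bar>\<kappa>\<bar> = 1 \<Longrightarrow> has_weak_deriv (mode \<kappa> k) (\<lambda>x. (- \<kappa> * (real k * pi)) * mode (- \<kappa>) k x)"
  using sin_has_weak_deriv[of k] cos_has_weak_deriv[of k]
  by (auto simp: mode_def[abs_def] abs_if split: if_splits)

lemma has_weak_deriv_AE_cong:
  assumes "has_weak_deriv f g" "AE x in LI. f x = h x" "h \<in> L2"
  shows "has_weak_deriv h g"
proof -
  have "L2_inner f w = L2_inner h w" if "w \<in> L2" for w
    using assms that L2_measurable has_weak_deriv_L2[OF assms(1)] by (intro L2_inner_cong_AE) auto
  then show ?thesis using assms test_function_L2 test_function_deriv(1) by (auto simp: has_weak_deriv_def)
qed

locale weak_solution =
  fixes V :: "(real \<Rightarrow> real) set" and \<kappa> T :: real and u0 u1 :: "real \<Rightarrow> real" and u v :: "real \<Rightarrow> real \<Rightarrow> real"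
  assumes V: "(V = H10 \<and> \<kappa> = -1) \<or> (V = H1 \<and> \<kappa> = 1)" and T: "T > 0"
    and solution: "weak_wave_solution V T u0 u1 u v"
begin

lemma kappa: "\<bar>\<kappa>\<bar> = 1" "\<kappa> * \<kappa> = 1"
  using V by auto

lemma u_in_V: "t \<in> {0..T} \<Longrightarrow> u t \<in> V"
  using solution by (auto simp: weak_wave_solution_def continuous_curve_def)

lemma u_in_H1: "t \<in> {0..T} \<Longrightarrow> u t \<in> H1"
  using u_in_V V H10_imp_H1 by blast

lemma u_in_L2: "t \<in> {0..T} \<Longrightarrow> u t \<in> L2" and ux_in_L2: "t \<in> {0..T} \<Longrightarrow> weak_deriv (u t) \<in> L2"
  using u_in_H1 H1_imp_L2 by blast+

lemma v_in_L2: "t \<in> {0..T} \<Longrightarrow> v t \<in> L2"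
  using solution by (auto simp: weak_wave_solution_def continuous_curve_def)

lemma u_inner_deriv:
  assumes t: "t \<in> {0..T}" and w: "w \<in> L2"
  shows "((\<lambda>s. L2_inner (u s) w) has_real_derivative L2_inner (v t) w) (at t within {0..T})"
  unfolding has_field_derivative_iff
proof (rule LIM_zero_cancel, rule Lim_null_comparison)
  let ?N = "\<lambda>s. L2_norm (\<lambda>x. (u s x - u t x) / (s - t) - v t x)"
  have "(?N \<longlongrightarrow> 0) (at t within {0..T})"
    using solution t by (auto simp: weak_wave_solution_def has_L2_time_deriv_def)
  from tendsto_mult_left[OF this, of "L2_norm w"]
  show "((\<lambda>s. L2_norm w * ?N s) \<longlongrightarrow> 0) (at t within {0..T})" by simp
  show "\<forall>\<^sub>F s in at t within {0..T}.
      norm ((L2_inner (u s) w - L2_inner (u t) w) / (s - t) - L2_inner (v t) w) \<le> L2_norm w * ?N s"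
    unfolding eventually_at_filter
  proof (intro always_eventually allI impI)
    fix s assume s: "s \<noteq> t" "s \<in> {0..T}"
    have d: "(\<lambda>x. (1 / (s - t)) * (u s x - u t x)) \<in> L2" 
      by (intro L2_scale L2_diff u_in_L2 s t)
    have "norm ((L2_inner (u s) w - L2_inner (u t) w) / (s - t) - L2_inner (v t) w)
        = norm (L2_inner (\<lambda>x. (1 / (s - t)) * (u s x - u t x) - v t x) w)"
      using L2_inner_diff_left[OF d v_in_L2[OF t] w] L2_inner_diff_left[OF u_in_L2[OF s(2)] u_in_L2[OF t] w]
        L2_inner_scale_left[of "1 / (s - t)" "\<lambda>x. u s x - u t x" w] by simp
    also have "\<dots> \<le> L2_norm (\<lambda>x. (1 / (s - t)) * (u s x - u t x) - v t x) * L2_norm w"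
      using L2_Cauchy_Schwarz[OF L2_diff[OF d v_in_L2[OF t]] w] by simp
    finally show "norm ((L2_inner (u s) w - L2_inner (u t) w) / (s - t) - L2_inner (v t) w) \<le> L2_norm w * ?N s"
      by (simp add: mult.commute)
  qed
qed

lemma mode_in_V: "mode \<kappa> k \<in> V"
  using V sin_in_H10[of k] has_weak_deriv_imp_H1[OF mode_weak_deriv[OF kappa(1)]] by (auto simp: mode_def[abs_def])

lemma v_coeff_deriv:
  assumes t: "t \<in> {0..T}"
  shows "((\<lambda>s. L2_inner (v s) (mode \<kappa> k)) has_real_derivative
    \<kappa> * (real k * pi) * L2_inner (weak_deriv (u t)) (mode (- \<kappa>) k)) (at t within {0..T})"
proof -
  have "((\<lambda>s. L2_inner (v s) (mode \<kappa> k)) has_real_derivative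
      - L2_inner (weak_deriv (u t)) (weak_deriv (mode \<kappa> k))) (at t within {0..T})"
    using solution t mode_in_V by (auto simp: weak_wave_solution_def)
  moreover have "L2_inner (weak_deriv (u t)) (weak_deriv (mode \<kappa> k)) = (- \<kappa> * (real k * pi)) * L2_inner (weak_deriv (u t)) (mode (- \<kappa>) k)"
    using has_weak_deriv_inner[OF mode_weak_deriv[OF kappa(1)] ux_in_L2[OF t], of k]
      L2_inner_scale_left[of "- \<kappa> * (real k * pi)" "mode (- \<kappa>) k" "weak_deriv (u t)"]
    by (simp add: L2_inner_commute[of "weak_deriv (u t)" "weak_deriv (mode \<kappa> k)"] L2_inner_commute[of "weak_deriv (u t)" "mode (- \<kappa>) k"])
  ultimately show ?thesis by simp
qed

text \<open>Integration by parts with a factor in \<open>H10\<close>: for \<kappa> = 1 the mode is a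
  sine, for \<kappa> = - 1 it is the solution that vanishes at the boundary.\<close>

lemma ux_coeff:
  assumes t: "t \<in> {0..T}"
  shows "L2_inner (weak_deriv (u t)) (mode (- \<kappa>) k) = - \<kappa> * (real k * pi) * L2_inner (u t) (mode \<kappa> k)"
proof -
  note wd = has_weak_deriv_weak_deriv[OF u_in_H1[OF t]]
  have m: "has_weak_deriv (mode (- \<kappa>) k) (\<lambda>x. (\<kappa> * (real k * pi)) * mode \<kappa> k x)"
    using mode_weak_deriv[of "-\<kappa>" k] kappa by simp
  have sc: "L2_inner (\<lambda>x. (\<kappa> * (real k * pi)) * mode \<kappa> k x) (u t) = (\<kappa> * (real k * pi)) * L2_inner (u t) (mode \<kappa> k)"
    using L2_inner_scale_left[of "\<kappa> * (real k * pi)" "mode \<kappa> k" "u t"] by (simp add: L2_inner_commute[of "u t" "mode \<kappa> k"])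
  show ?thesis
  proof (cases "\<kappa> = 1")
    case True
    have "mode (- \<kappa>) k \<in> H10" using sin_in_H10[of k] True by (simp add: mode_def[abs_def])
    from H1_H10_integration_by_parts[OF wd this m] show ?thesis
      using sc by (simp add: L2_inner_commute[of "u t" "\<lambda>x. (\<kappa> * (real k * pi)) * mode \<kappa> k x"])
  next
    case False
    then have "u t \<in> H10" using V u_in_V[OF t] by auto
    from H1_H10_integration_by_parts[OF m this wd] show ?thesis
      using sc by (simp add: L2_inner_commute[of "weak_deriv (u t)" "mode (- \<kappa>) k"])
  qed
qed

text \<open>The slope itself is only known to be continuous in time. By \<open>ux_coeff\<close> its
  coefficient is a multiple of one of \<open>u\<close>, and pairings of \<open>u\<close> with fixed
  functions are differentiable.\<close>

lemma ux_coeff_deriv: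
  assumes t: "t \<in> {0..T}"
  shows "((\<lambda>s. L2_inner (weak_deriv (u s)) (mode (- \<kappa>) k)) has_real_derivative
    - \<kappa> * (real k * pi) * L2_inner (v t) (mode \<kappa> k)) (at t within {0..T})"
proof (rule has_field_derivative_transform_within[OF DERIV_cmult[OF u_inner_deriv[OF t mode_L2]]])
  show "- \<kappa> * (real k * pi) * L2_inner (u s) (mode \<kappa> k) = L2_inner (weak_deriv (u s)) (mode (- \<kappa>) k)"
    if "s \<in> {0..T}" "dist s t < 1" for s
    using ux_coeff that by simp
qed (use t in auto)

lemma coeff_rotation:
  fixes k :: nat
  assumes t: "t \<in> {0..T}"
  defines "b \<equiv> \<lambda>t. L2_inner (v t) (mode \<kappa> k)" and "c \<equiv> \<lambda>t. L2_inner (weak_deriv (u t)) (mode (- \<kappa>) k)"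
    and "\<omega> \<equiv> real k * pi"
  shows "b t = b 0 * cos (\<omega> * t) + \<kappa> * c 0 * sin (\<omega> * t)" "c t = c 0 * cos (\<omega> * t) - \<kappa> * b 0 * sin (\<omega> * t)"
proof -
  have b': "(b has_real_derivative \<kappa> * \<omega> * c s) (at s within {0..T})" if "s \<in> {0..T}" for s
    unfolding b_def c_def \<omega>_def by (rule v_coeff_deriv[OF that])
  have c': "(c has_real_derivative - \<kappa> * \<omega> * b s) (at s within {0..T})" if "s \<in> {0..T}" for s
    unfolding b_def c_def \<omega>_def by (rule ux_coeff_deriv[OF that])
  \<comment> \<open>The pair of coefficients is rotated back by the angle \<omega> times
    \<open>s\<close>. In this moving frame it is constant, and undoing the rotation at time
    \<open>t\<close> gives both formulas.\<close>
  let ?p = "\<lambda>s. b s * cos (\<omega> * s) - \<kappa> * c s * sin (\<omega> * s)"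
  let ?q = "\<lambda>s. \<kappa> * b s * sin (\<omega> * s) + c s * cos (\<omega> * s)"
  have k: "\<kappa> * (\<kappa> * x) = x" for x using kappa by (simp add: mult.assoc[symmetric])
  have "(?p has_real_derivative 0) (at s within {0..T})" if "s \<in> {0..T}" for s
    by (rule derivative_eq_intros b'[OF that] c'[OF that] refl | simp)+ (simp add: algebra_simps k kappa)
  then have "\<exists>z. \<forall>s\<in>{0..T}. ?p s = z"
    by (intro has_field_derivative_zero_constant) auto
  then have p: "?p t = b 0" using t T by force
  have "(?q has_real_derivative 0) (at s within {0..T})" if "s \<in> {0..T}" for s
    by (rule derivative_eq_intros b'[OF that] c'[OF that] refl | simp)+ (simp add: algebra_simps k kappa)
  then have "\<exists>z. \<forall>s\<in>{0..T}. ?q s = z"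
    by (intro has_field_derivative_zero_constant) auto
  then have q: "?q t = c 0" using t T by force
  let ?C = "cos (\<omega> * t)" and ?S = "sin (\<omega> * t)"
  have cs: "?C * ?C + ?S * ?S = 1" using sin_cos_squared_add[of "\<omega> * t"] by (simp add: power2_eq_square)
  have "b 0 * ?C + \<kappa> * c 0 * ?S = b t * (?C * ?C + (\<kappa> * \<kappa>) * (?S * ?S))"
    unfolding p[symmetric] q[symmetric] by (simp add: algebra_simps)
  then show "b t = b 0 * ?C + \<kappa> * c 0 * ?S" using cs kappa by simp
  have "c 0 * ?C - \<kappa> * b 0 * ?S = c t * (?C * ?C + (\<kappa> * \<kappa>) * (?S * ?S))"
    unfolding p[symmetric] q[symmetric] by (simp add: algebra_simps)
  then show "c t = c 0 * ?C - \<kappa> * b 0 * ?S" using cs kappa by simp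
qed

text \<open>If all velocity coefficients vanish, the rotation formula at one well-chosen time forces
  the initial slope coefficient to vanish, and then the one at every time. \<open>ux_coeff\<close>
  returns to \<open>u\<close> for positive frequency.\<close>

lemma u_coeff_0_if_v_0:
  assumes v0: "\<And>t. t \<in> {0..T} \<Longrightarrow> AE x in LI. v t x = 0" and k: "k > 0" and t: "t \<in> {0..T}"
  shows "L2_inner (u t) (mode \<kappa> k) = 0"
proof -
  have b: "L2_inner (v s) (mode \<kappa> k) = 0" if s: "s \<in> {0..T}" for s
  proof -
    have "L2_inner (v s) (mode \<kappa> k) = L2_inner (\<lambda>x. 0) (mode \<kappa> k)"
      using v0[OF s] v_in_L2[OF s] L2_measurable mode_L2 L2_zero by (intro L2_inner_cong_AE) auto
    then show ?thesis by (simp add: L2_inner_def)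
  qed
  let ?\<omega> = "real k * pi"
  \<comment> \<open>The second entry is a quarter of the period of this mode, so the angle lies in
    the range where the sine is positive; the minimum keeps \<open>s\<close> inside
    \<open>[0, T]\<close>.\<close>
  define s where "s = min T (1 / (2 * real k))"
  have s: "s \<in> {0..T}" "0 < s" "s \<le> 1 / (2 * real k)" using T k by (auto simp: s_def)
  have "?\<omega> * s \<le> ?\<omega> * (1 / (2 * real k))" using s(3) by (intro mult_left_mono) auto
  also have "\<dots> = pi / 2" using k by simp
  finally have "sin (?\<omega> * s) > 0" using s(2) k pi_gt_zero by (intro sin_gt_zero) (simp, linarith)
  moreover have "\<kappa> * L2_inner (weak_deriv (u 0)) (mode (- \<kappa>) k) * sin (?\<omega> * s) = 0"
    using coeff_rotation(1)[OF s(1), of k] b[OF s(1)] b[of 0] T by simp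
  ultimately have "L2_inner (weak_deriv (u 0)) (mode (- \<kappa>) k) = 0" using kappa by auto
  then have "L2_inner (weak_deriv (u t)) (mode (- \<kappa>) k) = 0"
    using coeff_rotation(2)[OF t, of k] b[of 0] T by simp
  then show ?thesis using ux_coeff[OF t, of k] kappa k by auto
qed

text \<open>Completeness of the modes leaves nothing in the Dirichlet case and only the spatial mean
  in the Neumann case. The mean is constant in time because its derivative is the mean of the
  velocity.\<close>

lemma v_0_imp_stationary:
  assumes v0: "\<And>t. t \<in> {0..T} \<Longrightarrow> AE x in LI. v t x = 0"
  shows "\<exists>c. (\<kappa> = -1 \<longrightarrow> c = 0) \<and> (\<forall>t\<in>{0..T}. AE x in LI. u t x = c)"
proof (cases "\<kappa> = 1")
  case True
  have *: "AE x in LI. u t x = L2_inner (u t) (\<lambda>x. 1)" if t: "t \<in> {0..T}" for t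
    using u_coeff_0_if_v_0[OF v0 _ t] True
    by (intro cos_complete_const u_in_L2[OF t]) (simp add: mode_def[abs_def])
  have "((\<lambda>s. L2_inner (u s) (\<lambda>x. 1)) has_real_derivative 0) (at t within {0..T})" if t: "t \<in> {0..T}" for t
  proof -
    have "L2_inner (v t) (\<lambda>x. 1) = L2_inner (\<lambda>x. 0) (\<lambda>x. 1)"
      using v0[OF t] v_in_L2[OF t] L2_measurable L2_zero by (intro L2_inner_cong_AE) auto
    then show ?thesis using u_inner_deriv[OF t L2_const[of 1]] by (simp add: L2_inner_def)
  qed
  then have "\<exists>c. \<forall>t\<in>{0..T}. L2_inner (u t) (\<lambda>x. 1) = c"
    by (intro has_field_derivative_zero_constant) auto
  then obtain c where "\<And>t. t \<in> {0..T} \<Longrightarrow> L2_inner (u t) (\<lambda>x. 1) = c" by blast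
  with * have "\<forall>t\<in>{0..T}. AE x in LI. u t x = c" by simp
  then show ?thesis using True by auto
next
  case False
  have "AE x in LI. u t x = 0" if t: "t \<in> {0..T}" for t
  proof (rule sin_complete[OF u_in_L2[OF t]])
    fix k :: nat
    show "L2_inner (u t) (\<lambda>x. sin (real k * pi * x)) = 0"
    proof (cases "k = 0")
      case True then show ?thesis by (simp add: L2_inner_def)
    next
      case k: False
      then show ?thesis using u_coeff_0_if_v_0[OF v0 _ t, of k] False by (simp add: mode_def[abs_def])
    qed
  qed
  then show ?thesis by blast
qed

end

subsection \<open>The d'Alembert representation\<close>

text \<open>The regularity that the initial data of an arbitrary weak solution provide. It is enough
  for the Fourier coefficients of the travelling waves, through which the solution is
  identified.\<close>

locale square_integrable_profile =
  fixes g :: "real \<Rightarrow> real" and \<kappa> :: real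
  assumes g_measurable[measurable]: "g \<in> borel_measurable borel" and g_periodic: "g (y + 2) = g y"
    and g_square: "integrable lborel (\<lambda>y. indicator {-1..<1} y * (g y)\<^sup>2)"
    and kappa: "\<bar>\<kappa>\<bar> = 1"
begin

lemma g_shift_L2: "(\<lambda>x. g (x - t)) \<in> L2" "(\<lambda>x. g (- x - t)) \<in> L2"
proof -
  have "integrable LI (\<lambda>x. (g (x - t))\<^sup>2)" "integrable LI (\<lambda>x. (g (- x - t))\<^sup>2)"
    using integral_unfold[of "\<lambda>y. (g y)\<^sup>2" t] g_periodic g_square by auto
  moreover have "(\<lambda>x. g (x - t)) \<in> borel_measurable LI" "(\<lambda>x. g (- x - t)) \<in> borel_measurable LI"
    by (rule borel_imp_LI, measurable)+
  ultimately show "(\<lambda>x. g (x - t)) \<in> L2" "(\<lambda>x. g (- x - t)) \<in> L2" by (auto simp: L2_def)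
qed

text \<open>The parity of \<open>e\<close> allows the two integrals over the interval to be joined
  into one over the circle, where the time shift falls on \<open>e\<close> instead of
  \<open>g\<close>.\<close>

lemma profile_unfold:
  assumes [measurable]: "e \<in> borel_measurable borel" and per: "\<And>y. e (y + 2) = e y" and b: "\<And>y. \<bar>e y\<bar> \<le> 1"
    and par: "\<And>x. e (- x) = c * e x"
  shows "integrable lborel (\<lambda>y. indicator {-1..<1} y * (g y * e (y + t)))"
    "L2_inner (\<lambda>x. g (x - t)) e + c * L2_inner (\<lambda>x. g (- x - t)) e = (\<integral>y. indicator {-1..<1} y * (g y * e (y + t)) \<partial>lborel)"
proof -
  show i: "integrable lborel (\<lambda>y. indicator {-1..<1} y * (g y * e (y + t)))"
  proof (rule Bochner_Integration.integrable_bound)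
    show "integrable lborel (\<lambda>y. indicator {-1..<1} y * (g y)\<^sup>2 + indicator {-1..<1::real} y)"
      using g_square by (intro Bochner_Integration.integrable_add) auto
    have "\<bar>g y * e (y + t)\<bar> \<le> (g y)\<^sup>2 + 1" for y
    proof -
      have "\<bar>g y * e (y + t)\<bar> \<le> \<bar>g y\<bar> * 1" unfolding abs_mult by (intro mult_left_mono b) auto
      also have "\<dots> \<le> (g y)\<^sup>2 + 1"
        using sum_squares_bound[of "\<bar>g y\<bar>" 1] mult_nonneg_nonneg[of "\<bar>g y\<bar>" 1] by (simp add: power2_eq_square)
      finally show ?thesis .
    qed
    then have "norm (indicator {-1..<1} y * (g y * e (y + t))) \<le> norm (indicator {-1..<1} y * (g y)\<^sup>2 + indicator {-1..<1} y)" for y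
      by (auto simp: indicator_def abs_mult)
    then show "AE y in lborel. norm (indicator {-1..<1} y * (g y * e (y + t))) \<le> norm (indicator {-1..<1} y * (g y)\<^sup>2 + indicator {-1..<1} y)"
      by (intro AE_I2)
  qed measurable
  have "(LINT x|LI. g (x - t) * e x) + (LINT x|LI. g (- x - t) * e (- x)) = (\<integral>y. indicator {-1..<1} y * (g y * e (y + t)) \<partial>lborel)"
  proof -
    have p: "g (y + 2) * e (y + 2 + t) = g y * e (y + t)" for y
      using per[of "y + t"] g_periodic by (simp add: add.assoc add.commute add.left_commute)
    show ?thesis
      using integral_unfold(3)[of "\<lambda>y. g y * e (y + t)" t, OF _ p i] by simp
  qed
  then show "L2_inner (\<lambda>x. g (x - t)) e + c * L2_inner (\<lambda>x. g (- x - t)) e = (\<integral>y. indicator {-1..<1} y * (g y * e (y + t)) \<partial>lborel)"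
    by (simp add: L2_inner_def par algebra_simps)
qed

definition V :: "real \<Rightarrow> real \<Rightarrow> real" where
  "V t x = g (- x - t) + \<kappa> * g (x - t)"

lemma V_L2: "V t \<in> L2"
  unfolding V_def[abs_def] by (intro L2_add L2_scale g_shift_L2)

text \<open>The coefficient is an integral over the circle of \<open>g\<close> against a translated
  mode, which \<open>mode_add\<close> expands. The outcome is the formula of
  \<open>coeff_rotation\<close>, with \<open>g (- x) - \<kappa> * g x\<close> in the role of the
  initial slope.\<close>

lemma V_coeff:
  "L2_inner (V t) (mode \<kappa> k) = cos (real k * pi * t) * L2_inner (V 0) (mode \<kappa> k)
    + \<kappa> * sin (real k * pi * t) * L2_inner (\<lambda>x. g (- x) - \<kappa> * g x) (mode (- \<kappa>) k)"
proof -
  let ?e = "mode \<kappa> k" and ?f = "mode (- \<kappa>) k"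
  let ?I = "\<lambda>h. \<integral>y. indicator {-1..<1} y * (g y * h y) \<partial>lborel"
  have kk: "\<kappa> * \<kappa> = 1" using kappa by (auto simp: abs_if split: if_splits)
  have k: "\<kappa> * (\<kappa> * x) = x" for x using kk by (simp add: mult.assoc[symmetric])
  note e = profile_unfold[of ?e, OF mode_measurable mode_periodic mode_bounded mode_minus[OF kappa]]
  have f_par: "?f (- x) = - \<kappa> * ?f x" for x using mode_minus[of "-\<kappa>" k x] kappa by simp
  note f = profile_unfold[of ?f, OF mode_measurable mode_periodic mode_bounded f_par]
  have Ve: "L2_inner (V t) ?e = \<kappa> * ?I (\<lambda>y. ?e (y + t))" for t
  proof -
    have "L2_inner (V t) ?e = L2_inner (\<lambda>x. g (- x - t)) ?e + \<kappa> * L2_inner (\<lambda>x. g (x - t)) ?e"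
      unfolding V_def[abs_def] by (simp add: L2_inner_add_left L2_scale g_shift_L2 mode_L2 L2_inner_scale_left)
    also have "\<dots> = \<kappa> * (L2_inner (\<lambda>x. g (x - t)) ?e + \<kappa> * L2_inner (\<lambda>x. g (- x - t)) ?e)"
      by (simp add: algebra_simps k)
    finally show ?thesis using e(2)[of t] by simp
  qed
  have U: "L2_inner (\<lambda>x. g (- x) - \<kappa> * g x) ?f = - \<kappa> * ?I ?f"
  proof -
    have "L2_inner (\<lambda>x. g (- x - 0) - \<kappa> * g (x - 0)) ?f = L2_inner (\<lambda>x. g (- x - 0)) ?f - \<kappa> * L2_inner (\<lambda>x. g (x - 0)) ?f"
      using L2_inner_diff_left[OF g_shift_L2(2)[of 0] L2_scale[OF g_shift_L2(1)[of 0]] mode_L2, of \<kappa> "-\<kappa>" k]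
        L2_inner_scale_left[of \<kappa> "\<lambda>x. g (x - 0)" ?f] by simp
    also have "\<dots> = - \<kappa> * (L2_inner (\<lambda>x. g (x - 0)) ?f + (- \<kappa>) * L2_inner (\<lambda>x. g (- x - 0)) ?f)"
      by (simp add: algebra_simps k)
    finally show ?thesis using f(2)[of 0] by simp
  qed
  have "?I (\<lambda>y. ?e (y + t)) = (\<integral>y. cos (real k * pi * t) * (indicator {-1..<1} y * (g y * ?e y))
      - \<kappa> * sin (real k * pi * t) * (indicator {-1..<1} y * (g y * ?f y)) \<partial>lborel)"
    by (intro Bochner_Integration.integral_cong refl) (simp add: mode_add[OF kappa] algebra_simps)
  also have "\<dots> = cos (real k * pi * t) * ?I ?e - \<kappa> * sin (real k * pi * t) * ?I ?f"
    using e(1)[of 0] f(1)[of 0] by simp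
  finally have I: "?I (\<lambda>y. ?e (y + t)) = cos (real k * pi * t) * ?I ?e - \<kappa> * sin (real k * pi * t) * ?I ?f" .
  have "L2_inner (V t) ?e = cos (real k * pi * t) * (\<kappa> * ?I ?e) - (\<kappa> * \<kappa>) * (sin (real k * pi * t) * ?I ?f)"
    unfolding Ve I by (simp only: right_diff_distrib mult_ac)
  then have "L2_inner (V t) ?e = cos (real k * pi * t) * (\<kappa> * ?I ?e) - sin (real k * pi * t) * ?I ?f"
    by (simp add: kk)
  moreover have "L2_inner (V 0) ?e = \<kappa> * ?I ?e" using Ve[of 0] by simp
  moreover have "?I ?f = - \<kappa> * L2_inner (\<lambda>x. g (- x) - \<kappa> * g x) ?f"
    unfolding U by (simp add: k)
  ultimately show ?thesis by (simp add: algebra_simps)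
qed

end

text \<open>The representative modulo 2 in \<open>[-1, 1)\<close>. This period is centred at 0 so
  that the sign of the representative tells the two labels apart.\<close>

definition wrap :: "real \<Rightarrow> real" where
  "wrap y = y - 2 * of_int \<lfloor>(y + 1) / 2\<rfloor>"

lemma wrap_measurable[measurable]: "wrap \<in> borel_measurable borel"
  unfolding wrap_def[abs_def] by measurable

lemma wrap_bounds: "- 1 \<le> wrap y" "wrap y < 1"
  using floor_correct[of "(y + 1) / 2"] by (auto simp: wrap_def field_simps)

lemma wrap_cases: obtains n :: int where "wrap y = y + 2 * of_int n"
  by (rule that[of "- \<lfloor>(y + 1) / 2\<rfloor>"]) (simp add: wrap_def)

lemma wrap_unique:
  assumes "- 1 \<le> z" "z < 1" "z = y + 2 * of_int n" shows "wrap y = z"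
proof -
  have "\<lfloor>(y + 1) / 2\<rfloor> = - n" using assms by (simp add: floor_eq_iff)
  then show ?thesis using assms by (simp add: wrap_def)
qed

lemma wrap_id: "- 1 \<le> z \<Longrightarrow> z < 1 \<Longrightarrow> wrap z = z"
  by (rule wrap_unique[of _ _ 0]) auto

lemma wrap_periodic: "wrap (y + 2) = wrap y"
proof -
  obtain n where "wrap y = y + 2 * of_int n" by (rule wrap_cases)
  then show ?thesis using wrap_bounds[of y] by - (rule wrap_unique[where n = "n - 1"]; auto simp: algebra_simps)
qed

text \<open>The values of \<open>g\<close> on the two halves of a period are two free functions,
  fixed by the two initial data. Velocity and travelling waves then have equal initial coefficients
  and follow the same rotation, so completeness identifies them at each time.\<close>

lemma (in weak_solution) dalembert_representation:
  obtains g :: "real \<Rightarrow> real" where "g \<in> borel_measurable borel" "\<And>y. g (y + 2) = g y"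
    "\<And>t. t \<in> {0..T} \<Longrightarrow> AE x in LI. v t x = g (- x - t) + \<kappa> * g (x - t)"
proof -
  have 0: "0 \<in> {0..T}" using T by simp
  have rep: "\<exists>h\<in>borel_measurable borel. AE x in LI. f x = h x" if "f \<in> L2" for f :: "real \<Rightarrow> real"
  proof -
    have "(\<lambda>x. if x \<in> I01 then f x else 0) \<in> borel_measurable lebesgue"
      by (intro LI_extend_measurable L2_measurable that)
    then obtain h where "h \<in> borel_measurable lborel" "AE x in lborel. (if x \<in> I01 then f x else 0) = h x"
      using completion_ex_borel_measurable_real by blast
    moreover from this(2) have "AE x in lebesgue. (if x \<in> I01 then f x else 0) = h x" by (rule AE_completion)
    then have "AE x in LI. f x = h x" unfolding AE_LI_iff by eventually_elim auto
    ultimately show ?thesis by auto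
  qed
  obtain a where a[measurable]: "a \<in> borel_measurable borel" and a': "AE x in LI. weak_deriv (u 0) x = a x"
    using rep[OF ux_in_L2[OF 0]] by blast
  obtain b where b[measurable]: "b \<in> borel_measurable borel" and b': "AE x in LI. v 0 x = b x"
    using rep[OF v_in_L2[OF 0]] by blast
  \<comment> \<open>The solution of the linear system that asks
    \<open>g (- x) + \<kappa> * g x\<close> to be the initial velocity \<open>b\<close> and
    \<open>g (- x) - \<kappa> * g x\<close> the initial slope \<open>a\<close> on the
    interval.\<close>
  define g0 where "g0 y = (if 0 < y then \<kappa> * (b y - a y) / 2 else (a (- y) + b (- y)) / 2)" for y :: real
  define g where "g y = g0 (wrap y)" for y
  have [measurable]: "g0 \<in> borel_measurable borel" unfolding g0_def[abs_def] by measurable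
  have gm[measurable]: "g \<in> borel_measurable borel" unfolding g_def[abs_def] by measurable
  have gp: "g (y + 2) = g y" for y by (simp add: g_def wrap_periodic)
  have g1: "g y = g0 y" if "y \<in> {-1..<1}" for y using that by (simp add: g_def wrap_id)
  have gx: "g x = \<kappa> * (b x - a x) / 2" "g (- x) = (a x + b x) / 2" if "x \<in> I01" for x
    using that by (auto simp: g1 g0_def)
  have abL2: "a \<in> L2" "b \<in> L2"
  proof -
    have "f \<in> L2" if "f' \<in> L2" "f \<in> borel_measurable borel" "AE x in LI. f' x = f x" for f f' :: "real \<Rightarrow> real"
    proof -
      have "integrable LI (\<lambda>x. (f x)\<^sup>2) \<longleftrightarrow> integrable LI (\<lambda>x. (f' x)\<^sup>2)"
        using that(3) borel_imp_LI[OF that(2)] L2_measurable[OF that(1)]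
        by (intro integrable_cong_AE) auto
      with that show ?thesis using borel_imp_LI by (auto simp: L2_def)
    qed
    then show "a \<in> L2" "b \<in> L2" using a a' b b' ux_in_L2[OF 0] v_in_L2[OF 0] by blast+
  qed
  have L2s: "(\<lambda>x. (\<kappa> / 2) * (b x - a x)) \<in> L2" "(\<lambda>x. (1/2) * (a x + b x)) \<in> L2"
    by (intro L2_scale L2_add L2_diff abL2)+
  have sq: "integrable lborel (\<lambda>y. indicator {-1..<1} y * (g y)\<^sup>2)"
  proof -
    have 1: "(\<integral>\<^sup>+x. ennreal ((g x)\<^sup>2) \<partial>LI) = (\<integral>\<^sup>+x. ennreal (((\<kappa> / 2) * (b x - a x))\<^sup>2) \<partial>LI)"
      by (intro nn_integral_cong) (simp add: gx)
    have 2: "(\<integral>\<^sup>+x. ennreal ((g (- x))\<^sup>2) \<partial>LI) = (\<integral>\<^sup>+x. ennreal (((1/2) * (a x + b x))\<^sup>2) \<partial>LI)"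
      by (intro nn_integral_cong) (simp add: gx)
    have "(\<integral>\<^sup>+y. indicator {-1..<1} y * ennreal ((g y)\<^sup>2) \<partial>lborel) = (\<integral>\<^sup>+x. ennreal ((g (x - 0))\<^sup>2) \<partial>LI) + (\<integral>\<^sup>+x. ennreal ((g (- x - 0))\<^sup>2) \<partial>LI)"
      by (rule nn_integral_unfold[symmetric]) (simp_all add: gp)
    also have "\<dots> < \<infinity>"
      using L2_square_integrable[OF L2s(1)] L2_square_integrable[OF L2s(2)]
      unfolding integrable_iff_bounded by (simp add: 1 2 del: power_mult_distrib times_divide_eq_left)
    finally have "(\<integral>\<^sup>+y. indicator {-1..<1} y * ennreal ((g y)\<^sup>2) \<partial>lborel) < \<infinity>" .
    moreover have "ennreal (norm (indicator {-1..<1} y * (g y)\<^sup>2)) = indicator {-1..<1} y * ennreal ((g y)\<^sup>2)" for y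
      by (auto simp: indicator_def)
    ultimately show ?thesis unfolding integrable_iff_bounded by simp
  qed
  interpret P: square_integrable_profile g \<kappa>
    by unfold_locales (use gp sq kappa in auto)
  have kk: "\<kappa> * (\<kappa> * x) = x" for x using kappa(2) by (simp add: mult.assoc[symmetric])
  have V0: "AE x in LI. P.V 0 x = v 0 x" and U0: "AE x in LI. g (- x) - \<kappa> * g x = weak_deriv (u 0) x"
  proof -
    have I: "AE x in LI. x \<in> I01" by (rule AE_I2) simp
    show "AE x in LI. P.V 0 x = v 0 x"
      using b' I by eventually_elim (simp add: P.V_def gx kk field_simps)
    show "AE x in LI. g (- x) - \<kappa> * g x = weak_deriv (u 0) x"
      using a' I by eventually_elim (simp add: gx kk field_simps)
  qed
  have UL2: "(\<lambda>x. g (- x) - \<kappa> * g x) \<in> L2"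
    using L2_diff[OF P.g_shift_L2(2)[of 0] L2_scale[OF P.g_shift_L2(1)[of 0], of \<kappa>]] by simp
  have "AE x in LI. v t x = g (- x - t) + \<kappa> * g (x - t)" if t: "t \<in> {0..T}" for t
  proof -
    have coeff: "L2_inner (\<lambda>x. v t x - P.V t x) (mode \<kappa> k) = 0" for k
    proof -
      have "L2_inner (P.V 0) (mode \<kappa> k) = L2_inner (v 0) (mode \<kappa> k)"
        using V0 P.V_L2 v_in_L2[OF 0] mode_L2 L2_measurable by (intro L2_inner_cong_AE) auto
      moreover have "L2_inner (\<lambda>x. g (- x) - \<kappa> * g x) (mode (- \<kappa>) k) = L2_inner (weak_deriv (u 0)) (mode (- \<kappa>) k)"
        using U0 UL2 ux_in_L2[OF 0] mode_L2 L2_measurable by (intro L2_inner_cong_AE) auto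
      ultimately have "L2_inner (P.V t) (mode \<kappa> k) = L2_inner (v t) (mode \<kappa> k)"
        using P.V_coeff[of t k] coeff_rotation(1)[OF t, of k] by (simp only: mult_ac)
      then show ?thesis using L2_inner_diff_left[OF v_in_L2[OF t] P.V_L2 mode_L2] by simp
    qed
    have "AE x in LI. v t x - P.V t x = 0"
    proof (cases "\<kappa> = 1")
      case True
      then show ?thesis using coeff by (intro cos_complete L2_diff v_in_L2[OF t] P.V_L2) (simp add: mode_def[abs_def])
    next
      case False
      then show ?thesis using coeff by (intro sin_complete L2_diff v_in_L2[OF t] P.V_L2) (simp add: mode_def[abs_def])
    qed
    then show ?thesis by (simp add: P.V_def)
  qed
  then show thesis using that gm gp by blast
qed

text \<open>A stationary constant has zero slope and zero velocity at time 0. These are the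
  difference and the sum of \<open>g (- x)\<close> and \<open>\<kappa> * g x\<close>, so both terms
  vanish.\<close>

lemma (in periodic_profile) stationary_imp_profile_0:
  assumes T: "T > 0" and \<kappa>: "\<bar>\<kappa>\<bar> = 1"
    and solution: "weak_wave_solution V T u0 u1 (wave_u \<kappa>) (wave_v \<kappa>)"
    and c: "\<And>t. t \<in> {0..T} \<Longrightarrow> AE x in LI. wave_u \<kappa> t x = c"
  shows "AE x in LI. g x = 0 \<and> g (- x) = 0"
proof -
  have uL2: "wave_u \<kappa> t \<in> L2" for t using has_weak_deriv_L2[OF wave_u_weak_deriv] by blast
  have "has_weak_deriv (\<lambda>x. c) (wave_ux \<kappa> 0)"
    by (rule has_weak_deriv_AE_cong[OF wave_u_weak_deriv c L2_const]) (use T in simp)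
  moreover have "has_weak_deriv (\<lambda>x. c) (\<lambda>x. 0)"
    by (rule C1_has_weak_deriv) auto
  ultimately have ux: "AE x in LI. wave_ux \<kappa> 0 x = 0" by (rule has_weak_deriv_unique)
  have "((\<lambda>s. L2_norm (\<lambda>x. (wave_u \<kappa> s x - wave_u \<kappa> 0 x) / (s - 0) - wave_v \<kappa> 0 x)) \<longlongrightarrow> 0) (at 0 within {0..T})"
    using solution T unfolding weak_wave_solution_def has_L2_time_deriv_def by fastforce
  \<comment> \<open>The displacements at times \<open>s\<close> and 0 agree almost everywhere, so
    the difference quotient drops out and only the velocity remains under the norm.\<close>
  moreover have "\<forall>\<^sub>F s in at 0 within {0..T}. L2_norm (\<lambda>x. (wave_u \<kappa> s x - wave_u \<kappa> 0 x) / (s - 0) - wave_v \<kappa> 0 x) = L2_norm (wave_v \<kappa> 0)"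
    unfolding eventually_at_filter
  proof (intro always_eventually allI impI)
    fix s assume s: "s \<in> {0..T}"
    have "L2_norm (\<lambda>x. (wave_u \<kappa> s x - wave_u \<kappa> 0 x) / (s - 0) - wave_v \<kappa> 0 x) = L2_norm (\<lambda>x. - wave_v \<kappa> 0 x)"
    proof (rule L2_norm_cong_AE)
      have "AE x in LI. wave_u \<kappa> 0 x = c" using c T by simp
      with c[OF s] show "AE x in LI. (wave_u \<kappa> s x - wave_u \<kappa> 0 x) / (s - 0) - wave_v \<kappa> 0 x = - wave_v \<kappa> 0 x"
        by eventually_elim simp
    qed (use L2_measurable[OF uL2] L2_measurable[OF wave_v_L2] in auto)
    then show "L2_norm (\<lambda>x. (wave_u \<kappa> s x - wave_u \<kappa> 0 x) / (s - 0) - wave_v \<kappa> 0 x) = L2_norm (wave_v \<kappa> 0)"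
      by (simp add: L2_norm_minus)
  qed
  ultimately have "((\<lambda>s. L2_norm (wave_v \<kappa> 0)) \<longlongrightarrow> 0) (at 0 within {0..T})"
    by (rule Lim_transform_eventually)
  moreover have "at 0 within {0..T} \<noteq> bot" using T by (simp add: at_within_Icc_at_right)
  ultimately have "L2_norm (wave_v \<kappa> 0) = 0" using tendsto_unique tendsto_const by metis
  then have v: "AE x in LI. wave_v \<kappa> 0 x = 0" by (intro L2_norm_eq_0_AE wave_v_L2)
  from ux v show ?thesis
    by eventually_elim (use \<kappa> in \<open>auto simp: wave_ux_def wave_v_def abs_if split: if_splits\<close>)
qed

subsection \<open>Characteristics on the circle\<close>

text \<open>
  The point \<open>y\<close> of the circle \<open>\<real>/2\<int>\<close> moves with unit speed to the right and is then folded to the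
  interval: \<open>[x;\<xi>]\<close> corresponds to \<open>x\<close> and \<open>[x;\<eta>]\<close> to \<open>- x\<close>. The two characteristics through
  \<open>(t,x)\<close> start from \<open>x - t\<close> and \<open>- x - t\<close>.
\<close>

definition lift :: "real \<Rightarrow> real \<times> label" where
  "lift y = (if wrap y > 0 then (wrap y, Xi) else (- wrap y, Eta))"

lemma folding_eq_wrap: "folding y = \<bar>wrap y\<bar>"
proof -
  define r where "r = y rmod 2"
  have r: "0 \<le> r" "r < 2" unfolding r_def using rmod_nonneg[of 2 y] rmod_less[of 2 y] by auto
  have y: "r = y + 2 * of_int (- \<lfloor>y / 2\<rfloor>)" by (simp add: r_def rmod_def)
  show ?thesis
  proof (cases "r < 1")
    case True
    then have "wrap y = r" using r y by - (rule wrap_unique[where n = "- \<lfloor>y / 2\<rfloor>"]; auto simp: algebra_simps)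
    then show ?thesis using True r by (simp add: folding_def r_def[symmetric])
  next
    case False
    have "wrap y = r - 2" using r y False by - (rule wrap_unique[where n = "- \<lfloor>y / 2\<rfloor> - 1"]; auto simp: algebra_simps)
    then show ?thesis using False r by (auto simp: folding_def r_def[symmetric])
  qed
qed

lemma folding_measurable[measurable]: "folding \<in> borel_measurable borel"
  unfolding folding_eq_wrap[abs_def] by measurable

lemma folding_periodic: "folding (y + 2) = folding y"
  by (simp add: folding_eq_wrap wrap_periodic)

lemma folding_id: "0 \<le> x \<Longrightarrow> x < 1 \<Longrightarrow> folding x = x"
  by (simp add: folding_eq_wrap wrap_id)

lemma folding_minus: "folding (- y) = folding y"
proof -
  obtain n where n: "wrap y = y + 2 * of_int n" by (rule wrap_cases)
  show ?thesis
  proof (cases "wrap y = -1")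
    \<comment> \<open>The point -1 is its own negative modulo 2, but 1 is outside the range of
      \<open>wrap\<close>; here the sign does not change.\<close>
    case True
    then have "wrap (- y) = -1" using n by - (rule wrap_unique[where n = "- n - 1"]; auto simp: algebra_simps)
    with True show ?thesis by (simp add: folding_eq_wrap)
  next
    case False
    then have "wrap (- y) = - wrap y" using n wrap_bounds[of y] by - (rule wrap_unique[where n = "- n"]; auto simp: algebra_simps)
    then show ?thesis by (simp add: folding_eq_wrap)
  qed
qed

lemma wrap_shift_iff:
  assumes "- 1 \<le> a" "a < 1" "- 1 \<le> b" "b < 1"
  shows "wrap (a + t) = b \<longleftrightarrow> wrap (b - t) = a"
proof
  assume "wrap (a + t) = b"
  moreover obtain n where "wrap (a + t) = a + t + 2 * of_int n" by (rule wrap_cases)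
  ultimately show "wrap (b - t) = a" using assms by - (rule wrap_unique[where n = "- n"]; auto simp: algebra_simps)
next
  assume "wrap (b - t) = a"
  moreover obtain n where "wrap (b - t) = b - t + 2 * of_int n" by (rule wrap_cases)
  ultimately show "wrap (a + t) = b" using assms by - (rule wrap_unique[where n = "- n"]; auto simp: algebra_simps)
qed

lemma lift_eq_iff:
  assumes "z \<in> I01"
  shows "lift y = (z, Xi) \<longleftrightarrow> wrap y = z" "lift y = (z, Eta) \<longleftrightarrow> wrap y = - z"
  using assms by (auto simp: lift_def)

lemma lift_I01:
  assumes "x \<in> I01" shows "lift x = (x, Xi)" "lift (- x) = (x, Eta)"
  using assms by (auto simp: lift_eq_iff wrap_id)

lemma lift_periodic: "lift (y + 2) = lift y"
  by (simp add: lift_def wrap_periodic)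

lemma mem_char_line_iff:
  assumes x: "x \<in> I01" and t: "0 \<le> t" and q: "q \<in> I01 \<times> UNIV"
  shows "(t, x) \<in> char_line q \<longleftrightarrow> q = lift (x - t) \<or> q = lift (- x - t)"
proof -
  obtain z \<sigma> where z: "q = (z, \<sigma>)" "z \<in> I01" using q by auto
  have *: "\<bar>wrap y\<bar> = x \<longleftrightarrow> wrap y = x \<or> wrap y = - x" for y using x by (auto simp: abs_if)
  show ?thesis
  proof (cases \<sigma>)
    case Xi
    have "(t, x) \<in> char_line q \<longleftrightarrow> folding (z + t) = x"
      using t by (auto simp: char_line_def z Xi)
    also have "\<dots> \<longleftrightarrow> wrap (x - t) = z \<or> wrap (- x - t) = z"
      using x z(2) by (simp add: folding_eq_wrap * wrap_shift_iff)
    also have "\<dots> \<longleftrightarrow> q = lift (x - t) \<or> q = lift (- x - t)"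
      using lift_eq_iff(1)[OF z(2)] by (auto simp: z Xi eq_commute[of "(z, label.Xi)"])
    finally show ?thesis .
  next
    case Eta
    have "(t, x) \<in> char_line q \<longleftrightarrow> folding (- (- z + t)) = x"
      using t by (auto simp: char_line_def z Eta)
    also have "\<dots> \<longleftrightarrow> wrap (x - t) = - z \<or> wrap (- x - t) = - z"
      unfolding folding_minus using x z(2) by (simp only: folding_eq_wrap * ) (subst (1 2) wrap_shift_iff; auto)
    also have "\<dots> \<longleftrightarrow> q = lift (x - t) \<or> q = lift (- x - t)"
      using lift_eq_iff(2)[OF z(2)] by (auto simp: z Eta eq_commute[of "(z, label.Eta)"])
    finally show ?thesis .
  qed
qed

text \<open>The two starting points differ by \<open>2 * x\<close>, which is not a multiple of the
  period 2 for \<open>x\<close> strictly between 0 and 1.\<close>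

lemma lift_distinct:
  assumes "x \<in> I01" shows "lift (x - t) \<noteq> lift (- x - t)"
proof
  assume "lift (x - t) = lift (- x - t)"
  then have eq: "wrap (x - t) = wrap (- x - t)" by (auto simp: lift_def split: if_splits)
  obtain n m where "wrap (x - t) = x - t + 2 * of_int n" "wrap (- x - t) = - x - t + 2 * of_int m"
    using wrap_cases by metis
  with eq have "x = of_int (m - n)" by simp
  with assms have "0 < m - n" "m - n < 1" by (simp_all only: of_int_0_less_iff of_int_less_1_iff greaterThanLessThan_iff)
  then show False by simp
qed

text \<open>Exactly two characteristics pass through an interior point and their labels are
  distinct, so two different members of \<open>A\<close> meeting there must be these two.\<close>

lemma M_set_iff:
  assumes "x \<in> I01" "0 \<le> t" "A \<subseteq> I01 \<times> UNIV"
  shows "(t, x) \<in> M_set A \<longleftrightarrow> lift (x - t) \<in> A \<and> lift (- x - t) \<in> A"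
proof -
  have c: "(t, x) \<in> char_line q \<longleftrightarrow> q = lift (x - t) \<or> q = lift (- x - t)" if "q \<in> A" for q
    using mem_char_line_iff assms that by blast
  have "(t, x) \<in> M_set A \<longleftrightarrow> (\<exists>y\<in>A. \<exists>z\<in>A. y \<noteq> z \<and> (t, x) \<in> char_line y \<and> (t, x) \<in> char_line z)"
    using assms(1,2) by (simp add: M_set_def)
  also have "\<dots> \<longleftrightarrow> (\<exists>y\<in>A. \<exists>z\<in>A. y \<noteq> z \<and> (y = lift (x - t) \<or> y = lift (- x - t)) \<and> (z = lift (x - t) \<or> z = lift (- x - t)))"
    using c by blast
  also have "\<dots> \<longleftrightarrow> lift (x - t) \<in> A \<and> lift (- x - t) \<in> A"
    using lift_distinct[OF assms(1), of t] by metis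
  finally show ?thesis .
qed

lemma W_set_iff:
  assumes "x \<in> I01" "0 \<le> t" "E \<subseteq> I01 \<times> UNIV" "F \<subseteq> I01 \<times> UNIV"
  shows "(t, x) \<in> W_set E F \<longleftrightarrow>
    (lift (x - t) \<in> E \<and> lift (- x - t) \<in> F) \<or> (lift (x - t) \<in> F \<and> lift (- x - t) \<in> E)"
proof -
  have c: "(t, x) \<in> char_line q \<longleftrightarrow> q = lift (x - t) \<or> q = lift (- x - t)" if "q \<in> E \<union> F" for q
    using mem_char_line_iff assms that by blast
  have "(t, x) \<in> W_set E F \<longleftrightarrow> (\<exists>y\<in>E. \<exists>z\<in>F. y \<noteq> z \<and> (t, x) \<in> char_line y \<and> (t, x) \<in> char_line z)"
    using assms(1,2) by (simp add: W_set_def)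
  also have "\<dots> \<longleftrightarrow> (\<exists>y\<in>E. \<exists>z\<in>F. y \<noteq> z \<and> (y = lift (x - t) \<or> y = lift (- x - t)) \<and> (z = lift (x - t) \<or> z = lift (- x - t)))"
    using c by blast
  also have "\<dots> \<longleftrightarrow> (lift (x - t) \<in> E \<and> lift (- x - t) \<in> F) \<or> (lift (x - t) \<in> F \<and> lift (- x - t) \<in> E)"
    using lift_distinct[OF assms(1), of t] by metis
  finally show ?thesis .
qed

subsection \<open>Null sets and characteristics\<close>

lemma AE_iff_cong: "(AE x in M. P x \<longleftrightarrow> Q x) \<Longrightarrow> (AE x in M. P x) \<longleftrightarrow> (AE x in M. Q x)"
  by (auto elim: AE_mp)

lemma AE_LI_iff_lborel: "(AE x in LI. P x) \<longleftrightarrow> (AE x in lborel. x \<in> I01 \<longrightarrow> P x)"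
  by (simp add: AE_LI_iff AE_completion_iff)

text \<open>\<open>nn_integral_unfold\<close> applied to the indicator of the points where
  \<open>P\<close> fails: the measure of that set within a period does not depend on the
  time.\<close>

lemma AE_unfold_iff:
  assumes [measurable]: "Measurable.pred borel P" and per: "\<And>y. P (y + 2) = P y"
  shows "(AE x in LI. P (x - t) \<and> P (- x - t)) \<longleftrightarrow> (AE x in LI. P x \<and> P (- x))"
proof -
  define f :: "real \<Rightarrow> ennreal" where "f y = (if P y then 0 else 1)" for y
  have [measurable]: "f \<in> borel_measurable borel" unfolding f_def[abs_def] by measurable
  have fp: "f (y + 2) = f y" for y by (simp add: f_def per)
  have m: "(\<lambda>x. f (c * x - t)) \<in> borel_measurable LI" for c t
    by (intro measurable_restrict_space1 measurable_completion) simp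
  have *: "(AE x in LI. P (x - t) \<and> P (- x - t)) \<longleftrightarrow> (\<integral>\<^sup>+x. f (x - t) \<partial>LI) + (\<integral>\<^sup>+x. f (- x - t) \<partial>LI) = 0" for t
  proof -
    have 1: "(\<integral>\<^sup>+x. f (x - t) \<partial>LI) = 0 \<longleftrightarrow> (AE x in LI. P (x - t))"
      using m[of 1 t] by (subst nn_integral_0_iff_AE) (auto simp: f_def)
    have 2: "(\<integral>\<^sup>+x. f (- x - t) \<partial>LI) = 0 \<longleftrightarrow> (AE x in LI. P (- x - t))"
      using m[of "-1" t] by (subst nn_integral_0_iff_AE) (auto simp: f_def)
    show ?thesis by (simp add: 1 2)
  qed
  have "(AE x in LI. P (x - t) \<and> P (- x - t)) \<longleftrightarrow> (AE x in LI. P (x - 0) \<and> P (- x - 0))"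
    unfolding * nn_integral_unfold[of f, OF \<open>f \<in> borel_measurable borel\<close> fp] ..
  then show ?thesis by simp
qed

lemma AE_plane_iff:
  fixes P :: "real \<Rightarrow> real \<Rightarrow> bool"
  assumes [measurable]: "Measurable.pred (borel \<Otimes>\<^sub>M borel) (\<lambda>p. P (fst p) (snd p))"
  shows "(AE p in lborel. P (fst p) (snd p)) \<longleftrightarrow> (AE t in lborel. AE x in lborel. P t x)"
proof -
  have "{p \<in> space (lborel \<Otimes>\<^sub>M lborel). P (fst p) (snd p)} \<in> sets (lborel \<Otimes>\<^sub>M lborel)"
    by measurable
  from lborel_pair.AE_pair_iff[OF this] show ?thesis unfolding lborel_prod ..
qed

text \<open>A null set of starting points is null on every time slice, hence by Fubini the points of
  the plane reached from it form a null set.\<close>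

lemma AE_plane_unfold:
  assumes [measurable]: "Measurable.pred borel P" and per: "\<And>y. P (y + 2) = P y"
    and ae: "AE x in LI. P x \<and> P (- x)"
  shows "AE p in lborel. snd p \<in> I01 \<longrightarrow> P (snd p - fst p) \<and> P (- snd p - fst p)"
proof -
  have "AE x in lborel. x \<in> I01 \<longrightarrow> P (x - t) \<and> P (- x - t)" for t
    using AE_unfold_iff[OF assms(1) per, of t] ae unfolding AE_LI_iff_lborel by blast
  then show ?thesis
    using AE_plane_iff[of "\<lambda>t x. x \<in> I01 \<longrightarrow> P (x - t) \<and> P (- x - t)"] by simp
qed

text \<open>Fubini's theorem in the coordinates (time, starting point of the characteristic).\<close>

lemma AE_plane_characteristics_iff:
  assumes H[measurable]: "H \<in> sets borel" and HI: "H \<subseteq> UNIV \<times> I01"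
    and N[measurable]: "N \<in> sets borel" and per: "\<And>y. y + 2 \<in> N \<longleftrightarrow> y \<in> N"
  shows "(AE p in lborel. p \<in> H \<longrightarrow> snd p - fst p \<notin> N \<and> - snd p - fst p \<notin> N) \<longleftrightarrow>
    (AE x in LI. (x \<in> N \<longrightarrow> (AE s in lborel. char_pt (x, Xi) s \<notin> H)) \<and> (- x \<in> N \<longrightarrow> (AE s in lborel. char_pt (x, Eta) s \<notin> H)))"
proof -
  have [measurable]: "H \<in> sets (borel \<Otimes>\<^sub>M borel)" unfolding borel_prod by (rule H)
  \<comment> \<open>Says that the characteristic starting at \<open>y\<close>, if \<open>y\<close>
    belongs to \<open>N\<close>, misses \<open>H\<close> at time \<open>t\<close>. For
    \<open>y = x - t\<close> and for \<open>y = - x - t\<close> the folded point is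
    \<open>x\<close>, so the condition on \<open>H\<close> is expressed on the circle and
    \<open>AE_unfold_iff\<close> can remove the shift by \<open>t\<close>.\<close>
  define P where "P t y = (\<not> ((t, folding (y + t)) \<in> H \<and> y \<in> N))" for t y :: real
  have Pm[measurable]: "Measurable.pred (borel \<Otimes>\<^sub>M borel) (\<lambda>p. P (fst p) (snd p))"
    unfolding P_def by measurable
  have Pm1: "Measurable.pred borel (P t)" for t
    unfolding P_def[abs_def] by measurable
  have Pp: "P t (y + 2) = P t y" for t y
    using folding_periodic[of "y + t"] per[of y] by (simp add: P_def ac_simps)
  have "(AE p in lborel. p \<in> H \<longrightarrow> snd p - fst p \<notin> N \<and> - snd p - fst p \<notin> N) \<longleftrightarrow>
      (AE t in lborel. AE x in lborel. (t, x) \<in> H \<longrightarrow> x - t \<notin> N \<and> - x - t \<notin> N)"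
    using AE_plane_iff[of "\<lambda>t x. (t, x) \<in> H \<longrightarrow> x - t \<notin> N \<and> - x - t \<notin> N"] by simp
  also have "\<dots> \<longleftrightarrow> (AE t in lborel. AE x in LI. P t (x - t) \<and> P t (- x - t))"
  proof -
    have "((t, x) \<in> H \<longrightarrow> x - t \<notin> N \<and> - x - t \<notin> N) \<longleftrightarrow> (x \<in> I01 \<longrightarrow> P t (x - t) \<and> P t (- x - t))" for t x
      using HI folding_id[of x] folding_minus[of x] by (auto simp: P_def)
    then show ?thesis by (simp only: AE_LI_iff_lborel)
  qed
  also have "\<dots> \<longleftrightarrow> (AE t in lborel. AE x in LI. P t x \<and> P t (- x))"
    using AE_unfold_iff[OF Pm1 Pp] by simp
  also have "\<dots> \<longleftrightarrow> (AE t in lborel. AE x in lborel. x \<in> I01 \<longrightarrow> P t x \<and> P t (- x))"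
    by (simp only: AE_LI_iff_lborel)
  also have "\<dots> \<longleftrightarrow> (AE x in lborel. AE t in lborel. x \<in> I01 \<longrightarrow> P t x \<and> P t (- x))"
  proof (rule lborel_pair.AE_commute)
    have "Measurable.pred (borel \<Otimes>\<^sub>M borel) (\<lambda>p. P (fst p) (- snd p))" unfolding P_def by measurable
    then show "{p \<in> space (lborel \<Otimes>\<^sub>M lborel). snd p \<in> I01 \<longrightarrow> P (fst p) (snd p) \<and> P (fst p) (- snd p)} \<in> sets (lborel \<Otimes>\<^sub>M lborel)"
      by measurable
  qed
  also have "\<dots> \<longleftrightarrow> (AE x in LI. (AE t in lborel. P t x) \<and> (AE t in lborel. P t (- x)))"
  proof -
    have "(AE t in lborel. x \<in> I01 \<longrightarrow> P t x \<and> P t (- x)) \<longleftrightarrow>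
        (x \<in> I01 \<longrightarrow> (AE t in lborel. P t x) \<and> (AE t in lborel. P t (- x)))" for x
      by (cases "x \<in> I01") auto
    then show ?thesis by (simp only: AE_LI_iff_lborel)
  qed
  also have "\<dots> \<longleftrightarrow> (AE x in LI. (x \<in> N \<longrightarrow> (AE s in lborel. char_pt (x, Xi) s \<notin> H)) \<and> (- x \<in> N \<longrightarrow> (AE s in lborel. char_pt (x, Eta) s \<notin> H)))"
  proof -
    have eta: "char_pt (x, Eta) t = (t, folding (- x + t))" for t x
      using folding_minus[of "x - t"] by simp
    have "(AE t in lborel. P t x) \<longleftrightarrow> (x \<in> N \<longrightarrow> (AE s in lborel. char_pt (x, Xi) s \<notin> H))" for x
      by (cases "x \<in> N") (simp_all add: P_def)
    moreover have "(AE t in lborel. P t (- x)) \<longleftrightarrow> (- x \<in> N \<longrightarrow> (AE s in lborel. char_pt (x, Eta) s \<notin> H))" for x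
      unfolding eta by (cases "- x \<in> N") (simp_all add: P_def)
    ultimately show ?thesis by (simp only:)
  qed
  finally show ?thesis .
qed

subsection \<open>The weak geometric control condition\<close>

locale observation_set =
  fixes T :: real and G :: "(real \<times> real) set"
  assumes T: "T > 0" and G: "G \<in> sets lebesgue" "G \<subseteq> {0..T} \<times> I01"
begin

text \<open>Sections of a Lebesgue measurable set along characteristics may fail to be measurable,
  so \<open>G\<close> is enclosed between a Borel set and that set enlarged by a Borel null set. The
  null set is kept over the open interval in order that \<open>AE_plane_characteristics_iff\<close>
  applies to it as well.\<close>

lemma borel_core:
  obtains H N where "H \<in> sets borel" "H \<subseteq> G" "N \<in> null_sets lborel" "N \<subseteq> UNIV \<times> I01" "G \<subseteq> H \<union> N"
proof -
  obtain S M N where S: "G = S \<union> M" "M \<subseteq> N" "N \<in> null_sets lborel" "S \<in> sets lborel"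
    using G(1) by (rule sets_completionE)
  have "N \<inter> (UNIV \<times> I01) \<in> null_sets lborel"
    using S(3) by (intro null_set_Int2) (auto simp: borel_prod[symmetric] intro!: pair_measureI)
  then show thesis
    using S G(2) by (intro that[of S "N \<inter> (UNIV \<times> I01)"]) auto
qed

lemma AE_G_iff:
  assumes "H \<subseteq> G" "N \<in> null_sets lborel" "G \<subseteq> H \<union> N"
  shows "(AE p in lborel. p \<in> H \<longrightarrow> P p) \<longleftrightarrow> (AE p in lebesgue. p \<in> G \<longrightarrow> P p)"
proof -
  have "AE p in lborel. p \<notin> N" using assms(2) by (rule AE_not_in)
  then have "AE p in lborel. p \<in> H \<longleftrightarrow> p \<in> G"
    by eventually_elim (use assms in auto)
  then have "(AE p in lborel. p \<in> H \<longrightarrow> P p) \<longleftrightarrow> (AE p in lborel. p \<in> G \<longrightarrow> P p)"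
    by (auto elim: AE_mp)
  then show ?thesis by (simp add: AE_completion_iff)
qed

text \<open>Fubini along characteristics shows that the null set \<open>N\<close> meets almost every
  one of them in length zero. On those, \<open>G\<close> and its Borel core \<open>H\<close> have
  the same length, and vanishing length means missing \<open>H\<close> at almost all times.\<close>

lemma weak_GCC_iff:
  assumes H: "H \<in> sets borel" "H \<subseteq> G" "N \<in> null_sets lborel" "N \<subseteq> UNIV \<times> I01" "G \<subseteq> H \<union> N"
  shows "weak_GCC T G \<longleftrightarrow> (AE x in LI. \<not> (AE s in lborel. char_pt (x, Xi) s \<notin> H) \<and> \<not> (AE s in lborel. char_pt (x, Eta) s \<notin> H))"
proof -
  have [measurable]: "H \<in> sets (borel \<Otimes>\<^sub>M borel)" unfolding borel_prod by (rule H(1))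
  have meas: "{s. char_pt (x, \<sigma>) s \<in> H} \<in> sets borel" for x \<sigma>
  proof -
    have "Measurable.pred borel (\<lambda>s. (s, folding (x + s)) \<in> H)" "Measurable.pred borel (\<lambda>s. (s, folding (x - s)) \<in> H)"
      by measurable
    then show ?thesis by (cases \<sigma>) (auto simp: pred_def)
  qed
  have N: "N \<in> sets borel" using H(3) by auto
  have "AE p in lborel. p \<notin> N" using H(3) by (rule AE_not_in)
  then have "AE p in lborel. p \<in> N \<longrightarrow> snd p - fst p \<notin> UNIV \<and> - snd p - fst p \<notin> UNIV" by simp
  then have N0: "AE x in LI. (AE s in lborel. char_pt (x, Xi) s \<notin> N) \<and> (AE s in lborel. char_pt (x, Eta) s \<notin> N)"
    using AE_plane_characteristics_iff[OF N H(4), of UNIV] by simp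
  have pos: "line_measure (x, \<sigma>) (G \<inter> char_pt (x, \<sigma>) ` {0..T}) > 0 \<longleftrightarrow> \<not> (AE s in lborel. char_pt (x, \<sigma>) s \<notin> H)"
    if "AE s in lborel. char_pt (x, \<sigma>) s \<notin> N" for x \<sigma>
  proof -
    let ?X = "{s. 0 \<le> s \<and> char_pt (x, \<sigma>) s \<in> G \<inter> char_pt (x, \<sigma>) ` {0..T}}"
    have fst: "fst (char_pt (x, \<sigma>) s) = s" for s by (cases \<sigma>) auto
    have X: "?X = {s. char_pt (x, \<sigma>) s \<in> G}" 
    proof (intro Collect_cong iffI)
      fix s assume s: "char_pt (x, \<sigma>) s \<in> G"
      then have "s \<in> {0..T}" using G(2) fst[of s] by (metis SigmaE fst_conv subsetD)
      with s show "0 \<le> s \<and> char_pt (x, \<sigma>) s \<in> G \<inter> char_pt (x, \<sigma>) ` {0..T}" by auto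
    qed simp
    have ae: "AE s in lebesgue. s \<in> {s. char_pt (x, \<sigma>) s \<in> H} \<longleftrightarrow> s \<in> ?X"
      using that unfolding AE_completion_iff X by eventually_elim (use H in auto)
    have Xm: "?X \<in> sets lebesgue"
      by (rule completion.in_sets_AE[OF ae]) (use meas in auto)
    have "emeasure lebesgue ?X = emeasure lebesgue {s. char_pt (x, \<sigma>) s \<in> H}"
      using ae Xm meas by (intro emeasure_eq_AE) auto
    also have "\<dots> = emeasure lborel {s. char_pt (x, \<sigma>) s \<in> H}" using meas by simp
    finally have e: "emeasure lebesgue ?X = emeasure lborel {s. char_pt (x, \<sigma>) s \<in> H}" .
    have "(AE s in lborel. char_pt (x, \<sigma>) s \<notin> H) \<longleftrightarrow> emeasure lborel {s. char_pt (x, \<sigma>) s \<in> H} = 0"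
      using meas by (subst AE_iff_measurable[OF _ refl]) auto
    then show ?thesis unfolding line_measure_def e by (auto simp: ennreal_zero_less_mult_iff zero_less_iff_neq_zero)
  qed
  have closed_unit: "(AE x in lebesgue_on {0..1}. P x) \<longleftrightarrow> (AE x in LI. P x)" for P :: "real \<Rightarrow> bool"
  proof -
    have "AE x in lborel. x \<in> {0..1::real} \<longleftrightarrow> x \<in> I01"
      using AE_lborel_singleton[of "0::real"] AE_lborel_singleton[of "1::real"]
      by eventually_elim auto
    then have "(AE x in lborel. x \<in> {0..1} \<longrightarrow> P x) \<longleftrightarrow> (AE x in lborel. x \<in> I01 \<longrightarrow> P x)"
      by (auto elim: AE_mp)
    then show ?thesis by (simp add: AE_LI_iff_lborel AE_restrict_space_iff AE_completion_iff)
  qed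
  show ?thesis
    unfolding weak_GCC_def closed_unit
  proof (rule AE_iff_cong)
    show "AE x in LI. (line_measure (x, Eta) (G \<inter> char_pt (x, Eta) ` {0..T}) > 0 \<and> line_measure (x, Xi) (G \<inter> char_pt (x, Xi) ` {0..T}) > 0)
        \<longleftrightarrow> (\<not> (AE s in lborel. char_pt (x, Xi) s \<notin> H) \<and> \<not> (AE s in lborel. char_pt (x, Eta) s \<notin> H))"
      using N0
    proof eventually_elim
      case (elim x)
      then show ?case using pos[of x Xi] pos[of x Eta] by blast
    qed
  qed
qed

text \<open>By Fubini almost every characteristic starting in \<open>N\<close> would miss
  \<open>G\<close> at almost all times. (Weak GCC) excludes this for almost every starting point, so
  \<open>N\<close> is null.\<close>

lemma weak_GCC_imp_AE:
  assumes gcc: "weak_GCC T G" and N[measurable]: "N \<in> sets borel" and per: "\<And>y. y + 2 \<in> N \<longleftrightarrow> y \<in> N"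
    and ae: "AE p in lebesgue. p \<in> G \<longrightarrow> snd p - fst p \<notin> N \<and> - snd p - fst p \<notin> N"
  shows "AE x in LI. x \<notin> N \<and> - x \<notin> N"
proof -
  obtain H M where H: "H \<in> sets borel" "H \<subseteq> G" "M \<in> null_sets lborel" "M \<subseteq> UNIV \<times> I01" "G \<subseteq> H \<union> M"
    by (rule borel_core)
  have HI: "H \<subseteq> UNIV \<times> I01" using H(2) G(2) by auto
  have "AE p in lborel. p \<in> H \<longrightarrow> snd p - fst p \<notin> N \<and> - snd p - fst p \<notin> N"
    by (subst AE_G_iff[OF H(2,3,5)]) (rule ae)
  with AE_plane_characteristics_iff[OF H(1) HI N per]
  have "AE x in LI. (x \<in> N \<longrightarrow> (AE s in lborel. char_pt (x, Xi) s \<notin> H)) \<and> (- x \<in> N \<longrightarrow> (AE s in lborel. char_pt (x, Eta) s \<notin> H))"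
    by blast
  moreover have "AE x in LI. \<not> (AE s in lborel. char_pt (x, Xi) s \<notin> H) \<and> \<not> (AE s in lborel. char_pt (x, Eta) s \<notin> H)"
    using gcc weak_GCC_iff[OF H] by blast
  ultimately show ?thesis by eventually_elim auto
qed

lemma not_weak_GCC_imp_unobserved:
  assumes "\<not> weak_GCC T G"
  obtains Z where "Z \<in> sets borel" "\<And>y. y + 2 \<in> Z \<longleftrightarrow> y \<in> Z"
    "AE p in lebesgue. p \<in> G \<longrightarrow> snd p - fst p \<notin> Z \<and> - snd p - fst p \<notin> Z"
    "\<not> (AE x in LI. x \<notin> Z \<and> - x \<notin> Z)"
proof -
  obtain H M where H: "H \<in> sets borel" "H \<subseteq> G" "M \<in> null_sets lborel" "M \<subseteq> UNIV \<times> I01" "G \<subseteq> H \<union> M"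
    by (rule borel_core)
  have HI: "H \<subseteq> UNIV \<times> I01" using H(2) G(2) by auto
  have [measurable]: "H \<in> sets (borel \<Otimes>\<^sub>M borel)" unfolding borel_prod by (rule H(1))
  \<comment> \<open>The starting points on the circle whose characteristic spends no time in the
    Borel core.\<close>
  define Z where "Z = {y. emeasure lborel {s. (s, folding (y + s)) \<in> H} = 0}"
  have sec: "{s. (s, folding (y + s)) \<in> H} \<in> sets borel" for y
  proof -
    have "Measurable.pred borel (\<lambda>s. (s, folding (y + s)) \<in> H)" by measurable
    then show ?thesis by (simp add: pred_def)
  qed
  have Z: "y \<in> Z \<longleftrightarrow> (AE s in lborel. (s, folding (y + s)) \<notin> H)" for y
    unfolding Z_def using sec by (subst AE_iff_measurable[OF _ refl]) auto
  \<comment> \<open>\<open>H\<close> is pulled back to the coordinates (starting point, time); the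
    length of a section is then a measurable function of the starting point.\<close>
  have "(\<lambda>y. emeasure lborel (Pair y -` {q \<in> space (borel \<Otimes>\<^sub>M lborel). (snd q, folding (fst q + snd q)) \<in> H})) \<in> borel_measurable borel"
    by (rule lborel.measurable_emeasure_Pair) measurable
  then have "(\<lambda>y. emeasure lborel {s. (s, folding (y + s)) \<in> H}) \<in> borel_measurable borel"
    by (simp add: vimage_def space_pair_measure)
  then have Zm: "Z \<in> sets borel" unfolding Z_def by measurable
  have per: "y + 2 \<in> Z \<longleftrightarrow> y \<in> Z" for y
  proof -
    have "folding (y + 2 + s) = folding (y + s)" for s using folding_periodic[of "y + s"] by (simp add: ac_simps)
    then show ?thesis by (simp add: Z)
  qed
  have sec_iff: "x \<in> Z \<longleftrightarrow> (AE s in lborel. char_pt (x, Xi) s \<notin> H)" "- x \<in> Z \<longleftrightarrow> (AE s in lborel. char_pt (x, Eta) s \<notin> H)" for x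
  proof -
    have "folding (s - x) = folding (x - s)" for s using folding_minus[of "x - s"] by simp
    then show "x \<in> Z \<longleftrightarrow> (AE s in lborel. char_pt (x, Xi) s \<notin> H)" "- x \<in> Z \<longleftrightarrow> (AE s in lborel. char_pt (x, Eta) s \<notin> H)"
      by (simp_all add: Z)
  qed
  have "AE p in lborel. p \<in> H \<longrightarrow> snd p - fst p \<notin> Z \<and> - snd p - fst p \<notin> Z"
    unfolding AE_plane_characteristics_iff[OF H(1) HI Zm per] by (intro AE_I2) (use sec_iff in blast)
  then have "AE p in lebesgue. p \<in> G \<longrightarrow> snd p - fst p \<notin> Z \<and> - snd p - fst p \<notin> Z"
    by (subst (asm) AE_G_iff[OF H(2,3,5)])
  moreover have "\<not> (AE x in LI. x \<notin> Z \<and> - x \<notin> Z)"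
    using assms unfolding weak_GCC_iff[OF H] sec_iff[symmetric] .
  ultimately show thesis using that Zm per by blast
qed

end

subsection \<open>Observable symmetry in terms of periodic sets\<close>

lemma label_UNIV: "UNIV = {Xi, Eta}"
  using label.exhaust by auto

lemma space_cover: "space cover = I01 \<times> UNIV"
  by (simp add: cover_def space_pair_measure)

lemma cover_subset: "A \<in> sets cover \<Longrightarrow> A \<subseteq> I01 \<times> UNIV"
  using sets.sets_into_space[of A cover] by (simp add: space_cover)

lemma cover_section: "A \<in> sets cover \<Longrightarrow> {x. (x, \<sigma>) \<in> A} \<in> sets LI"
  using sets_Pair2[of A LI "count_space UNIV" \<sigma>] by (simp add: cover_def vimage_def)

lemma sets_coverI:
  assumes "A \<subseteq> I01 \<times> UNIV" "\<And>\<sigma>. {x. (x, \<sigma>) \<in> A} \<in> sets LI"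
  shows "A \<in> sets cover"
proof -
  have "{x. (x, Xi) \<in> A} \<times> {Xi} \<union> {x. (x, Eta) \<in> A} \<times> {Eta} \<in> sets cover"
    unfolding cover_def using assms(2) by (intro sets.Un pair_measureI) auto
  also have "{x. (x, Xi) \<in> A} \<times> {Xi} \<union> {x. (x, Eta) \<in> A} \<times> {Eta} = A"
    using label_UNIV by (auto simp: set_eq_iff) (metis label.exhaust)+
  finally show ?thesis .
qed

lemma emeasure_cover:
  assumes "A \<in> sets cover"
  shows "emeasure cover A = emeasure LI {x. (x, Xi) \<in> A} + emeasure LI {x. (x, Eta) \<in> A}"
proof -
  interpret C: sigma_finite_measure "count_space (UNIV :: label set)"
    by (rule sigma_finite_measure_count_space_finite) (simp add: label_UNIV)
  interpret P: pair_sigma_finite LI "count_space (UNIV :: label set)" ..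
  have "emeasure cover A = (\<integral>\<^sup>+\<sigma>. emeasure LI ((\<lambda>x. (x, \<sigma>)) -` A) \<partial>count_space UNIV)"
    using assms unfolding cover_def by (rule P.emeasure_pair_measure_alt2)
  also have "\<dots> = (\<Sum>\<sigma>\<in>UNIV. emeasure LI ((\<lambda>x. (x, \<sigma>)) -` A))"
    by (rule nn_integral_count_space_finite) (simp add: label_UNIV)
  finally show ?thesis by (simp add: label_UNIV vimage_def)
qed

lemma cover_null_iff:
  assumes "A \<in> sets cover"
  shows "emeasure cover A = 0 \<longleftrightarrow> (AE x in LI. (x, Xi) \<notin> A \<and> (x, Eta) \<notin> A)"
proof -
  have sub: "x \<in> I01" if "(x, \<sigma>) \<in> A" for x \<sigma> using cover_subset[OF assms] that by auto
  have "emeasure LI {x. (x, \<sigma>) \<in> A} = 0 \<longleftrightarrow> (AE x in LI. (x, \<sigma>) \<notin> A)" for \<sigma>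
  proof (rule AE_iff_measurable[symmetric])
    show "{x. (x, \<sigma>) \<in> A} \<in> sets LI" by (rule cover_section[OF assms])
    show "{x \<in> space LI. \<not> (x, \<sigma>) \<notin> A} = {x. (x, \<sigma>) \<in> A}" using sub by auto
  qed
  then show ?thesis by (simp add: emeasure_cover[OF assms])
qed

lemma cover_full_iff:
  assumes A: "A \<in> sets cover"
  shows "emeasure cover A = 2 \<longleftrightarrow> (AE x in LI. (x, Xi) \<in> A \<and> (x, Eta) \<in> A)"
proof -
  have S: "space cover \<in> sets cover" by simp
  have B: "space cover - A \<in> sets cover" using A by auto
  have "{x. (x, \<sigma>) \<in> space cover} = I01" for \<sigma> by (auto simp: space_cover)
  then have 2: "emeasure cover (space cover) = 2"
    unfolding emeasure_cover[OF S] by (simp add: emeasure_restrict_space one_add_one)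
  have fin: "emeasure cover A \<noteq> \<infinity>"
    using emeasure_mono[OF sets.sets_into_space[OF A] S] by (auto simp: 2 top_unique)
  have eq: "emeasure cover (space cover - A) = 2 - emeasure cover A"
    using emeasure_compl[OF A fin] by (simp add: 2)
  have le: "emeasure cover A \<le> 2"
    using emeasure_mono[OF sets.sets_into_space[OF A] S] by (simp add: 2)
  have "emeasure cover A = 2 \<longleftrightarrow> emeasure cover (space cover - A) = 0"
    unfolding eq using le by (auto simp: diff_eq_0_iff_ennreal dest: antisym)
  also have "\<dots> \<longleftrightarrow> (AE x in LI. (x, Xi) \<notin> space cover - A \<and> (x, Eta) \<notin> space cover - A)"
    by (rule cover_null_iff[OF B])
  also have "\<dots> \<longleftrightarrow> (AE x in LI. (x, Xi) \<in> A \<and> (x, Eta) \<in> A)"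
    by (intro AE_cong) (auto simp: space_cover)
  finally show ?thesis .
qed

definition label_set :: "real set \<Rightarrow> (real \<times> label) set" where
  "label_set S = {(x, \<sigma>). x \<in> I01 \<and> (case \<sigma> of Xi \<Rightarrow> x \<in> S | Eta \<Rightarrow> - x \<in> S)}"

lemma label_set_cover:
  assumes "S \<in> sets borel" shows "label_set S \<in> sets cover"
proof (rule sets_coverI)
  show "label_set S \<subseteq> I01 \<times> UNIV" by (auto simp: label_set_def)
  fix \<sigma>
  have b: "X \<inter> I01 \<in> sets LI" if "X \<in> sets borel" for X
    using that by (auto simp: sets_restrict_space)
  have "(\<lambda>x::real. - x) -` S \<in> sets borel"
    using measurable_sets[of "\<lambda>x::real. - x" borel borel S] assms by simp
  then have "S \<inter> I01 \<in> sets LI" "(\<lambda>x. - x) -` S \<inter> I01 \<in> sets LI"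
    using b assms by auto
  moreover have "{x. (x, Xi) \<in> label_set S} = S \<inter> I01" "{x. (x, Eta) \<in> label_set S} = (\<lambda>x. - x) -` S \<inter> I01"
    by (auto simp: label_set_def)
  ultimately show "{x. (x, \<sigma>) \<in> label_set S} \<in> sets LI" by (cases \<sigma>) simp_all
qed

lemma periodic_set_wrap:
  assumes "\<And>y. y + 2 \<in> S \<longleftrightarrow> y \<in> S" shows "wrap y \<in> S \<longleftrightarrow> y \<in> S"
proof -
  obtain n where "wrap y = y + 2 * of_int n" by (rule wrap_cases)
  then show ?thesis using periodic_add_int[of "\<lambda>y. y \<in> S" y n] assms by simp
qed

lemma lift_mem_label_set:
  assumes per: "\<And>y. y + 2 \<in> S \<longleftrightarrow> y \<in> S" and y: "lift y \<in> I01 \<times> UNIV"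
  shows "lift y \<in> label_set S \<longleftrightarrow> y \<in> S"
  using y periodic_set_wrap[OF per, of y] by (auto simp: label_set_def lift_def split: if_splits)

lemma mem_label_set_I01:
  assumes "x \<in> I01"
  shows "(x, Xi) \<in> label_set S \<longleftrightarrow> x \<in> S" "(x, Eta) \<in> label_set S \<longleftrightarrow> - x \<in> S"
  using assms by (auto simp: label_set_def)

lemma lift_regular_iff: "lift y \<in> I01 \<times> UNIV \<longleftrightarrow> wrap y \<noteq> 0 \<and> wrap y \<noteq> - 1"
  using wrap_bounds[of y] by (auto simp: lift_def)

text \<open>The circle points 0 and 1 correspond to the ends of the interval and carry no label of
  the open cover. The points of the plane reached from them form a null set, off which
  \<open>lift\<close> really lands in the cover.\<close>

lemma AE_plane_lift_regular:
  "AE p in lborel. snd p \<in> I01 \<longrightarrow> lift (snd p - fst p) \<in> I01 \<times> UNIV \<and> lift (- snd p - fst p) \<in> I01 \<times> UNIV"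
proof (rule AE_plane_unfold)
  show "Measurable.pred borel (\<lambda>y. lift y \<in> I01 \<times> UNIV)"
    unfolding lift_regular_iff by measurable
  show "AE x in LI. lift x \<in> I01 \<times> UNIV \<and> lift (- x) \<in> I01 \<times> UNIV"
    by (intro AE_I2) (simp add: lift_I01)
qed (simp add: lift_periodic)

text \<open>Profiles have to be Borel functions on the circle, whereas a set in the cover is only
  Lebesgue measurable on each label. Each label is replaced by a Borel set up to a null set, and
  \<open>AE_plane_unfold\<close> carries the agreement to the plane.\<close>

lemma cover_borel_representative:
  assumes A: "A \<in> sets cover"
  obtains S where "S \<in> sets borel" "\<And>y. y + 2 \<in> S \<longleftrightarrow> y \<in> S"
    "AE x in LI. (x \<in> S \<longleftrightarrow> (x, Xi) \<in> A) \<and> (- x \<in> S \<longleftrightarrow> (x, Eta) \<in> A)"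
    "AE p in lborel. snd p \<in> I01 \<longrightarrow> (snd p - fst p \<in> S \<longleftrightarrow> lift (snd p - fst p) \<in> A) \<and>
      (- snd p - fst p \<in> S \<longleftrightarrow> lift (- snd p - fst p) \<in> A)"
proof -
  have "\<exists>B N. B \<in> sets borel \<and> N \<in> null_sets lborel \<and> (\<forall>x. x \<notin> N \<longrightarrow> (x \<in> B \<longleftrightarrow> (x, \<sigma>) \<in> A))" for \<sigma>
  proof -
    have "{x. (x, \<sigma>) \<in> A} \<in> sets lebesgue"
      using cover_section[OF A, of \<sigma>] by (auto simp: sets_restrict_space_iff)
    then obtain S M N where "{x. (x, \<sigma>) \<in> A} = S \<union> M" "M \<subseteq> N" "N \<in> null_sets lborel" "S \<in> sets lborel"
      by (rule sets_completionE)
    then show ?thesis by (intro exI[of _ S] exI[of _ N]) auto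
  qed
  then obtain B N where B[measurable]: "\<And>\<sigma>. B \<sigma> \<in> sets borel" and N: "\<And>\<sigma>. N \<sigma> \<in> null_sets lborel"
    and BN: "\<And>\<sigma> x. x \<notin> N \<sigma> \<Longrightarrow> x \<in> B \<sigma> \<longleftrightarrow> (x, \<sigma>) \<in> A" by metis
  have [measurable]: "N \<sigma> \<in> sets borel" for \<sigma> using N[of \<sigma>] by auto
  define S where "S = {y. (wrap y > 0 \<and> wrap y \<in> B Xi) \<or> (wrap y \<le> 0 \<and> - wrap y \<in> B Eta)}"
  have Sm: "S \<in> sets borel" unfolding S_def by measurable
  have Sp: "y + 2 \<in> S \<longleftrightarrow> y \<in> S" for y by (simp add: S_def wrap_periodic)
  \<comment> \<open>Both exceptional sets are avoided at the folded point, so the condition need not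
    distinguish the labels.\<close>
  define P where "P y \<longleftrightarrow> \<bar>wrap y\<bar> \<notin> N Xi \<and> \<bar>wrap y\<bar> \<notin> N Eta" for y
  have P: "y \<in> S \<longleftrightarrow> lift y \<in> A" if "P y" for y
    using that BN by (auto simp: P_def S_def lift_def)
  have "AE x in lborel. x \<notin> N Xi" "AE x in lborel. x \<notin> N Eta" using N by (auto intro: AE_not_in)
  then have ae: "AE x in LI. P x \<and> P (- x)"
    unfolding AE_LI_iff_lborel by eventually_elim (auto simp: P_def wrap_id)
  have "AE x in LI. x \<in> I01" by (rule AE_I2) simp
  with ae have 1: "AE x in LI. (x \<in> S \<longleftrightarrow> (x, Xi) \<in> A) \<and> (- x \<in> S \<longleftrightarrow> (x, Eta) \<in> A)"
  proof eventually_elim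
    case (elim x)
    then show ?case using P[of x] P[of "- x"] lift_I01[of x] by simp
  qed
  have "AE p in lborel. snd p \<in> I01 \<longrightarrow> P (snd p - fst p) \<and> P (- snd p - fst p)"
  proof (rule AE_plane_unfold[OF _ _ ae])
    show "Measurable.pred borel P" unfolding P_def[abs_def] by measurable
    show "P (y + 2) = P y" for y by (simp add: P_def wrap_periodic)
  qed
  then have 2: "AE p in lborel. snd p \<in> I01 \<longrightarrow> (snd p - fst p \<in> S \<longleftrightarrow> lift (snd p - fst p) \<in> A) \<and>
      (- snd p - fst p \<in> S \<longleftrightarrow> lift (- snd p - fst p) \<in> A)"
    by eventually_elim (use P in blast)
  show thesis using that[OF Sm Sp 1 2] .
qed

lemma LI_not_AE_False: "\<not> (AE x in LI. False)"
proof
  assume "AE x in LI. False"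
  then have "emeasure LI (space LI) = 0" by (subst (asm) AE_iff_measurable[of I01]) auto
  then show False by (simp add: emeasure_restrict_space)
qed

context observation_set
begin

lemma G_snd: "p \<in> G \<Longrightarrow> snd p \<in> I01" and G_fst: "p \<in> G \<Longrightarrow> 0 \<le> fst p \<and> fst p \<le> T"
  using G(2) by auto

text \<open>Lying in one of the two intersection sets means that both labels are in \<open>A\<close>
  or both are in its complement. The complement is taken inside the cover, so the equivalence is
  claimed only off the null set of irregular points.\<close>

lemma observable_symmetric_D_iff:
  assumes A: "A \<in> sets cover"
  shows "observable_symmetric_D T G A \<longleftrightarrow>
    (AE p in lebesgue. p \<in> G \<longrightarrow> (lift (snd p - fst p) \<in> A \<longleftrightarrow> lift (- snd p - fst p) \<in> A))"
proof -
  let ?X = "G - (M_upto A T \<union> M_upto (space cover - A) T)"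
  have "observable_symmetric_D T G A \<longleftrightarrow> (AE p in lebesgue. p \<notin> ?X)"
    unfolding observable_symmetric_D_def completion.null_sets_iff_AE by simp
  also have "\<dots> \<longleftrightarrow> (AE p in lebesgue. p \<in> G \<longrightarrow> (lift (snd p - fst p) \<in> A \<longleftrightarrow> lift (- snd p - fst p) \<in> A))"
  proof (rule AE_iff_cong)
    show "AE p in lebesgue. p \<notin> ?X \<longleftrightarrow> (p \<in> G \<longrightarrow> (lift (snd p - fst p) \<in> A \<longleftrightarrow> lift (- snd p - fst p) \<in> A))"
      using AE_completion[OF AE_plane_lift_regular]
    proof eventually_elim
      case (elim p)
      show ?case
      proof (cases "p \<in> G")
        case True
        obtain t x where p: "p = (t, x)" by (cases p)
        have x: "x \<in> I01" "0 \<le> t" "t \<le> T" using G_snd[OF True] G_fst[OF True] by (auto simp: p)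
        have "p \<in> M_upto C T \<longleftrightarrow> lift (x - t) \<in> C \<and> lift (- x - t) \<in> C" if "C \<subseteq> I01 \<times> UNIV" for C
          using M_set_iff[OF x(1,2) that] x by (simp add: M_upto_def p)
        from this[of A] this[of "space cover - A"] show ?thesis
          using True elim x cover_subset[OF A] by (auto simp: p space_cover)
      qed simp
    qed
  qed
  finally show ?thesis .
qed

lemma observable_symmetric_N_iff:
  assumes E: "E \<in> sets cover" and F: "F \<in> sets cover"
  shows "observable_symmetric_N T G E F \<longleftrightarrow>
    (AE p in lebesgue. p \<in> G \<longrightarrow> (let a = lift (snd p - fst p); b = lift (- snd p - fst p) in
      (a \<in> E \<and> b \<in> F) \<or> (a \<in> F \<and> b \<in> E) \<or> (a \<notin> E \<union> F \<and> b \<notin> E \<union> F)))"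
proof -
  let ?X = "G - (W_upto E F T \<union> M_upto (space cover - (E \<union> F)) T)"
  let ?R = "\<lambda>p. let a = lift (snd p - fst p); b = lift (- snd p - fst p) in
      (a \<in> E \<and> b \<in> F) \<or> (a \<in> F \<and> b \<in> E) \<or> (a \<notin> E \<union> F \<and> b \<notin> E \<union> F)"
  have "observable_symmetric_N T G E F \<longleftrightarrow> (AE p in lebesgue. p \<notin> ?X)"
    unfolding observable_symmetric_N_def completion.null_sets_iff_AE by simp
  also have "\<dots> \<longleftrightarrow> (AE p in lebesgue. p \<in> G \<longrightarrow> ?R p)"
  proof (rule AE_iff_cong)
    show "AE p in lebesgue. p \<notin> ?X \<longleftrightarrow> (p \<in> G \<longrightarrow> ?R p)"
      using AE_completion[OF AE_plane_lift_regular]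
    proof eventually_elim
      case (elim p)
      show ?case
      proof (cases "p \<in> G")
        case True
        obtain t x where p: "p = (t, x)" by (cases p)
        have x: "x \<in> I01" "0 \<le> t" "t \<le> T" using G_snd[OF True] G_fst[OF True] by (auto simp: p)
        have "p \<in> M_upto C T \<longleftrightarrow> lift (x - t) \<in> C \<and> lift (- x - t) \<in> C" if "C \<subseteq> I01 \<times> UNIV" for C
          using M_set_iff[OF x(1,2) that] x by (simp add: M_upto_def p)
        then have 1: "p \<in> M_upto (space cover - (E \<union> F)) T \<longleftrightarrow> lift (x - t) \<in> space cover - (E \<union> F) \<and> lift (- x - t) \<in> space cover - (E \<union> F)"
          by (auto simp: space_cover)
        have 2: "p \<in> W_upto E F T \<longleftrightarrow> (lift (x - t) \<in> E \<and> lift (- x - t) \<in> F) \<or> (lift (x - t) \<in> F \<and> lift (- x - t) \<in> E)"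
          using W_set_iff[OF x(1,2) cover_subset[OF E] cover_subset[OF F]] x by (simp add: W_upto_def p)
        have 3: "lift (x - t) \<in> space cover" "lift (- x - t) \<in> space cover"
          using elim x(1) by (simp_all only: space_cover p fst_conv snd_conv)
        show ?thesis using True 1 2 3 unfolding Let_def p fst_conv snd_conv by blast
      qed simp
    qed
  qed
  finally show ?thesis .
qed

subsection \<open>From observability to the geometric conditions\<close>

abbreviation D_unique :: bool where
  "D_unique \<equiv> \<forall>u0\<in>H10. \<forall>u1\<in>L2. \<forall>u ut. weak_wave_solution H10 T u0 u1 u ut \<and> vanishes_ae_on T G ut \<longrightarrow>
    (\<forall>t\<in>{0..T}. AE x in LI. u t x = 0)"

abbreviation N_unique :: bool where
  "N_unique \<equiv> \<forall>u0\<in>H1. \<forall>u1\<in>L2. \<forall>u ut. weak_wave_solution H1 T u0 u1 u ut \<and> vanishes_ae_on T G ut \<longrightarrow>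
    (\<exists>c. \<forall>t\<in>{0..T}. AE x in LI. u t x = c)"

lemma rectangle_lebesgue: "{0..T} \<times> I01 \<in> sets lebesgue"
proof -
  have "{0..T} \<times> I01 \<in> sets (borel \<Otimes>\<^sub>M borel)" by (intro pair_measureI) auto
  then have "{0..T} \<times> I01 \<in> sets borel" unfolding borel_prod .
  then show ?thesis by simp
qed

lemma profile_vanishes:
  assumes "periodic_profile g B"
    and ae: "AE p in lebesgue. p \<in> G \<longrightarrow> g (- snd p - fst p) + \<kappa> * g (snd p - fst p) = 0"
  shows "vanishes_ae_on T G (periodic_profile.wave_v g \<kappa>)"
proof -
  interpret periodic_profile g B by fact
  have "(\<lambda>p. wave_v \<kappa> (fst p) (snd p)) \<in> borel_measurable (borel \<Otimes>\<^sub>M borel)"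
    unfolding wave_v_def by measurable
  then have "(\<lambda>p. wave_v \<kappa> (fst p) (snd p)) \<in> borel_measurable borel"
    unfolding borel_prod .
  then have "(\<lambda>p. wave_v \<kappa> (fst p) (snd p)) \<in> borel_measurable (lebesgue_on ({0..T} \<times> I01))"
    by (intro measurable_restrict_space1 measurable_completion) simp
  moreover have "AE p in lebesgue_on ({0..T} \<times> I01). p \<in> G \<longrightarrow> wave_v \<kappa> (fst p) (snd p) = 0"
    using ae rectangle_lebesgue by (subst AE_restrict_space_iff) (auto simp: wave_v_def elim: AE_mp)
  ultimately show ?thesis
    unfolding vanishes_ae_on_def by (intro bexI[of _ "\<lambda>p. wave_v \<kappa> (fst p) (snd p)"]) auto
qed

text \<open>The profile is the indicator minus its mean: mean zero gives the Dirichlet condition,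
  and the velocity, a difference of two values of the profile, does not feel the constant.
  Uniqueness makes the indicator almost everywhere equal to its mean \<open>m\<close>, so
  \<open>m\<close> is 0 or 1.\<close>

lemma D_unique_periodic_set:
  assumes D: D_unique and S[measurable]: "S \<in> sets borel" and per: "\<And>y. y + 2 \<in> S \<longleftrightarrow> y \<in> S"
    and ae: "AE p in lebesgue. p \<in> G \<longrightarrow> (snd p - fst p \<in> S \<longleftrightarrow> - snd p - fst p \<in> S)"
  shows "(AE x in LI. x \<in> S \<and> - x \<in> S) \<or> (AE x in LI. x \<notin> S \<and> - x \<notin> S)"
proof -
  \<comment> \<open>Division by 2, the length of a period.\<close>
  define m where "m = (LBINT z=ereal (-1)..ereal 1. indicator S z :: real) / 2"
  define g where "g y = indicator S y - m" for y :: real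
  have prof: "periodic_profile g (1 + \<bar>m\<bar>)"
  proof
    show "g \<in> borel_measurable borel" unfolding g_def[abs_def] by measurable
    show "\<bar>g x\<bar> \<le> 1 + \<bar>m\<bar>" for x by (auto simp: g_def indicator_def)
    show "g (x + 2) = g x" for x using per by (simp add: g_def indicator_def)
  qed
  interpret periodic_profile g "1 + \<bar>m\<bar>" by (rule prof)
  have mean: "primitive g 1 = primitive g (-1)"
  proof -
    have "primitive g 1 - primitive g (-1) = (LBINT z=ereal (-1)..ereal 1. indicator S z - m)"
      by (simp add: G_diff g_def)
    also have "\<dots> = (LBINT z=ereal (-1)..ereal 1. indicator S z) - (LBINT z=ereal (-1)..ereal 1. m)"
      by (intro interval_lebesgue_integral_diff interval_lebesgue_integrable_bounded[where B = 1]
          interval_lebesgue_integrable_bounded[where B = "\<bar>m\<bar>"]) (auto simp: indicator_def)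
    also have "(LBINT z=ereal (-1)..ereal 1. m) = 2 * m"
      using interval_integral_const[of "-1" 1 m] by simp
    finally show ?thesis by (simp add: m_def)
  qed
  have sol: "weak_wave_solution H10 T (wave_u (-1) 0) (wave_v (-1) 0) (wave_u (-1)) (wave_v (-1))"
    by (rule dalembert_weak_solution) (use mean in auto)
  have van: "vanishes_ae_on T G (wave_v (-1))"
  proof (rule profile_vanishes[OF prof])
    show "AE p in lebesgue. p \<in> G \<longrightarrow> g (- snd p - fst p) + (-1) * g (snd p - fst p) = 0"
      using ae by eventually_elim (auto simp: g_def indicator_def)
  qed
  have "AE x in LI. wave_u (-1) t x = 0" if "t \<in> {0..T}" for t
    using D[rule_format, OF wave_u_H10[OF refl mean] wave_v_L2 conjI[OF sol van] that] .
  then have g0: "AE x in LI. g x = 0 \<and> g (- x) = 0"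
    by (intro stationary_imp_profile_0[OF T _ sol]) auto
  consider "m = 1" | "m = 0" | "m \<noteq> 1" "m \<noteq> 0" by blast
  then show ?thesis
  proof cases
    case 1
    have "AE x in LI. x \<in> S \<and> - x \<in> S"
      using g0 by eventually_elim (auto simp: g_def indicator_def 1 split: if_splits)
    then show ?thesis by blast
  next
    case 2
    have "AE x in LI. x \<notin> S \<and> - x \<notin> S"
      using g0 by eventually_elim (auto simp: g_def indicator_def 2 split: if_splits)
    then show ?thesis by blast
  next
    case 3
    have "AE x in LI. False"
      using g0 by eventually_elim (use 3 in \<open>auto simp: g_def indicator_def split: if_splits\<close>)
    then show ?thesis using LI_not_AE_False by blast
  qed
qed

text \<open>The profile takes the values 1, -1 and 0. It serves two purposes: with a symmetric pair
  it yields (OSC-N), with \<open>F\<close> empty it excludes unobserved characteristics.\<close>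

lemma N_unique_periodic_sets:
  assumes N: N_unique and E[measurable]: "E \<in> sets borel" and F[measurable]: "F \<in> sets borel"
    and per: "\<And>y. y + 2 \<in> E \<longleftrightarrow> y \<in> E" "\<And>y. y + 2 \<in> F \<longleftrightarrow> y \<in> F"
    and ae: "AE p in lebesgue. p \<in> G \<longrightarrow>
      indicator E (- snd p - fst p) - indicator F (- snd p - fst p) + (indicator E (snd p - fst p) - indicator F (snd p - fst p)) = (0::real)"
  shows "AE x in LI. indicator E x = (indicator F x :: real) \<and> indicator E (- x) = (indicator F (- x) :: real)"
proof -
  define g :: "real \<Rightarrow> real" where "g y = indicator E y - indicator F y" for y
  have prof: "periodic_profile g 1"
  proof
    show "g \<in> borel_measurable borel" unfolding g_def[abs_def] by measurable
    show "\<bar>g x\<bar> \<le> 1" for x by (auto simp: g_def indicator_def)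
    show "g (x + 2) = g x" for x using per by (simp add: g_def indicator_def)
  qed
  interpret periodic_profile g 1 by (rule prof)
  have sol: "weak_wave_solution H1 T (wave_u 1 0) (wave_v 1 0) (wave_u 1) (wave_v 1)"
    by (rule dalembert_weak_solution) auto
  have van: "vanishes_ae_on T G (wave_v 1)"
    by (rule profile_vanishes[OF prof]) (use ae in \<open>simp add: g_def\<close>)
  obtain c where "\<forall>t\<in>{0..T}. AE x in LI. wave_u 1 t x = c"
    using N[rule_format, OF has_weak_deriv_imp_H1[OF wave_u_weak_deriv] wave_v_L2 conjI[OF sol van]] by blast
  then have "AE x in LI. g x = 0 \<and> g (- x) = 0"
    by (intro stationary_imp_profile_0[OF T _ sol, of c]) auto
  then show ?thesis by eventually_elim (auto simp: g_def)
qed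

lemma D_unique_imp_OSC_D:
  assumes D: D_unique shows "OSC_D T G"
  unfolding OSC_D_def
proof (intro ballI impI notI)
  fix A assume A: "A \<in> sets cover" "\<not> trivial_set A" "observable_symmetric_D T G A"
  obtain S where S: "S \<in> sets borel" "\<And>y. y + 2 \<in> S \<longleftrightarrow> y \<in> S"
    "AE x in LI. (x \<in> S \<longleftrightarrow> (x, Xi) \<in> A) \<and> (- x \<in> S \<longleftrightarrow> (x, Eta) \<in> A)"
    "AE p in lborel. snd p \<in> I01 \<longrightarrow> (snd p - fst p \<in> S \<longleftrightarrow> lift (snd p - fst p) \<in> A) \<and>
      (- snd p - fst p \<in> S \<longleftrightarrow> lift (- snd p - fst p) \<in> A)"
    by (rule cover_borel_representative[OF A(1)]) (rule that)
  have "AE p in lebesgue. p \<in> G \<longrightarrow> (lift (snd p - fst p) \<in> A \<longleftrightarrow> lift (- snd p - fst p) \<in> A)"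
    using A observable_symmetric_D_iff by blast
  with AE_completion[OF S(4)]
  have "AE p in lebesgue. p \<in> G \<longrightarrow> (snd p - fst p \<in> S \<longleftrightarrow> - snd p - fst p \<in> S)"
    by eventually_elim (use G_snd in blast)
  from D_unique_periodic_set[OF D S(1,2) this]
  show False
  proof
    assume "AE x in LI. x \<in> S \<and> - x \<in> S"
    with S(3) have "AE x in LI. (x, Xi) \<in> A \<and> (x, Eta) \<in> A" by eventually_elim blast
    then show False using A(2) cover_full_iff[OF A(1)] by (simp add: trivial_set_def)
  next
    assume "AE x in LI. x \<notin> S \<and> - x \<notin> S"
    with S(3) have "AE x in LI. (x, Xi) \<notin> A \<and> (x, Eta) \<notin> A" by eventually_elim blast
    then show False using A(2) cover_null_iff[OF A(1)] by (simp add: trivial_set_def)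
  qed
qed

text \<open>The unobserved set may be the whole circle, for instance when \<open>G\<close> is null,
  and its indicator then gives only the zero solution. So it is split by the sign of
  \<open>wrap\<close>: neither half can have full measure, hence both are null.\<close>

lemma D_unique_imp_weak_GCC:
  assumes D: D_unique shows "weak_GCC T G"
proof (rule ccontr)
  assume "\<not> weak_GCC T G"
  then obtain Z where Z[measurable]: "Z \<in> sets borel" and per: "\<And>y. y + 2 \<in> Z \<longleftrightarrow> y \<in> Z"
    and ae: "AE p in lebesgue. p \<in> G \<longrightarrow> snd p - fst p \<notin> Z \<and> - snd p - fst p \<notin> Z"
    and nn: "\<not> (AE x in LI. x \<notin> Z \<and> - x \<notin> Z)"
    by (rule not_weak_GCC_imp_unobserved) (rule that)
  have I: "AE x in LI. x \<in> I01" by (rule AE_I2) simp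
  define half where "half c = {y \<in> Z. c * wrap y > 0}" for c :: real
  have half: "AE x in LI. x \<notin> half c \<and> - x \<notin> half c" if c: "c = 1 \<or> c = -1" for c
  proof -
    have "(AE x in LI. x \<in> half c \<and> - x \<in> half c) \<or> (AE x in LI. x \<notin> half c \<and> - x \<notin> half c)"
    proof (rule D_unique_periodic_set[OF D])
      show "half c \<in> sets borel" unfolding half_def by measurable
      show "y + 2 \<in> half c \<longleftrightarrow> y \<in> half c" for y by (simp add: half_def per wrap_periodic)
      show "AE p in lebesgue. p \<in> G \<longrightarrow> (snd p - fst p \<in> half c \<longleftrightarrow> - snd p - fst p \<in> half c)"
        using ae by eventually_elim (auto simp: half_def)
    qed
    moreover have "\<not> (AE x in LI. x \<in> half c \<and> - x \<in> half c)"
    proof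
      assume "AE x in LI. x \<in> half c \<and> - x \<in> half c"
      with I have "AE x in LI. False"
        by eventually_elim (use c in \<open>auto simp: half_def wrap_id\<close>)
      then show False using LI_not_AE_False by blast
    qed
    ultimately show ?thesis by blast
  qed
  have "AE x in LI. x \<notin> Z \<and> - x \<notin> Z"
    using half[OF disjI1[OF refl]] half[OF disjI2[OF refl]] I by eventually_elim (auto simp: half_def wrap_id)
  with nn show False by blast
qed

text \<open>At a point of the symmetric region the profile values at the two labels are 1 and -1, or
  both 0, so the velocity vanishes. Uniqueness makes the indicators of two disjoint sets agree,
  which leaves \<open>E\<close> null.\<close>

lemma N_unique_imp_OSC_N:
  assumes N: N_unique shows "OSC_N T G"
  unfolding OSC_N_def
proof (intro ballI impI notI)
  fix E F assume E: "E \<in> sets cover" and F: "F \<in> sets cover"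
    and EF: "E \<inter> F = {} \<and> \<not> trivial_pair E F" and obs: "observable_symmetric_N T G E F"
  obtain S where S: "S \<in> sets borel" "\<And>y. y + 2 \<in> S \<longleftrightarrow> y \<in> S"
    "AE x in LI. (x \<in> S \<longleftrightarrow> (x, Xi) \<in> E) \<and> (- x \<in> S \<longleftrightarrow> (x, Eta) \<in> E)"
    "AE p in lborel. snd p \<in> I01 \<longrightarrow> (snd p - fst p \<in> S \<longleftrightarrow> lift (snd p - fst p) \<in> E) \<and>
      (- snd p - fst p \<in> S \<longleftrightarrow> lift (- snd p - fst p) \<in> E)"
    by (rule cover_borel_representative[OF E]) (rule that)
  obtain R where R: "R \<in> sets borel" "\<And>y. y + 2 \<in> R \<longleftrightarrow> y \<in> R"
    "AE x in LI. (x \<in> R \<longleftrightarrow> (x, Xi) \<in> F) \<and> (- x \<in> R \<longleftrightarrow> (x, Eta) \<in> F)"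
    "AE p in lborel. snd p \<in> I01 \<longrightarrow> (snd p - fst p \<in> R \<longleftrightarrow> lift (snd p - fst p) \<in> F) \<and>
      (- snd p - fst p \<in> R \<longleftrightarrow> lift (- snd p - fst p) \<in> F)"
    by (rule cover_borel_representative[OF F]) (rule that)
  have "AE p in lebesgue. p \<in> G \<longrightarrow> (let a = lift (snd p - fst p); b = lift (- snd p - fst p) in
      (a \<in> E \<and> b \<in> F) \<or> (a \<in> F \<and> b \<in> E) \<or> (a \<notin> E \<union> F \<and> b \<notin> E \<union> F))"
    using obs observable_symmetric_N_iff[OF E F] by blast
  with AE_completion[OF S(4)] AE_completion[OF R(4)]
  have "AE p in lebesgue. p \<in> G \<longrightarrow>
      indicator S (- snd p - fst p) - indicator R (- snd p - fst p) + (indicator S (snd p - fst p) - indicator R (snd p - fst p)) = (0::real)"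
  proof eventually_elim
    case (elim p)
    show ?case
    proof
      assume "p \<in> G"
      with elim G_snd[of p] EF show "indicator S (- snd p - fst p) - indicator R (- snd p - fst p) + (indicator S (snd p - fst p) - indicator R (snd p - fst p)) = (0::real)"
        unfolding Let_def indicator_def by auto
    qed
  qed
  from N_unique_periodic_sets[OF N S(1) R(1) S(2) R(2) this] S(3) R(3)
  have "AE x in LI. (x, Xi) \<notin> E \<and> (x, Eta) \<notin> E"
    by eventually_elim (use EF in \<open>auto simp: indicator_def split: if_splits\<close>)
  then show False using EF cover_null_iff[OF E] by (simp add: trivial_pair_def)
qed

text \<open>The indicator of the unobserved set is itself a Neumann profile whose waves never meet
  \<open>G\<close>, up to null sets; here the second set is empty.\<close>

lemma N_unique_imp_weak_GCC:
  assumes N: N_unique shows "weak_GCC T G"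
proof (rule ccontr)
  assume "\<not> weak_GCC T G"
  then obtain Z where Z: "Z \<in> sets borel" "\<And>y. y + 2 \<in> Z \<longleftrightarrow> y \<in> Z"
    and ae: "AE p in lebesgue. p \<in> G \<longrightarrow> snd p - fst p \<notin> Z \<and> - snd p - fst p \<notin> Z"
    and nn: "\<not> (AE x in LI. x \<notin> Z \<and> - x \<notin> Z)"
    by (rule not_weak_GCC_imp_unobserved) (rule that)
  have "AE x in LI. indicator Z x = (indicator {} x :: real) \<and> indicator Z (- x) = (indicator {} (- x) :: real)"
    by (rule N_unique_periodic_sets[OF N Z(1) _ Z(2)]) (use ae in \<open>auto elim: AE_mp\<close>)
  then have "AE x in LI. x \<notin> Z \<and> - x \<notin> Z"
    by eventually_elim (auto simp: indicator_def split: if_splits)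
  with nn show False by blast
qed

subsection \<open>From the geometric conditions to observability\<close>

text \<open>The representation of the velocity holds slice by slice, with an exceptional set for
  each time, while \<open>G\<close> is a set in the plane. Joint measurability of \<open>W\<close>
  bridges the gap through Fubini.\<close>

lemma observed_profile_relation:
  fixes g :: "real \<Rightarrow> real"
  assumes van: "vanishes_ae_on T G v" and [measurable]: "g \<in> borel_measurable borel"
    and rep: "\<And>t. t \<in> {0..T} \<Longrightarrow> AE x in LI. v t x = g (- x - t) + \<kappa> * g (x - t)"
  shows "AE p in lebesgue. p \<in> G \<longrightarrow> g (- snd p - fst p) + \<kappa> * g (snd p - fst p) = 0"
proof -
  let ?R = "{0..T} \<times> I01"
  obtain W where W: "W \<in> borel_measurable (lebesgue_on ?R)"
    "AE t in lebesgue_on {0..T}. AE x in LI. W (t, x) = v t x"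
    "AE p in lebesgue_on ?R. p \<in> G \<longrightarrow> W p = 0"
    using van by (auto simp: vanishes_ae_on_def)
  have "(\<lambda>p. if p \<in> ?R then W p else 0) \<in> borel_measurable lebesgue"
    using W(1) rectangle_lebesgue by (subst borel_measurable_if) auto
  \<comment> \<open>A Borel version of \<open>W\<close>, since the exchange of slices and plane is
    available for Borel predicates.\<close>
  then obtain W' where W'm: "W' \<in> borel_measurable lborel" and W': "AE p in lborel. (if p \<in> ?R then W p else 0) = W' p"
    using completion_ex_borel_measurable_real by blast
  have [measurable]: "W' \<in> borel_measurable (borel \<Otimes>\<^sub>M borel)" using W'm unfolding borel_prod by simp
  have "AE p in lborel \<Otimes>\<^sub>M lborel. (if p \<in> ?R then W p else 0) = W' p" using W' unfolding lborel_prod .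
  then have 1: "AE t in lborel. AE x in lborel. (if (t, x) \<in> ?R then W (t, x) else 0) = W' (t, x)"
    by (rule lborel_pair.AE_pair)
  have 2: "AE t in lborel. t \<in> {0..T} \<longrightarrow> (AE x in LI. W (t, x) = v t x)"
    using W(2) by (simp add: AE_restrict_space_iff AE_completion_iff)
  have "AE t in lborel. AE x in lborel. (t, x) \<in> ?R \<longrightarrow> W' (t, x) = g (- x - t) + \<kappa> * g (x - t)"
    using 1 2
  proof eventually_elim
    case (elim t)
    show ?case
    proof (cases "t \<in> {0..T}")
      case True
      with elim(2) have "AE x in LI. W (t, x) = v t x" by blast
      then have a: "AE x in lborel. x \<in> I01 \<longrightarrow> W (t, x) = v t x" unfolding AE_LI_iff_lborel .
      have "AE x in lborel. x \<in> I01 \<longrightarrow> v t x = g (- x - t) + \<kappa> * g (x - t)"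
        using rep[OF True] unfolding AE_LI_iff_lborel .
      with elim(1) a show ?thesis
        by eventually_elim (auto split: if_splits)
    qed auto
  qed
  then have "AE p in lborel. p \<in> ?R \<longrightarrow> W' p = g (- snd p - fst p) + \<kappa> * g (snd p - fst p)"
    using AE_plane_iff[of "\<lambda>t x. (t, x) \<in> ?R \<longrightarrow> W' (t, x) = g (- x - t) + \<kappa> * g (x - t)"] by simp
  from AE_completion[OF this] AE_completion[OF W']
  have 3: "AE p in lebesgue. p \<in> ?R \<longrightarrow> W p = g (- snd p - fst p) + \<kappa> * g (snd p - fst p)"
    by eventually_elim (auto split: if_splits)
  have "AE p in lebesgue. p \<in> ?R \<longrightarrow> p \<in> G \<longrightarrow> W p = 0"
    using W(3) rectangle_lebesgue by (subst (asm) AE_restrict_space_iff) auto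
  with 3 show ?thesis by eventually_elim (use G(2) in auto)
qed

text \<open>Each superlevel set is null or of full measure. The countably many rational levels share
  one exceptional null set, and a real number is determined by the rationals below it.\<close>

lemma OSC_D_imp_profile_const:
  fixes g :: "real \<Rightarrow> real"
  assumes osc: "OSC_D T G" and [measurable]: "g \<in> borel_measurable borel" and per: "\<And>y. g (y + 2) = g y"
    and rel: "AE p in lebesgue. p \<in> G \<longrightarrow> g (- snd p - fst p) = g (snd p - fst p)"
  obtains c where "AE x in LI. g x = c \<and> g (- x) = c"
proof -
  have level: "(AE x in LI. \<not> g x > q \<and> \<not> g (- x) > q) \<or> (AE x in LI. g x > q \<and> g (- x) > q)" for q
  proof -
    let ?S = "{y. g y > q}"
    have S: "?S \<in> sets borel" by measurable
    have Sp: "y + 2 \<in> ?S \<longleftrightarrow> y \<in> ?S" for y by (simp add: per)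
    note A = label_set_cover[OF S]
    have "observable_symmetric_D T G (label_set ?S)"
      unfolding observable_symmetric_D_iff[OF A]
      using rel AE_completion[OF AE_plane_lift_regular]
    proof eventually_elim
      case (elim p)
      show ?case
      proof
        assume p: "p \<in> G"
        then have "lift (snd p - fst p) \<in> I01 \<times> UNIV" "lift (- snd p - fst p) \<in> I01 \<times> UNIV"
          using elim(2) G_snd by blast+
        then show "lift (snd p - fst p) \<in> label_set ?S \<longleftrightarrow> lift (- snd p - fst p) \<in> label_set ?S"
          using elim(1) p by (simp add: lift_mem_label_set[OF Sp])
      qed
    qed
    with osc A have "trivial_set (label_set ?S)" by (auto simp: OSC_D_def)
    then have "(AE x in LI. (x, Xi) \<notin> label_set ?S \<and> (x, Eta) \<notin> label_set ?S) \<or> (AE x in LI. (x, Xi) \<in> label_set ?S \<and> (x, Eta) \<in> label_set ?S)"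
      unfolding trivial_set_def cover_null_iff[OF A] cover_full_iff[OF A] .
    moreover have "AE x in LI. x \<in> I01" by (rule AE_I2) simp
    ultimately show ?thesis
    proof (elim disjE)
      assume I: "AE x in LI. x \<in> I01" and a: "AE x in LI. (x, Xi) \<notin> label_set ?S \<and> (x, Eta) \<notin> label_set ?S"
      from I a have "AE x in LI. \<not> g x > q \<and> \<not> g (- x) > q"
        by eventually_elim (simp add: mem_label_set_I01)
      then show ?thesis ..
    next
      assume I: "AE x in LI. x \<in> I01" and a: "AE x in LI. (x, Xi) \<in> label_set ?S \<and> (x, Eta) \<in> label_set ?S"
      from I a have "AE x in LI. g x > q \<and> g (- x) > q"
        by eventually_elim (simp add: mem_label_set_I01)
      then show ?thesis ..
    qed
  qed
  define above where "above q \<longleftrightarrow> (AE x in LI. g x > q \<and> g (- x) > q)" for q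
  have "AE x in LI. (g x > q \<longleftrightarrow> above q) \<and> (g (- x) > q \<longleftrightarrow> above q)" for q
  proof (cases "above q")
    case True
    then have "AE x in LI. g x > q \<and> g (- x) > q" by (simp add: above_def)
    then show ?thesis by eventually_elim (use True in simp)
  next
    case False
    with level[of q] have "AE x in LI. \<not> g x > q \<and> \<not> g (- x) > q" unfolding above_def by blast
    then show ?thesis by eventually_elim (use False in simp)
  qed
  then have all: "AE x in LI. \<forall>q::rat. (g x > of_rat q \<longleftrightarrow> above (of_rat q)) \<and> (g (- x) > of_rat q \<longleftrightarrow> above (of_rat q))"
    by (subst AE_all_countable) blast
  \<comment> \<open>Any point outside the common null set will do; the value of \<open>g\<close>
    there becomes the constant.\<close>
  have "\<exists>x0. \<forall>q::rat. (g x0 > of_rat q \<longleftrightarrow> above (of_rat q))"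
  proof (rule ccontr)
    assume "\<nexists>x0. \<forall>q::rat. (g x0 > of_rat q \<longleftrightarrow> above (of_rat q))"
    then have no: "\<And>x. \<not> (\<forall>q::rat. (g x > of_rat q \<longleftrightarrow> above (of_rat q)))" by blast
    from all have "AE x in LI. False" by eventually_elim (use no in blast)
    then show False using LI_not_AE_False by blast
  qed
  then obtain x0 where x0: "\<And>q::rat. g x0 > of_rat q \<longleftrightarrow> above (of_rat q)" by blast
  have eq: "a = b" if "\<And>q::rat. a > of_rat q \<longleftrightarrow> b > of_rat q" for a b :: real
  proof (rule ccontr)
    assume "a \<noteq> b"
    then consider "a < b" | "b < a" by linarith
    then show False
    proof cases
      case 1
      then obtain q where "a < of_rat q" "of_rat q < b" using of_rat_dense by blast
      with that[of q] show False by simp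
    next
      case 2
      then obtain q where "b < of_rat q" "of_rat q < a" using of_rat_dense by blast
      with that[of q] show False by simp
    qed
  qed
  have "AE x in LI. g x = g x0 \<and> g (- x) = g x0"
    using all by eventually_elim (use x0 eq in blast)
  then show thesis by (rule that)
qed

lemma OSC_N_weak_GCC_imp_profile_0:
  fixes g :: "real \<Rightarrow> real"
  assumes osc: "OSC_N T G" and gcc: "weak_GCC T G" and g[measurable]: "g \<in> borel_measurable borel" and per: "\<And>y. g (y + 2) = g y"
    and rel: "AE p in lebesgue. p \<in> G \<longrightarrow> g (- snd p - fst p) + g (snd p - fst p) = 0"
  shows "AE x in LI. g x = 0 \<and> g (- x) = 0"
proof -
  let ?E = "{y. g y > 0}" and ?F = "{y. g y < 0}"
  have m: "?E \<in> sets borel" "?F \<in> sets borel" by measurable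
  have Ep: "y + 2 \<in> ?E \<longleftrightarrow> y \<in> ?E" and Fp: "y + 2 \<in> ?F \<longleftrightarrow> y \<in> ?F" for y by (simp_all add: per)
  note E = label_set_cover[OF m(1)] and F = label_set_cover[OF m(2)]
  have "observable_symmetric_N T G (label_set ?E) (label_set ?F)"
    unfolding observable_symmetric_N_iff[OF E F]
    using rel AE_completion[OF AE_plane_lift_regular]
  proof eventually_elim
    case (elim p)
    show ?case
    proof
      assume p: "p \<in> G"
      then have "lift (snd p - fst p) \<in> I01 \<times> UNIV" "lift (- snd p - fst p) \<in> I01 \<times> UNIV"
        using elim(2) G_snd by blast+
      then show "let a = lift (snd p - fst p); b = lift (- snd p - fst p) in
          (a \<in> label_set ?E \<and> b \<in> label_set ?F) \<or> (a \<in> label_set ?F \<and> b \<in> label_set ?E) \<or>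
          (a \<notin> label_set ?E \<union> label_set ?F \<and> b \<notin> label_set ?E \<union> label_set ?F)"
        using elim(1) p by (auto simp: Let_def lift_mem_label_set[OF Ep] lift_mem_label_set[OF Fp])
    qed
  qed
  moreover have "label_set ?E \<inter> label_set ?F = {}" 
    unfolding label_set_def by (auto split: label.splits) (metis label.exhaust less_asym)+
  ultimately have "trivial_pair (label_set ?E) (label_set ?F)"
    using osc E F by (auto simp: OSC_N_def)
  then have "(AE x in LI. (x, Xi) \<notin> label_set ?E \<and> (x, Eta) \<notin> label_set ?E) \<or> (AE x in LI. (x, Xi) \<notin> label_set ?F \<and> (x, Eta) \<notin> label_set ?F)"
    unfolding trivial_pair_def cover_null_iff[OF E] cover_null_iff[OF F] .
  \<comment> \<open>A trivial pair removes either the positive or the negative values;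
    \<open>s\<close> is -1 or 1 accordingly, so that both cases continue together.\<close>
  then have sign: "\<exists>s::real. s \<noteq> 0 \<and> (AE x in LI. s * g x \<ge> 0 \<and> s * g (- x) \<ge> 0)"
  proof
    assume a: "AE x in LI. (x, Xi) \<notin> label_set ?E \<and> (x, Eta) \<notin> label_set ?E"
    have "AE x in LI. x \<in> I01" by (rule AE_I2) simp
    with a have "AE x in LI. (-1) * g x \<ge> 0 \<and> (-1) * g (- x) \<ge> 0"
      by eventually_elim (simp add: mem_label_set_I01)
    then show ?thesis by (intro exI[of _ "-1"]) simp
  next
    assume a: "AE x in LI. (x, Xi) \<notin> label_set ?F \<and> (x, Eta) \<notin> label_set ?F"
    have "AE x in LI. x \<in> I01" by (rule AE_I2) simp
    with a have "AE x in LI. 1 * g x \<ge> 0 \<and> 1 * g (- x) \<ge> 0"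
      by eventually_elim (simp add: mem_label_set_I01)
    then show ?thesis by (intro exI[of _ 1]) simp
  qed
  then obtain s :: real where s: "s \<noteq> 0" "AE x in LI. s * g x \<ge> 0 \<and> s * g (- x) \<ge> 0" by blast
  have "AE p in lborel. snd p \<in> I01 \<longrightarrow> s * g (snd p - fst p) \<ge> 0 \<and> s * g (- snd p - fst p) \<ge> 0"
    by (rule AE_plane_unfold[OF _ _ s(2)]) (simp_all add: per)
  from AE_completion[OF this] rel
  have "AE p in lebesgue. p \<in> G \<longrightarrow> snd p - fst p \<notin> {y. g y \<noteq> 0} \<and> - snd p - fst p \<notin> {y. g y \<noteq> 0}"
  proof eventually_elim
    case (elim p)
    show ?case
    proof
      assume p: "p \<in> G"
      let ?a = "g (snd p - fst p)" and ?b = "g (- snd p - fst p)"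
      have ab: "s * ?a \<ge> 0" "s * ?b \<ge> 0" "?b = - ?a" using elim p G_snd by auto
      \<comment> \<open>The two values are opposite and, after multiplication by \<open>s\<close>,
        both nonnegative.\<close>
      then have "s * ?a = 0" by simp
      then show "snd p - fst p \<notin> {y. g y \<noteq> 0} \<and> - snd p - fst p \<notin> {y. g y \<noteq> 0}" using s(1) ab(3) by simp
    qed
  qed
  then have "AE x in LI. x \<notin> {y. g y \<noteq> 0} \<and> - x \<notin> {y. g y \<noteq> 0}"
    by (intro weak_GCC_imp_AE gcc) (simp_all add: per)
  then show ?thesis by simp
qed

lemma profile_const_shift:
  fixes g :: "real \<Rightarrow> real"
  assumes [measurable]: "g \<in> borel_measurable borel" and per: "\<And>y. g (y + 2) = g y" and "AE x in LI. g x = c \<and> g (- x) = c"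
  shows "AE x in LI. g (x - t) = c \<and> g (- x - t) = c"
  using assms(3) by (subst AE_unfold_iff) (simp_all add: per)

lemma OSC_D_imp_D_unique:
  assumes osc: "OSC_D T G" shows D_unique
proof (intro ballI allI impI, elim conjE)
  fix u0 u1 u v t
  assume sol: "weak_wave_solution H10 T u0 u1 u v" and van: "vanishes_ae_on T G v" and t: "t \<in> {0..T}"
  interpret weak_solution H10 "-1" T u0 u1 u v by unfold_locales (use sol T in auto)
  obtain g where g: "g \<in> borel_measurable borel" "\<And>y. g (y + 2) = g y"
    "\<And>t. t \<in> {0..T} \<Longrightarrow> AE x in LI. v t x = g (- x - t) + - 1 * g (x - t)"
    by (rule dalembert_representation) (rule that)
  have "AE p in lebesgue. p \<in> G \<longrightarrow> g (- snd p - fst p) = g (snd p - fst p)"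
    using observed_profile_relation[OF van g(1,3)] by simp
  then obtain c where c: "AE x in LI. g x = c \<and> g (- x) = c"
    using OSC_D_imp_profile_const[OF osc g(1,2)] by blast
  \<comment> \<open>The constant cancels because for \<kappa> = - 1 the velocity is a difference of
    two profile values.\<close>
  have "AE x in LI. v t x = 0" if "t \<in> {0..T}" for t
    using g(3)[OF that] profile_const_shift[OF g(1,2) c, of t] by eventually_elim simp
  from v_0_imp_stationary[OF this] show "AE x in LI. u t x = 0" using t by auto
qed

lemma OSC_N_imp_N_unique:
  assumes osc: "OSC_N T G" and gcc: "weak_GCC T G" shows N_unique
proof (intro ballI allI impI, elim conjE)
  fix u0 u1 u v
  assume sol: "weak_wave_solution H1 T u0 u1 u v" and van: "vanishes_ae_on T G v"
  interpret weak_solution H1 1 T u0 u1 u v by unfold_locales (use sol T in auto)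
  obtain g where g: "g \<in> borel_measurable borel" "\<And>y. g (y + 2) = g y"
    "\<And>t. t \<in> {0..T} \<Longrightarrow> AE x in LI. v t x = g (- x - t) + 1 * g (x - t)"
    by (rule dalembert_representation) (rule that)
  have "AE p in lebesgue. p \<in> G \<longrightarrow> g (- snd p - fst p) + g (snd p - fst p) = 0"
    using observed_profile_relation[OF van g(1,3)] by simp
  then have 0: "AE x in LI. g x = 0 \<and> g (- x) = 0"
    by (rule OSC_N_weak_GCC_imp_profile_0[OF osc gcc g(1,2)])
  have "AE x in LI. v t x = 0" if "t \<in> {0..T}" for t
    using g(3)[OF that] profile_const_shift[OF g(1,2) 0, of t] by eventually_elim simp
  from v_0_imp_stationary[OF this] show "\<exists>c. \<forall>t\<in>{0..T}. AE x in LI. u t x = c" by blast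
qed

end

theorem theorem1p2:
  fixes T :: real and G :: "(real \<times> real) set"
  assumes "T > 0" and "G \<in> sets lebesgue" and "G \<subseteq> {0..T} \<times> I01"
  shows "((\<forall>u0\<in>H10. \<forall>u1\<in>L2. \<forall>u ut.
             weak_wave_solution H10 T u0 u1 u ut \<and> vanishes_ae_on T G ut \<longrightarrow>
             (\<forall>t\<in>{0..T}. AE x in lebesgue_on I01. u t x = 0))
          \<longleftrightarrow> OSC_D T G \<and> weak_GCC T G)
       \<and> ((\<forall>u0\<in>H1. \<forall>u1\<in>L2. \<forall>u ut.
             weak_wave_solution H1 T u0 u1 u ut \<and> vanishes_ae_on T G ut \<longrightarrow>
             (\<exists>c. \<forall>t\<in>{0..T}. AE x in lebesgue_on I01. u t x = c))
          \<longleftrightarrow> OSC_N T G \<and> weak_GCC T G)"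
proof -
  interpret observation_set T G by unfold_locales (use assms in auto)
  have D: "D_unique \<longleftrightarrow> OSC_D T G \<and> weak_GCC T G"
  proof
    assume D_unique
    then show "OSC_D T G \<and> weak_GCC T G"
      by (intro conjI D_unique_imp_OSC_D D_unique_imp_weak_GCC)
  next
    assume "OSC_D T G \<and> weak_GCC T G"
    then have "OSC_D T G" by (rule conjunct1)
    then show D_unique by (rule OSC_D_imp_D_unique)
  qed
  have N: "N_unique \<longleftrightarrow> OSC_N T G \<and> weak_GCC T G"
  proof
    assume N_unique
    then show "OSC_N T G \<and> weak_GCC T G"
      by (intro conjI N_unique_imp_OSC_N N_unique_imp_weak_GCC)
  next
    assume c: "OSC_N T G \<and> weak_GCC T G"
    show N_unique by (rule OSC_N_imp_N_unique[OF conjunct1[OF c] conjunct2[OF c]])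
  qed
  show ?thesis by (rule conjI[OF D N])
qed

end
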